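(* Let $\boldsymbol u_0\in BV_{\mathrm{rad}}(I,\mathcal N)$. There exists $T^*\ge0$ (depending on $\boldsymbol u_0$ but not on the solution) such that the following holds: if $T\in\,]T^*,+\infty]$ and $\boldsymbol u$ is a strong solution in $[0,T[$ (in the sense defined in the context) with initial datum $\boldsymbol u(0)=\boldsymbol u_0$ satisfying $$TV_I^{\mathcal N}(\boldsymbol u(t))+\int_0^t\int_I|\boldsymbol u_t|^2\,dx\,d\tau\le TV_I^{\mathcal N}(\boldsymbol u_0)\quad\text{for a.e. }t\in\,]0,T[$$ and $$|\boldsymbol u_x(t)|_{\mathcal N}\le|\boldsymbol u_x(s)|_{\mathcal N}\le|(\boldsymbol u_0)_x|_{\mathcal N}\quad\text{as measures on } I,\ \text{for a.e. }s,t\in\,]0,T[\text{ with }s\le t,$$ then there exists $\overline{\boldsymbol u}\in\mathcal N$ such that $\boldsymbol u\equiv\overline{\boldsymbol u}$ in $[T^*,T[$.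
   Context: **Setting.** $(\mathcal N,g)$ is a complete, connected $n$-dimensional Riemannian manifold without boundary, isometrically embedded in $\mathbb R^N$ with closed embedding, whose sectional curvature is bounded from above; $K_{\mathcal N}<\infty$ is the supremum of all sectional curvatures at all points, $\mathrm{inj}_{\mathcal N}$ the injectivity radius, $\mathrm{dist}_{\mathcal N}$ the geodesic distance, $\pi_{\boldsymbol p}:\mathbb R^N\to T_{\boldsymbol p}\mathcal N$ the orthogonal projection, $\log_{\boldsymbol p}$ the inverse of the exponential map $\exp_{\boldsymbol p}$. $I\subset\mathbb R$ is a bounded open interval. Spaces of $\mathcal N$-valued functions, such as $BV(I,\mathcal N)$ and $L^2(I,\mathcal N)$, consist of the functions in the corresponding $\mathbb R^N$-valued space with values in $\mathcal N$ a.e. **BV functions.** Each $\boldsymbol w\in BV(I,\mathbb R^N)$ is identified with a representative having one-sided (left/right) limits $\boldsymbol w^\mp(x)$ at each $x\in I$, and extended to $\overline I$ by one-sided limits. $J_{\boldsymbol w}=\{\boldsymbol w^-\ne\boldsymbol w^+\}$ is the (countable) jump set. The derivative measure decomposes as $\boldsymbol w_x=\boldsymbol w_x^d+\boldsymbol w_x^j$, with $\boldsymbol w_x^j=(\boldsymbol w^+-\boldsymbol w^-)\mathcal H^0$ restricted to $J_{\boldsymbol w}$ and $\boldsymbol w_x^d$ the diffuse part; also $\boldsymbol w_x=\boldsymbol w_x^a\mathcal L^1+\boldsymbol w_x^c+\boldsymbol w_x^j$ with $\boldsymbol w_x^a$ the density of the absolutely continuous part and $\boldsymbol w_x^c$ the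 Cantor part. For $\boldsymbol w\in BV(I,\mathcal N)$, $|\boldsymbol w_x|_{\mathcal N}$ is the measure $$|\boldsymbol w_x|_{\mathcal N}(A)=|\boldsymbol w_x^d|(A)+\sum_{x\in A\cap J_{\boldsymbol w}}\mathrm{dist}_{\mathcal N}(\boldsymbol w^-(x),\boldsymbol w^+(x)).$$ $TV_I^{\mathcal N}:L^2(I,\mathcal N)\to[0,\infty]$ is the lower semicontinuous envelope of $\boldsymbol w\mapsto\int_I|\boldsymbol w_x|$ defined on $C^1(\overline I,\mathcal N)$; it satisfies $TV_I^{\mathcal N}(\boldsymbol w)=|\boldsymbol w_x|_{\mathcal N}(I)$ for $\boldsymbol w\in BV(I,\mathcal N)$. **rad.** $\mathrm{rad}_{\mathcal N}=\frac12\min\{\mathrm{inj}_{\mathcal N},\pi/\sqrt{K_{\mathcal N}}\}$ if $K_{\mathcal N}>0$ and $\mathrm{rad}_{\mathcal N}=\frac12\mathrm{inj}_{\mathcal N}$ if $K_{\mathcal N}\le0$. $BV_{\mathrm{rad}}(I,\mathcal N)$ is the set of $\boldsymbol w\in BV(I,\mathcal N)$ with $\mathrm{dist}_{\mathcal N}(\boldsymbol w^-(x),\boldsymbol w^+(x))<2\,\mathrm{rad}_{\mathcal N}$ for all $x\in I$. **Tangents at jumps.** If $\mathrm{dist}_{\mathcal N}(\boldsymbol w^-,\boldsymbol w^+)<\mathrm{inj}_{\mathcal N}$ on $J_{\boldsymbol w}$, then on $J_{\boldsymbol w}$ $$\boldsymbol T^-_{\boldsymbol w}=\frac{\log_{\boldsymbol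 w^-}\boldsymbol w^+}{\mathrm{dist}_{\mathcal N}(\boldsymbol w^-,\boldsymbol w^+)},\qquad \boldsymbol T^+_{\boldsymbol w}=-\frac{\log_{\boldsymbol w^+}\boldsymbol w^-}{\mathrm{dist}_{\mathcal N}(\boldsymbol w^-,\boldsymbol w^+)}.$$ **Weak-* spaces.** For a dual space $X^*$, $L^p_{w^*}(0,T;X^* )$ is the space of weakly-* measurable functions $(0,T)\to X^*$ with $p$-integrable norm (essentially bounded if $p=\infty$); here $L^\infty(I)=L^1(I)^*$, and $BV(I)=X^*$ with $X=\{\varphi+\psi_x:\varphi,\psi\in C_0(I)\}$. The subscript $loc([0,T[)$ means that the property holds on $]0,T'[$ for each $T'<T$. **Strong solution.** Let $T\in\,]0,+\infty]$ and $\boldsymbol u\in H^1_{loc}([0,T[;L^2(I,\mathcal N))\cap L^\infty_{loc}([0,T[;BV(I,\mathcal N))$ be such that $\mathrm{dist}_{\mathcal N}(\boldsymbol u^-(t,x),\boldsymbol u^+(t,x))<\mathrm{inj}_{\mathcal N}$ for all $x\in I$ and a.e. $t\in\,]0,T[$. $\boldsymbol u$ is a strong solution in $[0,T[$ if there is $\boldsymbol z\in L^\infty_{w^*}(0,T;L^\infty(I,\mathbb R^N))\cap L^2_{w^*,loc}([0,T[;BV(I,\mathbb R^N))$ such that for a.e. $t\in\,]0,T[$: 1. $\boldsymbol u_t(t)=\pi_{\boldsymbol u(t)}\boldsymbol z_x^a(t)$ $\mathcal L^1$-a.e. in $I$; 2. $\pi_{\boldsymbol u(t)}\boldsymbol z_x^c(t)=0$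 as measures; 3. $\boldsymbol z^\pm(t)\in T_{\boldsymbol u^\pm(t)}\mathcal N$ in $I$; 4. $|\boldsymbol z(t)|\le1$ in $I$; 5. $\boldsymbol z(t)=\frac{\boldsymbol u_x(t)}{|\boldsymbol u_x(t)|}$ (Radon–Nikodym derivative) $|\boldsymbol u_x^d(t)|$-a.e. in $I$; 6. $J_{\boldsymbol z(t)}\subseteq J_{\boldsymbol u(t)}$; 7. $\boldsymbol z^\pm(t)=\boldsymbol T^\pm_{\boldsymbol u(t)}$ on $J_{\boldsymbol u(t)}$; 8. $\boldsymbol z(t)=0$ on $\partial I$. *)

theory Defs
  imports "HOL-Analysis.Analysis"
begin

section \<open>Embedded Riemannian manifolds\<close>

text \<open>The manifold is a subset \<open>N\<close> of a Euclidean space with the metric induced by the ambient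
  inner product.\<close>

primrec Ck_on :: "nat \<Rightarrow> 'a::real_normed_vector set \<Rightarrow> ('a \<Rightarrow> 'b::real_normed_vector) \<Rightarrow> bool" where
  "Ck_on 0 S f \<longleftrightarrow> continuous_on S f"
| "Ck_on (Suc k) S f \<longleftrightarrow> (\<forall>x\<in>S. f differentiable (at x)) \<and>
     (\<forall>v. Ck_on k S (\<lambda>x. frechet_derivative f (at x) v))"

text \<open>Meant for open \<open>S\<close>.\<close>

definition smooth_on :: "'a::real_normed_vector set \<Rightarrow> ('a \<Rightarrow> 'b::real_normed_vector) \<Rightarrow> bool" where
  "smooth_on S f \<longleftrightarrow> (\<forall>k. Ck_on k S f)"

text \<open>On arbitrary subsets \<open>X\<close>, smooth means: locally the restriction of a smooth ambient map.\<close>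

definition smooth_map :: "'a::real_normed_vector set \<Rightarrow> ('a \<Rightarrow> 'b::real_normed_vector) \<Rightarrow> bool" where
  "smooth_map X f \<longleftrightarrow>
     (\<forall>x\<in>X. \<exists>U F. open U \<and> x \<in> U \<and> smooth_on U F \<and> (\<forall>y\<in>X \<inter> U. F y = f y))"

definition diffeo :: "'a::real_normed_vector set \<Rightarrow> 'b::real_normed_vector set \<Rightarrow> ('a \<Rightarrow> 'b) \<Rightarrow> bool" where
  "diffeo X Y f \<longleftrightarrow> bij_betw f X Y \<and> smooth_map X f \<and> smooth_map Y (inv_into X f)"

definition smooth_submanifold :: "nat \<Rightarrow> 'a::euclidean_space set \<Rightarrow> bool" where
  "smooth_submanifold n N \<longleftrightarrow>
     (\<forall>p\<in>N. \<exists>U V \<Phi> \<Psi> L. open U \<and> p \<in> U \<and> open (V :: 'a set) \<and> homeomorphism U V \<Phi> \<Psi> \<and>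
        smooth_on U \<Phi> \<and> smooth_on V \<Psi> \<and> subspace L \<and> dim L = n \<and> \<Phi> ` (N \<inter> U) = L \<inter> V)"

definition curve_through ::
  "'a::euclidean_space set \<Rightarrow> 'a \<Rightarrow> 'a \<Rightarrow> (real \<Rightarrow> 'a) \<Rightarrow> bool" where
  "curve_through N p v \<gamma> \<longleftrightarrow>
     (\<exists>e>0. smooth_on {-e<..<e} \<gamma> \<and> \<gamma> ` {-e<..<e} \<subseteq> N) \<and>
     \<gamma> 0 = p \<and> (\<gamma> has_vector_derivative v) (at 0)"

definition tangent_space :: "'a::euclidean_space set \<Rightarrow> 'a \<Rightarrow> 'a set" where
  "tangent_space N p = {v. \<exists>\<gamma>. curve_through N p v \<gamma>}"

definition tproj :: "'a::euclidean_space set \<Rightarrow> 'a \<Rightarrow> 'a \<Rightarrow> 'a" where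
  "tproj N p v = (THE w. w \<in> tangent_space N p \<and> (\<forall>y\<in>tangent_space N p. (v - w) \<bullet> y = 0))"

text \<open>Library paths that are \<open>C1\<close> off a finite set may have infinite length,
  so the length is an extended nonnegative integral.\<close>

definition path_len :: "(real \<Rightarrow> 'a::euclidean_space) \<Rightarrow> ennreal" where
  "path_len g = (\<integral>\<^sup>+ t\<in>{0..1}. ennreal (norm (vector_derivative g (at t))) \<partial>lborel)"

definition geo_dist :: "'a::euclidean_space set \<Rightarrow> 'a \<Rightarrow> 'a \<Rightarrow> real" where
  "geo_dist N p q = enn2real (INF g\<in>{g. valid_path g \<and> path_image g \<subseteq> N \<and>
      pathstart g = p \<and> pathfinish g = q}. path_len g)"

text \<open>The Levi-Civita connection of the induced metric is the tangential part of the ambient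
  derivative; thus a curve is a geodesic iff the tangential part of its acceleration vanishes.\<close>

definition geodesic :: "'a::euclidean_space set \<Rightarrow> (real \<Rightarrow> 'a) \<Rightarrow> bool" where
  "geodesic N \<gamma> \<longleftrightarrow> smooth_on UNIV \<gamma> \<and> (\<forall>t. \<gamma> t \<in> N) \<and>
     (\<forall>t. tproj N (\<gamma> t) (vector_derivative (\<lambda>s. vector_derivative \<gamma> (at s)) (at t)) = 0)"

definition geodesic_from :: "'a::euclidean_space set \<Rightarrow> 'a \<Rightarrow> 'a \<Rightarrow> (real \<Rightarrow> 'a) \<Rightarrow> bool" where
  "geodesic_from N p v \<gamma> \<longleftrightarrow> geodesic N \<gamma> \<and> \<gamma> 0 = p \<and> (\<gamma> has_vector_derivative v) (at 0)"

definition geodesically_complete :: "'a::euclidean_space set \<Rightarrow> bool" where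
  "geodesically_complete N \<longleftrightarrow> (\<forall>p\<in>N. \<forall>v\<in>tangent_space N p. \<exists>\<gamma>. geodesic_from N p v \<gamma>)"

definition exp_map :: "'a::euclidean_space set \<Rightarrow> 'a \<Rightarrow> 'a \<Rightarrow> 'a" where
  "exp_map N p v = (SOME \<gamma>. geodesic_from N p v \<gamma>) 1"

definition inj_radius_at :: "'a::euclidean_space set \<Rightarrow> 'a \<Rightarrow> ereal" where
  "inj_radius_at N p = Sup {ereal r | r. 0 < r \<and>
     diffeo {v \<in> tangent_space N p. norm v < r} {q \<in> N. geo_dist N p q < r} (exp_map N p)}"

definition inj_radius :: "'a::euclidean_space set \<Rightarrow> ereal" where
  "inj_radius N = (INF p\<in>N. inj_radius_at N p)"

definition log_map :: "'a::euclidean_space set \<Rightarrow> 'a \<Rightarrow> 'a \<Rightarrow> 'a" where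
  "log_map N p = inv_into {v \<in> tangent_space N p. ereal (norm v) < inj_radius_at N p} (exp_map N p)"

text \<open>Derivative at \<open>p \<in> N\<close> of a map defined on \<open>N\<close> only, in the tangent direction \<open>v\<close>.\<close>

definition dir_deriv :: "'a::euclidean_space set \<Rightarrow> ('a \<Rightarrow> 'a) \<Rightarrow> 'a \<Rightarrow> 'a \<Rightarrow> 'a" where
  "dir_deriv N W p v =
     (THE d. \<forall>\<gamma>. curve_through N p v \<gamma> \<longrightarrow> ((W \<circ> \<gamma>) has_vector_derivative d) (at 0))"

definition vfield :: "'a::euclidean_space set \<Rightarrow> ('a \<Rightarrow> 'a) \<Rightarrow> bool" where
  "vfield N X \<longleftrightarrow> smooth_map N X \<and> (\<forall>p\<in>N. X p \<in> tangent_space N p)"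

definition cov_deriv :: "'a::euclidean_space set \<Rightarrow> ('a \<Rightarrow> 'a) \<Rightarrow> ('a \<Rightarrow> 'a) \<Rightarrow> 'a \<Rightarrow> 'a" where
  "cov_deriv N X Y p = tproj N p (dir_deriv N Y p (X p))"

definition lie_bracket :: "'a::euclidean_space set \<Rightarrow> ('a \<Rightarrow> 'a) \<Rightarrow> ('a \<Rightarrow> 'a) \<Rightarrow> 'a \<Rightarrow> 'a" where
  "lie_bracket N X Y p = dir_deriv N Y p (X p) - dir_deriv N X p (Y p)"

definition riemann :: "'a::euclidean_space set \<Rightarrow> ('a \<Rightarrow> 'a) \<Rightarrow> ('a \<Rightarrow> 'a) \<Rightarrow> ('a \<Rightarrow> 'a) \<Rightarrow> 'a \<Rightarrow> 'a" where
  "riemann N X Y Z p = cov_deriv N X (cov_deriv N Y Z) p - cov_deriv N Y (cov_deriv N X Z) p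
     - cov_deriv N (lie_bracket N X Y) Z p"

text \<open>The planes are spanned by the values of two vector fields. If \<open>dim N \<le> 1\<close> the set is empty and the
  supremum is \<open>-\<infinity>\<close>.\<close>

definition sectional_curvatures :: "'a::euclidean_space set \<Rightarrow> real set" where
  "sectional_curvatures N =
     {(riemann N X Y Y p \<bullet> X p) / ((X p \<bullet> X p) * (Y p \<bullet> Y p) - (X p \<bullet> Y p)\<^sup>2) | X Y p.
        p \<in> N \<and> vfield N X \<and> vfield N Y \<and> X p \<noteq> Y p \<and> independent {X p, Y p}}"

definition curv_sup :: "'a::euclidean_space set \<Rightarrow> ereal" where
  "curv_sup N = (SUP c\<in>sectional_curvatures N. ereal c)"

definition rad :: "'a::euclidean_space set \<Rightarrow> ereal" where
  "rad N = (if curv_sup N > 0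
      then min (inj_radius N) (ereal (pi / sqrt (real_of_ereal (curv_sup N)))) / 2
      else inj_radius N / 2)"


section \<open>Functions of bounded variation on an open interval \<open>I\<close>\<close>

text \<open>Elements of function spaces are Borel representatives of a.e. classes.\<close>

abbreviation leb :: "real set \<Rightarrow> real measure" where
  "leb S \<equiv> restrict_space lborel S"

definition test_fun :: "real set \<Rightarrow> (real \<Rightarrow> real) \<Rightarrow> bool" where
  "test_fun S \<phi> \<longleftrightarrow> \<phi> C1_differentiable_on UNIV \<and>
     (\<exists>K. compact K \<and> K \<subseteq> S \<and> (\<forall>x. x \<notin> K \<longrightarrow> \<phi> x = 0))"

text \<open>A finite vector measure is represented by its polar decomposition \<open>\<sigma> \<mu>\<close>, where \<open>\<mu>\<close> is the total
  variation measure and \<open>|\<sigma>| = 1\<close> holds \<open>\<mu>\<close>-a.e. The measure \<open>\<mu>\<close> is uniquely determined, and \<open>\<sigma>\<close> is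
  determined up to \<open>\<mu>\<close>-null sets.\<close>

definition has_deriv_polar ::
  "real set \<Rightarrow> (real \<Rightarrow> 'a::euclidean_space) \<Rightarrow> real measure \<Rightarrow> (real \<Rightarrow> 'a) \<Rightarrow> bool" where
  "has_deriv_polar I w \<mu> \<sigma> \<longleftrightarrow>
     sets \<mu> = sets (leb I) \<and> finite_measure \<mu> \<and> \<sigma> \<in> borel_measurable \<mu> \<and>
     (AE x in \<mu>. norm (\<sigma> x) = 1) \<and>
     (\<forall>\<phi>. test_fun I \<phi> \<longrightarrow>
        (LINT x|leb I. deriv \<phi> x *\<^sub>R w x) = - (LINT x|\<mu>. \<phi> x *\<^sub>R \<sigma> x))"

definition bv :: "real set \<Rightarrow> (real \<Rightarrow> 'a::euclidean_space) \<Rightarrow> bool" where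
  "bv I w \<longleftrightarrow> integrable (leb I) w \<and> (\<exists>\<mu> \<sigma>. has_deriv_polar I w \<mu> \<sigma>)"

definition deriv_polar :: "real set \<Rightarrow> (real \<Rightarrow> 'a::euclidean_space) \<Rightarrow> real measure \<times> (real \<Rightarrow> 'a)" where
  "deriv_polar I w = (SOME P. has_deriv_polar I w (fst P) (snd P))"

text \<open>\<open>tv_meas\<close> is the measure \<open>|w_x|\<close> and \<open>dens\<close> is the Radon--Nikodym derivative \<open>w_x / |w_x|\<close>.\<close>

definition tv_meas :: "real set \<Rightarrow> (real \<Rightarrow> 'a::euclidean_space) \<Rightarrow> real measure" where
  "tv_meas I w = fst (deriv_polar I w)"

definition dens :: "real set \<Rightarrow> (real \<Rightarrow> 'a::euclidean_space) \<Rightarrow> real \<Rightarrow> 'a" where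
  "dens I w = snd (deriv_polar I w)"

text \<open>One-sided limits of a good representative; they depend only on the a.e. class of \<open>w\<close> and make
  sense also at the endpoints of \<open>I\<close> (from the inside).\<close>

definition lft :: "real set \<Rightarrow> (real \<Rightarrow> 'a::euclidean_space) \<Rightarrow> real \<Rightarrow> 'a" where
  "lft I w x = (THE l. \<exists>v. (AE y in leb I. v y = w y) \<and> (v \<longlongrightarrow> l) (at_left x))"

definition rgt :: "real set \<Rightarrow> (real \<Rightarrow> 'a::euclidean_space) \<Rightarrow> real \<Rightarrow> 'a" where
  "rgt I w x = (THE l. \<exists>v. (AE y in leb I. v y = w y) \<and> (v \<longlongrightarrow> l) (at_right x))"

definition jump_set :: "real set \<Rightarrow> (real \<Rightarrow> 'a::euclidean_space) \<Rightarrow> real set" where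
  "jump_set I w = {x \<in> I. lft I w x \<noteq> rgt I w x}"

text \<open>The parts of the derivative are restrictions of \<open>w_x\<close> to Borel sets, so they all share the
  polar density \<open>dens I w\<close>. The jump part is carried by the countable set \<open>jump_set I w\<close>, which
  contains all atoms of \<open>w_x\<close>; \<open>sing_set I w\<close> is a Lebesgue null set carrying the
  singular part.\<close>

definition tv_diffuse :: "real set \<Rightarrow> (real \<Rightarrow> 'a::euclidean_space) \<Rightarrow> real measure" where
  "tv_diffuse I w = density (tv_meas I w) (indicator (I - jump_set I w))"

definition sing_set :: "real set \<Rightarrow> (real \<Rightarrow> 'a::euclidean_space) \<Rightarrow> real set" where
  "sing_set I w = (SOME S. S \<in> null_sets (leb I) \<and>
     absolutely_continuous (leb I) (density (tv_meas I w) (indicator (I - S))))"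

definition ac_density :: "real set \<Rightarrow> (real \<Rightarrow> 'a::euclidean_space) \<Rightarrow> real \<Rightarrow> 'a" where
  "ac_density I w x =
     enn2real (RN_deriv (leb I) (density (tv_meas I w) (indicator (I - sing_set I w))) x)
       *\<^sub>R dens I w x"

definition tv_cantor :: "real set \<Rightarrow> (real \<Rightarrow> 'a::euclidean_space) \<Rightarrow> real measure" where
  "tv_cantor I w = density (tv_diffuse I w) (indicator (sing_set I w))"

definition bv_norm :: "real set \<Rightarrow> (real \<Rightarrow> 'a::euclidean_space) \<Rightarrow> ennreal" where
  "bv_norm I w = (\<integral>\<^sup>+ x. ennreal (norm (w x)) \<partial>leb I) + emeasure (tv_meas I w) I"

definition bvN :: "'a::euclidean_space set \<Rightarrow> real set \<Rightarrow> (real \<Rightarrow> 'a) \<Rightarrow> bool" where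
  "bvN N I w \<longleftrightarrow> bv I w \<and> (AE x in leb I. w x \<in> N)"

definition BV_rad :: "'a::euclidean_space set \<Rightarrow> real set \<Rightarrow> (real \<Rightarrow> 'a) set" where
  "BV_rad N I = {w. bvN N I w \<and>
     (\<forall>x\<in>I. ereal (geo_dist N (lft I w x) (rgt I w x)) < 2 * rad N)}"

text \<open>The measure \<open>|w_x|_N\<close>, as a set function on Borel subsets of \<open>I\<close>.\<close>

definition varN :: "'a::euclidean_space set \<Rightarrow> real set \<Rightarrow> (real \<Rightarrow> 'a) \<Rightarrow> real set \<Rightarrow> ennreal" where
  "varN N I w A = emeasure (tv_diffuse I w) A +
     (\<integral>\<^sup>+ x. ennreal (geo_dist N (lft I w x) (rgt I w x)) \<partial>count_space (A \<inter> jump_set I w))"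

definition L2N :: "'a::euclidean_space set \<Rightarrow> real set \<Rightarrow> (real \<Rightarrow> 'a) set" where
  "L2N N I = {w. w \<in> borel_measurable (leb I) \<and>
     (\<integral>\<^sup>+ x. ennreal ((norm (w x))\<^sup>2) \<partial>leb I) < \<infinity> \<and> (AE x in leb I. w x \<in> N)}"

definition L2_lsc :: "'a::euclidean_space set \<Rightarrow> real set \<Rightarrow> ((real \<Rightarrow> 'a) \<Rightarrow> ennreal) \<Rightarrow> bool" where
  "L2_lsc N I G \<longleftrightarrow>
     (\<forall>W w. w \<in> L2N N I \<and> (\<forall>k. W k \<in> L2N N I) \<and>
        (\<lambda>k. \<integral>\<^sup>+ x. ennreal ((norm (W k x - w x))\<^sup>2) \<partial>leb I) \<longlonglongrightarrow> 0
        \<longrightarrow> G w \<le> liminf (\<lambda>k. G (W k)))"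

text \<open>The envelope is the largest lower semicontinuous minorant of the length functional,
  which is \<open>\<infinity>\<close> off \<open>C1 (closure I)\<close>.\<close>

definition TV :: "'a::euclidean_space set \<Rightarrow> real set \<Rightarrow> (real \<Rightarrow> 'a) \<Rightarrow> ennreal" where
  "TV N I w = (SUP G\<in>{G. L2_lsc N I G \<and>
      (\<forall>v. v C1_differentiable_on (closure I) \<and> v ` closure I \<subseteq> N \<longrightarrow>
         G v \<le> (\<integral>\<^sup>+ x. ennreal (norm (vector_derivative v (at x))) \<partial>leb I))}. G w)"


section \<open>Strong solutions\<close>

definition time_int :: "ereal \<Rightarrow> real set" where
  "time_int T = {t. 0 < t \<and> ereal t < T}"

definition L2_cyl :: "real set \<Rightarrow> real \<Rightarrow> (real \<Rightarrow> real \<Rightarrow> 'a::euclidean_space) \<Rightarrow> bool" where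
  "L2_cyl I T' u \<longleftrightarrow> (\<lambda>(t, x). u t x) \<in> borel_measurable (leb {0<..<T'} \<Otimes>\<^sub>M leb I) \<and>
     (\<integral>\<^sup>+ t. \<integral>\<^sup>+ x. ennreal ((norm (u t x))\<^sup>2) \<partial>leb I \<partial>leb {0<..<T'}) < \<infinity>"

definition has_weak_dt ::
  "real set \<Rightarrow> ereal \<Rightarrow> (real \<Rightarrow> real \<Rightarrow> 'a::euclidean_space) \<Rightarrow> (real \<Rightarrow> real \<Rightarrow> 'a) \<Rightarrow> bool" where
  "has_weak_dt I T u v \<longleftrightarrow> (\<forall>T'\<in>time_int T. L2_cyl I T' v) \<and>
     (\<forall>\<phi>. test_fun (time_int T) \<phi> \<longrightarrow>
        (AE x in leb I. (LINT t|leb (time_int T). deriv \<phi> t *\<^sub>R u t x)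
            = - (LINT t|leb (time_int T). \<phi> t *\<^sub>R v t x)))"

definition weak_dt ::
  "real set \<Rightarrow> ereal \<Rightarrow> (real \<Rightarrow> real \<Rightarrow> 'a::euclidean_space) \<Rightarrow> real \<Rightarrow> real \<Rightarrow> 'a" where
  "weak_dt I T u = (SOME v. has_weak_dt I T u v)"

text \<open>\<open>H1_loc ([0,T[; L2 (I,N))\<close>; such \<open>u\<close> is identified with its representative that is continuous from
  \<open>[0,T[\<close> to \<open>L2\<close>, so that \<open>u t\<close> is meaningful for every \<open>t\<close>.\<close>

definition H1_loc :: "'a::euclidean_space set \<Rightarrow> real set \<Rightarrow> ereal \<Rightarrow> (real \<Rightarrow> real \<Rightarrow> 'a) \<Rightarrow> bool" where
  "H1_loc N I T u \<longleftrightarrow>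
     (\<forall>T'\<in>time_int T. L2_cyl I T' u) \<and> (\<exists>v. has_weak_dt I T u v) \<and>
     (\<forall>t. 0 \<le> t \<and> ereal t < T \<longrightarrow> u t \<in> L2N N I \<and>
        ((\<lambda>s. \<integral>\<^sup>+ x. ennreal ((norm (u s x - u t x))\<^sup>2) \<partial>leb I) \<longlongrightarrow> 0)
          (at t within {s. 0 \<le> s \<and> ereal s < T}))"

definition Linf_loc_BV :: "'a::euclidean_space set \<Rightarrow> real set \<Rightarrow> ereal \<Rightarrow> (real \<Rightarrow> real \<Rightarrow> 'a) \<Rightarrow> bool" where
  "Linf_loc_BV N I T u \<longleftrightarrow> (\<forall>T'\<in>time_int T. \<exists>C::real.
     AE t in leb {0<..<T'}. bvN N I (u t) \<and> bv_norm I (u t) \<le> ennreal C)"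

definition Linf_wstar :: "real set \<Rightarrow> ereal \<Rightarrow> (real \<Rightarrow> real \<Rightarrow> 'a::euclidean_space) \<Rightarrow> bool" where
  "Linf_wstar I T z \<longleftrightarrow>
     (\<forall>\<phi>. integrable (leb I) \<phi> \<longrightarrow>
        (\<lambda>t. LINT x|leb I. z t x \<bullet> \<phi> x) \<in> borel_measurable (lebesgue_on (time_int T))) \<and>
     (\<exists>C. AE t in leb (time_int T).
        z t \<in> borel_measurable (leb I) \<and> (AE x in leb I. norm (z t x) \<le> C))"

text \<open>\<open>C_0 (I)\<close>, its elements being extended by zero.\<close>

definition C0 :: "real set \<Rightarrow> (real \<Rightarrow> 'a::euclidean_space) \<Rightarrow> bool" where
  "C0 I \<phi> \<longleftrightarrow> continuous_on UNIV \<phi> \<and> (\<forall>x. x \<notin> I \<longrightarrow> \<phi> x = 0)"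

text \<open>\<open>L2_loc\<close> in time, weakly-* measurable with values in \<open>BV\<close>; the pairing of \<open>w\<close> with \<open>\<phi> + \<psi>_x\<close> is
  \<open>\<integral> w \<bullet> \<phi> dx - \<integral> \<psi> \<bullet> dw_x\<close>.\<close>

definition L2_loc_wstar_BV :: "real set \<Rightarrow> ereal \<Rightarrow> (real \<Rightarrow> real \<Rightarrow> 'a::euclidean_space) \<Rightarrow> bool" where
  "L2_loc_wstar_BV I T z \<longleftrightarrow> (\<forall>T'\<in>time_int T.
     (AE t in leb {0<..<T'}. bv I (z t)) \<and>
     (\<forall>\<phi> \<psi>. C0 I \<phi> \<and> C0 I \<psi> \<longrightarrow>
        (\<lambda>t. (LINT x|leb I. z t x \<bullet> \<phi> x) - (LINT x|tv_meas I (z t). \<psi> x \<bullet> dens I (z t) x))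
          \<in> borel_measurable (lebesgue_on {0<..<T'})) \<and>
     (\<integral>\<^sup>+ t. (bv_norm I (z t))\<^sup>2 \<partial>lebesgue_on {0<..<T'}) < \<infinity>)"

definition Tminus :: "'a::euclidean_space set \<Rightarrow> real set \<Rightarrow> (real \<Rightarrow> 'a) \<Rightarrow> real \<Rightarrow> 'a" where
  "Tminus N I w x =
     log_map N (lft I w x) (rgt I w x) /\<^sub>R geo_dist N (lft I w x) (rgt I w x)"

definition Tplus :: "'a::euclidean_space set \<Rightarrow> real set \<Rightarrow> (real \<Rightarrow> 'a) \<Rightarrow> real \<Rightarrow> 'a" where
  "Tplus N I w x =
     - (log_map N (rgt I w x) (lft I w x) /\<^sub>R geo_dist N (lft I w x) (rgt I w x))"

text \<open>At a fixed time: \<open>w = u t\<close>, \<open>wt = u_t t\<close>, \<open>\<zeta> = z t\<close> on \<open>I = ]a,b[\<close>. Off the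
  (countable) jump sets the left limit is the value of the function; diffuse measures do not charge
  the jump sets. A measure \<open>f |\<zeta>_x^c|\<close> vanishes iff \<open>f = 0\<close> holds \<open>|\<zeta>_x^c|\<close>-a.e.\<close>

definition strong_conditions ::
  "'a::euclidean_space set \<Rightarrow> real \<Rightarrow> real \<Rightarrow> (real \<Rightarrow> 'a) \<Rightarrow> (real \<Rightarrow> 'a) \<Rightarrow> (real \<Rightarrow> 'a) \<Rightarrow> bool" where
  "strong_conditions N a b w wt \<zeta> \<longleftrightarrow> (let I = {a<..<b} in
     (AE x in leb I. wt x = tproj N (w x) (ac_density I \<zeta> x)) \<and>
     (AE x in tv_cantor I \<zeta>. tproj N (lft I w x) (dens I \<zeta> x) = 0) \<and>
     (\<forall>x\<in>I. lft I \<zeta> x \<in> tangent_space N (lft I w x) \<and>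
             rgt I \<zeta> x \<in> tangent_space N (rgt I w x)) \<and>
     (\<forall>x\<in>I. norm (lft I \<zeta> x) \<le> 1 \<and> norm (rgt I \<zeta> x) \<le> 1) \<and>
     (AE x in tv_diffuse I w. lft I \<zeta> x = dens I w x) \<and>
     jump_set I \<zeta> \<subseteq> jump_set I w \<and>
     (\<forall>x\<in>jump_set I w. lft I \<zeta> x = Tminus N I w x \<and> rgt I \<zeta> x = Tplus N I w x) \<and>
     rgt I \<zeta> a = 0 \<and> lft I \<zeta> b = 0)"

definition strong_solution ::
  "'a::euclidean_space set \<Rightarrow> real \<Rightarrow> real \<Rightarrow> ereal \<Rightarrow> (real \<Rightarrow> real \<Rightarrow> 'a) \<Rightarrow> bool" where
  "strong_solution N a b T u \<longleftrightarrow> (let I = {a<..<b} in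
     H1_loc N I T u \<and> Linf_loc_BV N I T u \<and>
     (AE t in leb (time_int T). \<forall>x\<in>I.
        ereal (geo_dist N (lft I (u t) x) (rgt I (u t) x)) < inj_radius N) \<and>
     (\<exists>z. Linf_wstar I T z \<and> L2_loc_wstar_BV I T z \<and>
        (AE t in leb (time_int T). strong_conditions N a b (u t) (weak_dt I T u t) (z t))))"

end

theory Submission
  imports Defs
begin

text \<open>
  A strong solution that is not yet constant in space dissipates energy at a rate bounded below by a
  constant depending only on the interval, and only a finite amount of energy is available.

  Fix a good time, let \<open>w\<close> be the solution and \<open>\<zeta>\<close> the vector field \<open>z\<close> at that time, and follow
  \<open>|\<zeta>|\<^sup>2\<close> along the interval, starting from its value \<open>0\<close> at the left end. As \<open>\<zeta>\<close> is tangent to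
  \<open>N\<close> along \<open>w\<close>, only the tangential part of \<open>\<zeta>\<^sub>x\<close> contributes to the derivative \<open>2 \<zeta> \<bullet> \<zeta>\<^sub>x\<close>
  off the jumps: it is \<open>w\<^sub>t\<close> for the absolutely continuous part and \<open>0\<close> for the Cantor part. A jump of
  \<open>\<zeta>\<close> is a jump of \<open>w\<close>, where the left limit of \<open>\<zeta>\<close> is a unit vector, so \<open>|\<zeta>|\<close> cannot
  increase there because \<open>|\<zeta>| \<le> 1\<close>. If \<open>w\<close> is not constant, then \<open>|\<zeta>| = 1\<close> somewhere: at a jump of
  \<open>w\<close>, or else almost everywhere for the diffuse part of \<open>|w\<^sub>x|\<close>. Hence \<open>1 \<le> 2 \<integral>|w\<^sub>t|\<close>, and
  \<open>\<integral>|w\<^sub>t|\<^sup>2 \<ge> 1 / (4 |I|)\<close> by Young's inequality (\<open>velocity_L1_ge_1\<close> and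
  \<open>L2_lower_bound_if_L1_ge_1\<close>). The energy inequality then forces the solution to become constant in
  space before any time larger than \<open>4 |I| TV(u\<^sub>0)\<close>.

  This bound is useful because \<open>TV(u\<^sub>0)\<close> is finite (\<open>TV_finite\<close>): on a bounded part of \<open>N\<close> two points
  are joined inside \<open>N\<close> by a \<open>C\<^sup>1\<close> curve of length at most a constant times their distance, so
  sampling \<open>u\<^sub>0\<close> on finer and finer grids and joining consecutive samples yields \<open>C\<^sup>1\<close> maps into \<open>N\<close>
  of bounded length that converge to \<open>u\<^sub>0\<close> in \<open>L\<^sup>2\<close>.

  Once the solution is constant in space it remains so, because its variation does not increase. Pairing
  \<open>\<zeta>\<^sub>x\<close> with tangent vectors at the single value and using that \<open>\<zeta>\<close> vanishes at both ends shows that the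
  velocity has mean zero (\<open>velocity_mean_zero_if_const\<close>). The spatial mean, and hence the value
  itself, is therefore constant in time.

  Two facts from geometry enter. Geodesics have constant speed, so the distance from \<open>p\<close> to \<open>q\<close> is at most the
  length of \<open>log\<^sub>p q\<close>; this makes the unit tangents at jumps have length at least one
  (\<open>norm_Tminus_ge_1\<close>). And tangent spaces are linear, so that tangential projection is the usual
  orthogonal projection.
\<close>

section \<open>Test functions and the lemma of du Bois-Reymond\<close>

text \<open>A test function and its derivative are continuous with compact support, hence bounded; the derivative
  vanishes off the support because the complement of a compact set is open.\<close>

lemma test_fun_props:
  assumes "test_fun S \<phi>"
  shows "\<exists>K B. K \<subseteq> S \<and> (\<forall>t. (\<phi> has_vector_derivative deriv \<phi> t) (at t)) \<and> continuous_on UNIV (deriv \<phi>) \<and>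
    (\<forall>t. t \<notin> K \<longrightarrow> \<phi> t = 0 \<and> deriv \<phi> t = 0) \<and>
    (\<forall>t. \<bar>\<phi> t\<bar> \<le> B \<and> \<bar>deriv \<phi> t\<bar> \<le> B) \<and>
    \<phi> \<in> borel_measurable borel \<and> deriv \<phi> \<in> borel_measurable borel"
proof -
  obtain D K where D: "\<And>x. (\<phi> has_vector_derivative D x) (at x)" "continuous_on UNIV D"
    and K: "compact K" "K \<subseteq> S" "\<And>x. x \<notin> K \<Longrightarrow> \<phi> x = 0"
    using assms unfolding test_fun_def C1_differentiable_on_def by auto
  have dD: "deriv \<phi> = D"
    using D(1) by (intro ext DERIV_imp_deriv) (simp add: has_real_derivative_iff_has_vector_derivative)
  have c\<phi>: "continuous_on UNIV \<phi>"
    using D(1) by (intro continuous_at_imp_continuous_on ballI has_vector_derivative_continuous)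
  have D0: "D x = 0" if "x \<notin> K" for x
  proof -
    have "(\<phi> has_vector_derivative 0) (at x)"
      by (rule has_vector_derivative_transform_within_open[where f = "\<lambda>_. 0" and S = "- K"])
        (use that K in \<open>auto simp: compact_imp_closed open_Compl\<close>)
    then show ?thesis using D(1) vector_derivative_unique_at by blast
  qed
  have "bounded (\<phi> ` K)" "bounded (D ` K)"
    using K(1) c\<phi> D(2) by (auto intro!: compact_imp_bounded compact_continuous_image intro: continuous_on_subset)
  then obtain B1 B2 where B: "B1 > 0" "B2 > 0" "\<forall>x\<in>\<phi> ` K. norm x \<le> B1" "\<forall>x\<in>D ` K. norm x \<le> B2"
    unfolding bounded_pos by blast
  show ?thesis
  proof (intro exI[of _ K] exI[of _ "max B1 B2"] conjI allI impI)
    show "\<bar>\<phi> t\<bar> \<le> max B1 B2" for t using B K(3)[of t] by (cases "t \<in> K") auto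
    show "\<bar>deriv \<phi> t\<bar> \<le> max B1 B2" for t unfolding dD using B D0[of t] by (cases "t \<in> K") auto
  qed (use K D D0 dD borel_measurable_continuous_onI[OF c\<phi>] borel_measurable_continuous_onI[OF D(2)] in auto)
qed

text \<open>An antiderivative of the positive part. All \<open>C\<^sup>1\<close> cut-offs below are combinations of
  its translates, which avoids gluing functions piece by piece.\<close>

definition half_sq_pos :: "real \<Rightarrow> real" where
  "half_sq_pos s = (max 0 s)\<^sup>2 / 2"

lemma half_sq_pos_deriv: "(half_sq_pos has_real_derivative max 0 s) (at s)"
proof -
  consider "s < 0" | "s = 0" | "s > 0" by linarith
  then show ?thesis
  proof cases
    case 1
    have "((\<lambda>_. 0) has_real_derivative 0) (at s)" by simp
    moreover have "eventually (\<lambda>x. x < 0) (nhds s)"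
      using 1 by (metis eventually_nhds lessThan_iff open_lessThan)
    then have "eventually (\<lambda>x. half_sq_pos x = 0) (nhds s)"
      by eventually_elim (simp add: half_sq_pos_def)
    ultimately show ?thesis using 1
      by (subst DERIV_cong_ev[OF refl _ refl]) (auto simp: max_def)
  next
    case 3
    have "((\<lambda>x. x\<^sup>2/2) has_real_derivative s) (at s)"
      by (auto intro!: derivative_eq_intros)
    moreover have "eventually (\<lambda>x. x > 0) (nhds s)"
      using 3 by (metis eventually_nhds greaterThan_iff open_greaterThan)
    then have "eventually (\<lambda>x. half_sq_pos x = x\<^sup>2/2) (nhds s)"
      by eventually_elim (simp add: half_sq_pos_def)
    ultimately show ?thesis using 3
      by (subst DERIV_cong_ev[OF refl _ refl]) (auto simp: max_def)
  next
    case 2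
    have "((\<lambda>h. (half_sq_pos (0 + h) - half_sq_pos 0) / h) \<longlongrightarrow> 0) (at 0)"
    proof (rule Lim_null_comparison)
      show "eventually (\<lambda>h. norm ((half_sq_pos (0 + h) - half_sq_pos 0) / h) \<le> \<bar>h\<bar>) (at 0)"
        by (intro always_eventually allI)
          (auto simp: half_sq_pos_def max_def power2_eq_square field_simps)
      show "((\<lambda>h::real. \<bar>h\<bar>) \<longlongrightarrow> 0) (at 0)"
        by (rule tendsto_eq_intros) auto
    qed
    then show ?thesis using 2 by (simp add: DERIV_def)
  qed
qed

lemma tendsto_integral_indicator:
  fixes f :: "'b \<Rightarrow> 'a::{second_countable_topology, banach}"
  assumes f: "integrable M f" and A: "\<And>n. A n \<inter> space M \<in> sets M" and B: "B \<inter> space M \<in> sets M"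
    and ev: "\<And>y. f y \<noteq> 0 \<Longrightarrow> eventually (\<lambda>n. y \<in> A n \<longleftrightarrow> y \<in> B) sequentially"
  shows "(\<lambda>n. LINT y|M. indicator (A n) y *\<^sub>R f y) \<longlonglongrightarrow> (LINT y|M. indicator B y *\<^sub>R f y)"
proof (rule integral_dominated_convergence[where w = "\<lambda>y. norm (f y)"])
  have m: "(\<lambda>y. indicator X y *\<^sub>R f y) \<in> borel_measurable M" if "X \<inter> space M \<in> sets M" for X
    using that borel_measurable_integrable[OF f]
    by (intro borel_measurable_scaleR) (auto simp: borel_measurable_indicator_iff)
  show "(\<lambda>y. indicator B y *\<^sub>R f y) \<in> borel_measurable M" "\<And>n. (\<lambda>y. indicator (A n) y *\<^sub>R f y) \<in> borel_measurable M"
    by (intro m A B)+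
  show "AE y in M. (\<lambda>n. indicator (A n) y *\<^sub>R f y) \<longlonglongrightarrow> indicator B y *\<^sub>R f y"
  proof (intro AE_I2 tendsto_eventually)
    fix y
    show "eventually (\<lambda>n. indicator (A n) y *\<^sub>R f y = indicator B y *\<^sub>R f y) sequentially"
    proof (cases "f y = 0")
      case False
      from ev[OF this] show ?thesis by eventually_elim (simp add: indicator_def)
    qed simp
  qed
qed (use f in \<open>auto simp: indicator_def\<close>)

text \<open>The half-lines \<open>{..x}\<close> form an intersection-stable generator of the Borel sets, so the
  integral vanishes over every Borel set.\<close>

lemma AE_zero_if_integrals_atMost_zero:
  fixes f :: "real \<Rightarrow> 'a::{second_countable_topology, banach}"
  assumes f: "integrable lborel f"
    and zero: "\<And>x. (LINT y|lborel. indicator {..x} y *\<^sub>R f y) = 0"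
  shows "AE y in lborel. f y = 0"
proof (rule sigma_finite_measure.density_zero[OF sigma_finite_lborel f])
  have int: "integrable lborel (\<lambda>y. indicator A y *\<^sub>R f y)" if "A \<in> sets borel" for A
    using integrable_mult_indicator[OF _ f, of A] that by simp
  have top: "(LINT y|lborel. f y) = 0"
  proof -
    have "(\<lambda>n. LINT y|lborel. indicator {..real n} y *\<^sub>R f y) \<longlonglongrightarrow> (LINT y|lborel. indicator UNIV y *\<^sub>R f y)"
    proof (rule tendsto_integral_indicator[OF f])
      fix y :: real
      show "eventually (\<lambda>n. y \<in> {..real n} \<longleftrightarrow> y \<in> UNIV) sequentially"
        using eventually_ge_at_top[of "nat \<lceil>y\<rceil>"]
      proof eventually_elim
        case (elim n)
        then have "y \<le> real n" by linarith
        then show ?case by simp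
      qed
    qed auto
    then show ?thesis using zero by (simp add: LIMSEQ_const_iff)
  qed
  fix A :: "real set" assume "A \<in> sets lborel"
  then have A: "A \<in> sigma_sets UNIV (range (\<lambda>a::real. {..a}))"
    by (simp add: borel_eq_atMost)
  have gen: "Int_stable (range (\<lambda>a::real. {..a}))" "range (\<lambda>a::real. {..a}) \<subseteq> Pow UNIV"
    by (auto simp: Int_stable_def)
  from gen A have "(LINT y|lborel. indicator A y *\<^sub>R f y) = 0"
  proof (induction rule: sigma_sets_induct_disjoint)
    case (basic A)
    then show ?case using zero by auto
  next
    case empty
    show ?case by simp
  next
    case (compl A)
    then have A: "A \<in> sets borel" by (simp add: borel_eq_atMost)
    have "(LINT y|lborel. indicator (UNIV - A) y *\<^sub>R f y)
        = (LINT y|lborel. f y - indicator A y *\<^sub>R f y)"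
      by (intro Bochner_Integration.integral_cong) (auto simp: indicator_def)
    also have "\<dots> = 0" using int[OF A] f top compl by simp
    finally show ?case .
  next
    case (union A)
    then have A: "\<And>i. A i \<in> sets borel" by (auto simp: borel_eq_atMost)
    have "(LINT y:(\<Union>i. A i)|lborel. f y) = (\<Sum>i. (LINT y:(A i)|lborel. f y))"
      using union A int[of "\<Union>i. A i"]
      by (intro lebesgue_integral_countable_add)
        (auto simp: set_integrable_def disjoint_family_on_def)
    then show ?case using union by (simp add: set_lebesgue_integral_def)
  qed
  then show "set_lebesgue_integral lborel A f = 0" by (simp add: set_lebesgue_integral_def)
qed

text \<open>The piecewise linear function rising from \<open>0\<close> at \<open>\<alpha>\<close> to
  \<open>1\<close> at \<open>\<alpha> + d\<close>; it approximates the indicator of a half-line.\<close>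

definition ramp :: "real \<Rightarrow> real \<Rightarrow> real \<Rightarrow> real" where
  "ramp d \<alpha> t = (max 0 (t - \<alpha>) - max 0 (t - \<alpha> - d)) / d"

definition Ramp :: "real \<Rightarrow> real \<Rightarrow> real \<Rightarrow> real" where
  "Ramp d \<alpha> t = (half_sq_pos (t - \<alpha>) - half_sq_pos (t - \<alpha> - d)) / d"

lemma Ramp_deriv: "(Ramp d \<alpha> has_real_derivative ramp d \<alpha> t) (at t)"
proof -
  have 1: "((\<lambda>t. half_sq_pos (t - c)) has_real_derivative max 0 (t - c)) (at t)" for c
    using DERIV_shift[of half_sq_pos "max 0 (t - c)" t "- c"] half_sq_pos_deriv[of "t - c"] by simp
  have 2: "((\<lambda>t. half_sq_pos (t - \<alpha> - d)) has_real_derivative max 0 (t - \<alpha> - d)) (at t)"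
    using 1[of "\<alpha> + d"] by (simp add: diff_diff_eq)
  show ?thesis
    unfolding Ramp_def[abs_def] ramp_def by (intro DERIV_cdivide DERIV_diff 1 2)
qed

lemma continuous_ramp: "continuous_on S (ramp d \<alpha>)"
  unfolding ramp_def divide_inverse by (intro continuous_intros)

lemma Ramp_left: "d > 0 \<Longrightarrow> t \<le> \<alpha> \<Longrightarrow> Ramp d \<alpha> t = 0"
  by (simp add: Ramp_def half_sq_pos_def)

lemma Ramp_right: "d > 0 \<Longrightarrow> t \<ge> \<alpha> + d \<Longrightarrow> Ramp d \<alpha> t = t - \<alpha> - d / 2"
  by (simp add: Ramp_def half_sq_pos_def power2_eq_square field_simps)

lemma ramp_bounds: "d > 0 \<Longrightarrow> 0 \<le> ramp d \<alpha> t \<and> ramp d \<alpha> t \<le> 1"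
proof -
  assume d: "d > 0"
  have "0 \<le> max 0 (t - \<alpha>) - max 0 (t - \<alpha> - d)" "max 0 (t - \<alpha>) - max 0 (t - \<alpha> - d) \<le> d"
    using d by linarith+
  then show ?thesis using d by (simp add: ramp_def)
qed

lemma ramp_tendsto: "(\<lambda>n. ramp (d / real (Suc n)) \<alpha> t) \<longlonglongrightarrow> indicator {\<alpha><..} t" if "d > 0"
proof (cases "t > \<alpha>")
  case True
  have "(\<lambda>n. d / real (Suc n)) \<longlonglongrightarrow> 0"
    using LIMSEQ_Suc[OF lim_const_over_n] by simp
  then have "eventually (\<lambda>n. d / real (Suc n) < t - \<alpha>) sequentially"
    by (rule order_tendstoD(2)) (use True in simp)
  then have "eventually (\<lambda>n. ramp (d / real (Suc n)) \<alpha> t = 1) sequentially"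
  proof eventually_elim
    case (elim n)
    have "d / real (Suc n) > 0" using that by simp
    then show ?case using that elim True by (simp add: ramp_def max_def del: of_nat_Suc)
  qed
  then show ?thesis using True by (simp add: tendsto_eventually del: of_nat_Suc)
next
  case False
  have "ramp (d / real (Suc n)) \<alpha> t = 0" for n
  proof -
    have "d / real (Suc n) > 0" using that by simp
    then show ?thesis using False by (simp add: ramp_def max_def del: of_nat_Suc)
  qed
  then show ?thesis using False by (simp del: of_nat_Suc)
qed

text \<open>To the right of all ramps each \<open>Ramp d \<alpha> t\<close> equals \<open>t - \<alpha> - d /
  2\<close>, and the factor \<open>\<kappa>\<close> is chosen so that the combination cancels there; hence its
  support is compact.\<close>

lemma test_fun_Ramp:
  fixes \<alpha> \<beta> \<alpha>0 \<beta>0 a b d :: real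
  assumes "d > 0" "a < \<alpha>" "\<alpha> < \<beta>" "\<beta> + d < b" "a < \<alpha>0" "\<alpha>0 < \<beta>0" "\<beta>0 + d < b"
  defines "\<kappa> \<equiv> (\<beta> - \<alpha>) / (\<beta>0 - \<alpha>0)"
  defines "\<phi> \<equiv> \<lambda>t. Ramp d \<alpha> t - Ramp d \<beta> t - \<kappa> * (Ramp d \<alpha>0 t - Ramp d \<beta>0 t)"
  shows "test_fun {a<..<b} \<phi>"
    and "deriv \<phi> = (\<lambda>t. ramp d \<alpha> t - ramp d \<beta> t - \<kappa> * (ramp d \<alpha>0 t - ramp d \<beta>0 t))"
proof -
  have D: "(\<phi> has_real_derivative (ramp d \<alpha> t - ramp d \<beta> t - \<kappa> * (ramp d \<alpha>0 t - ramp d \<beta>0 t))) (at t)" for t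
    unfolding \<phi>_def by (intro DERIV_diff DERIV_cmult Ramp_deriv)
  then show "deriv \<phi> = (\<lambda>t. ramp d \<alpha> t - ramp d \<beta> t - \<kappa> * (ramp d \<alpha>0 t - ramp d \<beta>0 t))"
    by (intro ext DERIV_imp_deriv)
  have "\<phi> C1_differentiable_on UNIV"
    unfolding C1_differentiable_on_def
    using D has_real_derivative_iff_has_vector_derivative
    by (intro exI[of _ "\<lambda>t. ramp d \<alpha> t - ramp d \<beta> t - \<kappa> * (ramp d \<alpha>0 t - ramp d \<beta>0 t)"])
       (auto intro!: continuous_intros continuous_ramp)
  moreover have "\<phi> t = 0" if "t \<notin> {min \<alpha> \<alpha>0..max \<beta> \<beta>0 + d}" for t
  proof (cases "t < min \<alpha> \<alpha>0")
    case True then show ?thesis using assms by (simp add: Ramp_left)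
  next
    case False
    then have "t \<ge> max \<beta> \<beta>0 + d" using that by auto
    then have "\<phi> t = (\<beta> - \<alpha>) - \<kappa> * (\<beta>0 - \<alpha>0)" using assms by (simp add: Ramp_right)
    then show ?thesis using assms by (simp add: \<kappa>_def)
  qed
  moreover have "compact {min \<alpha> \<alpha>0..max \<beta> \<beta>0 + d}" "{min \<alpha> \<alpha>0..max \<beta> \<beta>0 + d} \<subseteq> {a<..<b}"
    using assms by auto
  ultimately show "test_fun {a<..<b} \<phi>" unfolding test_fun_def by blast
qed

text \<open>The lemma of du Bois-Reymond. Testing with the combinations of ramps from \<open>test_fun_Ramp\<close>
  and letting their width tend to zero shows that \<open>g\<close> has the same average over all half-open
  subintervals as over one fixed subinterval. Subtracting this average leaves a function whose integral over every
  such interval vanishes.\<close>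

lemma AE_const_if_weak_deriv_zero:
  fixes g :: "real \<Rightarrow> 'a::{second_countable_topology, banach}"
  assumes ab: "a < b"
    and g: "integrable (leb {a<..<b}) g"
    and zero: "\<And>\<phi>. test_fun {a<..<b} \<phi> \<Longrightarrow> (LINT t|leb {a<..<b}. deriv \<phi> t *\<^sub>R g t) = 0"
  shows "\<exists>c. AE t in leb {a<..<b}. g t = c"
proof -
  let ?I = "{a<..<b}"
  define g0 where "g0 t = indicator ?I t *\<^sub>R g t" for t
  have g0: "integrable lborel g0"
    using g unfolding g0_def by (subst (asm) integrable_restrict_space) auto
  have eq: "(LINT t|leb ?I. f t *\<^sub>R g t) = (LINT t|lborel. f t *\<^sub>R g0 t)" for f :: "real \<Rightarrow> real"
    unfolding g0_def by (subst integral_restrict_space) (auto simp: mult.commute)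
  define \<alpha>0 \<beta>0 where "\<alpha>0 = a + (b - a) / 3" and "\<beta>0 = a + (b - a) / 2"
  have 0: "a < \<alpha>0" "\<alpha>0 < \<beta>0" "\<beta>0 < b" using ab by (auto simp: \<alpha>0_def \<beta>0_def field_simps)
  define c where "c = (LINT t|lborel. indicator {\<alpha>0<..\<beta>0} t *\<^sub>R g0 t) /\<^sub>R (\<beta>0 - \<alpha>0)"
  have main: "(LINT t|lborel. indicator {\<alpha><..\<beta>} t *\<^sub>R g0 t) = (\<beta> - \<alpha>) *\<^sub>R c"
    if "a < \<alpha>" "\<alpha> < \<beta>" "\<beta> < b" for \<alpha> \<beta>
  proof -
    \<comment> \<open>ramps of width at most \<open>d\<close> that start at \<open>\<beta>\<close> or
      \<open>\<beta>0\<close> end before \<open>b\<close>\<close>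
    define d where "d = (b - max \<beta> \<beta>0) / 2"
    have d: "d > 0" "\<beta> + d < b" "\<beta>0 + d < b" using that 0 by (auto simp: d_def field_simps)
    define \<kappa> where "\<kappa> = (\<beta> - \<alpha>) / (\<beta>0 - \<alpha>0)"
    define f where "f n t = ramp (d / Suc n) \<alpha> t - ramp (d / Suc n) \<beta> t
        - \<kappa> * (ramp (d / Suc n) \<alpha>0 t - ramp (d / Suc n) \<beta>0 t)" for n t
    define f0 where "f0 t = indicator {\<alpha><..} t - indicator {\<beta><..} t
        - \<kappa> * (indicator {\<alpha>0<..} t - indicator {\<beta>0<..} t)" for t :: real
    have f00: "f0 t = indicator {\<alpha><..\<beta>} t - \<kappa> * indicator {\<alpha>0<..\<beta>0} t" for t
      using that 0 by (auto simp: f0_def indicator_def)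
    have fz: "(LINT t|lborel. f n t *\<^sub>R g0 t) = 0" for n
    proof -
      have dn: "d / Suc n > 0" "d / Suc n \<le> d" using d by (auto simp: field_simps)
      then have *: "\<beta> + d / Suc n < b" "\<beta>0 + d / Suc n < b" using d by auto
      note T = test_fun_Ramp[OF dn(1) that(1,2) *(1) 0(1,2) *(2)]
      show ?thesis using zero[OF T(1)] unfolding T(2) eq f_def \<kappa>_def .
    qed
    have "(\<lambda>n. LINT t|lborel. f n t *\<^sub>R g0 t) \<longlonglongrightarrow> (LINT t|lborel. f0 t *\<^sub>R g0 t)"
    proof (rule integral_dominated_convergence[where w = "\<lambda>t. (2 + 2 * \<bar>\<kappa>\<bar>) * norm (g0 t)"])
      show "(\<lambda>t. f0 t *\<^sub>R g0 t) \<in> borel_measurable lborel"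
        using borel_measurable_integrable[OF g0] unfolding f0_def by measurable
      have "ramp D A \<in> borel_measurable lborel" for D A
        using borel_measurable_continuous_onI[OF continuous_ramp] by simp
      then show "\<And>n. (\<lambda>t. f n t *\<^sub>R g0 t) \<in> borel_measurable lborel"
        using borel_measurable_integrable[OF g0] unfolding f_def by measurable
      show "integrable lborel (\<lambda>t. (2 + 2 * \<bar>\<kappa>\<bar>) * norm (g0 t))" using g0 by simp
      show "AE t in lborel. (\<lambda>n. f n t *\<^sub>R g0 t) \<longlonglongrightarrow> f0 t *\<^sub>R g0 t"
        unfolding f_def f0_def by (intro AE_I2 tendsto_intros ramp_tendsto d)
      have "\<bar>f n t\<bar> \<le> 2 + 2 * \<bar>\<kappa>\<bar>" for n t
      proof -
        have r: "\<bar>ramp (d / Suc n) x t - ramp (d / Suc n) y t\<bar> \<le> 2" for x y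
          using ramp_bounds[of "d / Suc n" x t] ramp_bounds[of "d / Suc n" y t] d by auto
        have "\<bar>f n t\<bar> \<le> 2 + \<bar>\<kappa>\<bar> * 2"
          unfolding f_def
          by (rule order_trans[OF abs_triangle_ineq4])
            (auto simp: abs_mult simp del: of_nat_Suc intro!: add_mono mult_left_mono r)
        then show ?thesis by simp
      qed
      then show "\<And>n. AE t in lborel. norm (f n t *\<^sub>R g0 t) \<le> (2 + 2 * \<bar>\<kappa>\<bar>) * norm (g0 t)"
        by (auto intro!: mult_right_mono)
    qed
    then have "(LINT t|lborel. f0 t *\<^sub>R g0 t) = 0" unfolding fz by (simp add: LIMSEQ_const_iff)
    moreover have "integrable lborel (\<lambda>t. indicator {x<..y} t *\<^sub>R g0 t)" for x y :: real
      using integrable_mult_indicator[OF _ g0] by simp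
    then have "(LINT t|lborel. f0 t *\<^sub>R g0 t) = (LINT t|lborel. indicator {\<alpha><..\<beta>} t *\<^sub>R g0 t)
        - \<kappa> *\<^sub>R (LINT t|lborel. indicator {\<alpha>0<..\<beta>0} t *\<^sub>R g0 t)"
      unfolding f00 scaleR_diff_left scaleR_scaleR[symmetric]
      by (subst Bochner_Integration.integral_diff) (auto simp del: scaleR_scaleR)
    ultimately show ?thesis unfolding c_def \<kappa>_def by (simp add: divide_inverse)
  qed
  define h where "h t = g0 t - indicator ?I t *\<^sub>R c" for t
  have hi: "integrable lborel h"
    unfolding h_def using g0 ab
    by (intro Bochner_Integration.integrable_diff integrable_scaleR_left) (auto simp: integrable_indicator_iff)
  have hz: "(LINT t|lborel. indicator {\<alpha><..\<beta>} t *\<^sub>R h t) = 0" if "a < \<alpha>" "\<beta> < b" for \<alpha> \<beta>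
  proof (cases "\<alpha> < \<beta>")
    case True
    have "(LINT t|lborel. indicator {\<alpha><..\<beta>} t *\<^sub>R h t)
        = (LINT t|lborel. indicator {\<alpha><..\<beta>} t *\<^sub>R g0 t - indicator {\<alpha><..\<beta>} t *\<^sub>R c)"
      using that unfolding h_def
      by (intro Bochner_Integration.integral_cong) (auto simp: indicator_def algebra_simps)
    also have "\<dots> = 0"
      using main[OF that(1) True that(2)] True integrable_mult_indicator[OF _ g0, of "{\<alpha><..\<beta>}"]
      by (subst Bochner_Integration.integral_diff) (auto simp: integrable_indicator_iff)
    finally show ?thesis .
  qed simp
  have "AE t in lborel. h t = 0"
  proof (rule AE_zero_if_integrals_atMost_zero[OF hi])
    fix x :: real
    define \<alpha> \<beta> where "\<alpha> n = a + (b - a) / Suc (Suc n)" and "\<beta> n = min x (b - (b - a) / Suc (Suc n))" for n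
    have l0: "(\<lambda>n. (b - a) / Suc (Suc n)) \<longlonglongrightarrow> 0"
      using LIMSEQ_Suc[OF LIMSEQ_Suc[OF lim_const_over_n]] by simp
    then have lim: "\<alpha> \<longlonglongrightarrow> a" "(\<lambda>n. b - (b - a) / Suc (Suc n)) \<longlonglongrightarrow> b"
      unfolding \<alpha>_def[abs_def]
      using tendsto_add[OF tendsto_const l0, of a] tendsto_diff[OF tendsto_const l0, of b]
      by (simp_all del: of_nat_Suc)
    have "(\<lambda>n. LINT t|lborel. indicator {\<alpha> n<..\<beta> n} t *\<^sub>R h t) \<longlonglongrightarrow> (LINT t|lborel. indicator {..x} t *\<^sub>R h t)"
    proof (rule tendsto_integral_indicator[OF hi])
      fix t assume "h t \<noteq> 0"
      then have "t \<in> ?I" by (auto simp: h_def g0_def indicator_def)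
      then have "eventually (\<lambda>n. \<alpha> n < t) sequentially"
        "eventually (\<lambda>n. t < b - (b - a) / Suc (Suc n)) sequentially"
        using lim by (auto dest: order_tendstoD simp del: of_nat_Suc)
      then show "eventually (\<lambda>n. t \<in> {\<alpha> n<..\<beta> n} \<longleftrightarrow> t \<in> {..x}) sequentially"
        by eventually_elim (auto simp: \<beta>_def)
    qed auto
    moreover have "(LINT t|lborel. indicator {\<alpha> n<..\<beta> n} t *\<^sub>R h t) = 0" for n
    proof (rule hz)
      have "(b - a) / Suc (Suc n) > 0" using ab by simp
      then show "a < \<alpha> n" "\<beta> n < b" by (auto simp: \<alpha>_def \<beta>_def min_def simp del: of_nat_Suc)
    qed
    ultimately show "(LINT t|lborel. indicator {..x} t *\<^sub>R h t) = 0" by (simp add: LIMSEQ_const_iff)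
  qed
  then have "AE t in leb ?I. g t = c"
    by (subst AE_restrict_space_iff) (auto simp: h_def g0_def)
  then show ?thesis by blast
qed

section \<open>Functions of bounded variation on an interval\<close>

lemma integrable_pair_if_AE_bounded:
  fixes f :: "'b \<times> 'c \<Rightarrow> 'a::{second_countable_topology, banach}"
  assumes "finite_measure M1" "finite_measure M2" and f[measurable]: "f \<in> borel_measurable (M1 \<Otimes>\<^sub>M M2)"
    and bd: "AE y in M1. AE x in M2. norm (f (y, x)) \<le> B"
  shows "integrable (M1 \<Otimes>\<^sub>M M2) f"
proof (rule integrableI_bounded[OF f])
  interpret M1: finite_measure M1 by fact
  interpret M2: finite_measure M2 by fact
  have "(\<integral>\<^sup>+ z. ennreal (norm (f z)) \<partial>(M1 \<Otimes>\<^sub>M M2)) = (\<integral>\<^sup>+ y. \<integral>\<^sup>+ x. ennreal (norm (f (y, x))) \<partial>M2 \<partial>M1)"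
    by (subst M2.nn_integral_fst[symmetric]) simp_all
  also have "\<dots> \<le> (\<integral>\<^sup>+ y. \<integral>\<^sup>+ x. ennreal B \<partial>M2 \<partial>M1)"
  proof (intro nn_integral_mono_AE)
    show "AE y in M1. (\<integral>\<^sup>+ x. ennreal (norm (f (y, x))) \<partial>M2) \<le> (\<integral>\<^sup>+ x. ennreal B \<partial>M2)"
      using bd
    proof eventually_elim
      case (elim y)
      then show ?case by (intro nn_integral_mono_AE) (auto elim: AE_mp intro: ennreal_leI)
    qed
  qed
  also have "\<dots> = ennreal B * emeasure M2 (space M2) * emeasure M1 (space M1)" by simp
  also have "\<dots> < \<infinity>"
    using M1.emeasure_finite[of "space M1"] M2.emeasure_finite[of "space M2"]
    by (metis ennreal_mult_eq_top_iff ennreal_neq_top infinity_ennreal_def less_top)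
  finally show "(\<integral>\<^sup>+ z. ennreal (norm (f z)) \<partial>(M1 \<Otimes>\<^sub>M M2)) < \<infinity>" .
qed

lemma finite_measure_leb_interval: "finite_measure (leb {a<..<b})"
proof
  have "emeasure lborel {a<..<b} \<noteq> \<infinity>" by (cases "a \<le> b") auto
  then show "emeasure (leb {a<..<b}) (space (leb {a<..<b})) \<noteq> \<infinity>"
    by (simp add: emeasure_restrict_space space_restrict_space)
qed

text \<open>The distribution function of the vector measure \<open>\<sigma> M\<close>, in its left-continuous
  version; the right-continuous one follows.\<close>

definition cum_left :: "real measure \<Rightarrow> (real \<Rightarrow> 'a::euclidean_space) \<Rightarrow> real \<Rightarrow> 'a" where
  "cum_left M \<sigma> x = (LINT y|M. indicator {..<x} y *\<^sub>R \<sigma> y)"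

definition cum_right :: "real measure \<Rightarrow> (real \<Rightarrow> 'a::euclidean_space) \<Rightarrow> real \<Rightarrow> 'a" where
  "cum_right M \<sigma> x = (LINT y|M. indicator {..x} y *\<^sub>R \<sigma> y)"

context
  fixes M :: "real measure" and \<sigma> :: "real \<Rightarrow> 'a::euclidean_space"
  assumes id: "(\<lambda>x. x) \<in> borel_measurable M" and s: "integrable M \<sigma>"
begin

lemma Borel_Int_space: "A \<in> sets borel \<Longrightarrow> A \<inter> space M \<in> sets M"
  using measurable_sets[OF id, of A] by simp

lemma integrable_indicator_scaleR: "A \<in> sets borel \<Longrightarrow> integrable M (\<lambda>y. indicator A y *\<^sub>R \<sigma> y)"
proof (rule Bochner_Integration.integrable_bound[OF s])
  assume "A \<in> sets borel"
  then show "(\<lambda>y. indicator A y *\<^sub>R \<sigma> y) \<in> borel_measurable M"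
    using borel_measurable_integrable[OF s] Borel_Int_space
    by (intro borel_measurable_scaleR) (auto simp: borel_measurable_indicator_iff)
qed (auto simp: indicator_def)

lemma tendsto_cum_at_left: "(cum_left M \<sigma> \<longlongrightarrow> cum_left M \<sigma> x) (at_left x)"
proof (rule tendsto_at_left_sequentially[of "x - 1"])
  fix X :: "nat \<Rightarrow> real" assume X: "\<And>n. X n < x" "X \<longlonglongrightarrow> x"
  show "(\<lambda>n. cum_left M \<sigma> (X n)) \<longlonglongrightarrow> cum_left M \<sigma> x"
    unfolding cum_left_def
  proof (rule tendsto_integral_indicator[OF s])
    fix y
    show "eventually (\<lambda>n. y \<in> {..<X n} \<longleftrightarrow> y \<in> {..<x}) sequentially"
    proof (cases "y < x")
      case True
      then have "eventually (\<lambda>n. y < X n) sequentially" using X(2) by (rule order_tendstoD(1)[rotated])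
      then show ?thesis by eventually_elim (use True in auto)
    next
      case False
      then have "\<not> y < X n" for n using X(1)[of n] by linarith
      then show ?thesis using False by simp
    qed
  qed (auto intro: Borel_Int_space)
qed simp

lemma tendsto_cum_at_right: "(cum_left M \<sigma> \<longlongrightarrow> cum_right M \<sigma> x) (at_right x)"
proof (rule tendsto_at_right_sequentially[of _ "x + 1"])
  fix X :: "nat \<Rightarrow> real" assume X: "\<And>n. x < X n" "X \<longlonglongrightarrow> x"
  show "(\<lambda>n. cum_left M \<sigma> (X n)) \<longlonglongrightarrow> cum_right M \<sigma> x"
    unfolding cum_left_def cum_right_def
  proof (rule tendsto_integral_indicator[OF s])
    fix y
    show "eventually (\<lambda>n. y \<in> {..<X n} \<longleftrightarrow> y \<in> {..x}) sequentially"
    proof (cases "y > x")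
      case True
      then have "eventually (\<lambda>n. X n < y) sequentially" using X(2) by (rule order_tendstoD(2)[rotated])
      then show ?thesis by eventually_elim (use True in auto)
    next
      case False
      then have "y < X n" for n using X(1)[of n] by linarith
      then show ?thesis using False by simp
    qed
  qed (auto intro: Borel_Int_space)
qed simp

lemma cum_right_eq_cum_left_plus_atom:
  assumes "finite_measure M" and x: "{x} \<in> sets M"
  shows "cum_right M \<sigma> x = cum_left M \<sigma> x + measure M {x} *\<^sub>R \<sigma> x"
proof -
  interpret finite_measure M by fact
  have "cum_right M \<sigma> x = (LINT y|M. indicator {..<x} y *\<^sub>R \<sigma> y + indicator {x} y *\<^sub>R \<sigma> x)"
    unfolding cum_right_def by (intro Bochner_Integration.integral_cong) (auto simp: indicator_def)
  also have "\<dots> = cum_left M \<sigma> x + measure M {x} *\<^sub>R \<sigma> x"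
    unfolding cum_left_def using integrable_indicator_scaleR[of "{..<x}"] x
    by (subst Bochner_Integration.integral_add)
      (auto simp: integrable_indicator_iff emeasure_eq_measure)
  finally show ?thesis .
qed

lemma norm_cum_left_diff_le:
  assumes "finite_measure M" and bd: "AE y in M. norm (\<sigma> y) \<le> 1" and xy: "x \<le> y"
  shows "norm (cum_left M \<sigma> y - cum_left M \<sigma> x) \<le> measure M ({x..<y} \<inter> space M)"
proof -
  interpret finite_measure M by fact
  have i: "integrable M (\<lambda>z. indicator {..<x} z *\<^sub>R \<sigma> z)" for x
    by (rule integrable_indicator_scaleR) simp
  have eq: "cum_left M \<sigma> y - cum_left M \<sigma> x = (LINT z|M. indicator {x..<y} z *\<^sub>R \<sigma> z)"
    unfolding cum_left_def Bochner_Integration.integral_diff[OF i i, symmetric]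
    using xy by (intro Bochner_Integration.integral_cong) (auto simp: indicator_def)
  have m: "{x..<y} \<inter> space M \<in> sets M" by (rule Borel_Int_space) simp
  have "norm (cum_left M \<sigma> y - cum_left M \<sigma> x) \<le> (LINT z|M. norm (indicator {x..<y} z *\<^sub>R \<sigma> z))"
    unfolding eq by (rule integral_norm_bound)
  also have "\<dots> \<le> (LINT z|M. indicator ({x..<y} \<inter> space M) z)"
  proof (rule integral_mono_AE)
    show "integrable M (\<lambda>z. norm (indicator {x..<y} z *\<^sub>R \<sigma> z))" by (intro integrable_norm integrable_indicator_scaleR) simp
    show "integrable M (\<lambda>z. indicator ({x..<y} \<inter> space M) z :: real)"
      using m by (simp add: integrable_indicator_iff emeasure_eq_measure)
    show "AE z in M. norm (indicator {x..<y} z *\<^sub>R \<sigma> z) \<le> indicator ({x..<y} \<inter> space M) z"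
      using bd AE_space by eventually_elim (auto simp: indicator_def)
  qed
  also have "\<dots> = measure M ({x..<y} \<inter> space M)"
    using m by simp
  finally show ?thesis .
qed

end

text \<open>Fubini: the inner integral of \<open>\<phi>'\<close> over the points to the right of \<open>y\<close>
  is \<open>- \<phi> y\<close>, as \<open>\<phi>\<close> vanishes at the right end.\<close>

lemma weak_deriv_cum_left:
  fixes \<sigma> :: "real \<Rightarrow> 'a::euclidean_space"
  assumes ab: "a < b" and "finite_measure M" and sM: "sets M = sets (leb {a<..<b})"
    and s[measurable]: "\<sigma> \<in> borel_measurable M" and bd: "AE y in M. norm (\<sigma> y) \<le> 1"
    and \<phi>: "test_fun {a<..<b} \<phi>"
  shows "(LINT x|leb {a<..<b}. deriv \<phi> x *\<^sub>R cum_left M \<sigma> x) = - (LINT y|M. \<phi> y *\<^sub>R \<sigma> y)"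
proof -
  interpret M: finite_measure M by fact
  let ?I = "{a<..<b}"
  interpret L: finite_measure "leb ?I"
    by (rule finite_measure_leb_interval)
  interpret pair_sigma_finite M "leb ?I" ..
  have spM: "space M = ?I" using sets_eq_imp_space_eq[OF sM] by (simp add: space_restrict_space)
  have idM: "(\<lambda>x. x) \<in> borel_measurable M"
    using sM by (simp add: measurable_cong_sets[OF sM refl] measurable_restrict_space1)
  have idL: "(\<lambda>x. x) \<in> borel_measurable (leb ?I)" by (simp add: measurable_restrict_space1)
  define D where "D = deriv \<phi>"
  obtain K B where K: "K \<subseteq> ?I" "\<And>x. x \<notin> K \<Longrightarrow> \<phi> x = 0"
    and D: "\<And>x. (\<phi> has_vector_derivative D x) (at x)" "continuous_on UNIV D"
    and B: "\<And>x. \<bar>D x\<bar> \<le> B" and Dm[measurable]: "D \<in> borel_measurable borel"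
    using test_fun_props[OF \<phi>] unfolding D_def by blast
  have B0: "0 \<le> B" using B[of 0] by linarith
  have "(LINT x|leb ?I. deriv \<phi> x *\<^sub>R cum_left M \<sigma> x)
     = (LINT x|leb ?I. LINT y|M. (D x * indicator {..<x} y) *\<^sub>R \<sigma> y)"
    unfolding cum_left_def D_def[symmetric] scaleR_scaleR[symmetric] Bochner_Integration.integral_scaleR_right ..
  also have "\<dots> = (LINT y|M. LINT x|leb ?I. (D x * indicator {y<..} x) *\<^sub>R \<sigma> y)"
  proof -
    have eq: "(\<lambda>(y, x). (D x * indicator {..<x} y) *\<^sub>R \<sigma> y) = (\<lambda>p. (D (snd p) * (if fst p < snd p then 1 else 0)) *\<^sub>R \<sigma> (fst p))"
      by (auto simp: fun_eq_iff indicator_def)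
    have "integrable (M \<Otimes>\<^sub>M leb ?I) (\<lambda>(y, x). (D x * indicator {..<x} y) *\<^sub>R \<sigma> y)"
      unfolding eq
    proof (rule integrable_pair_if_AE_bounded)
      show "(\<lambda>p. (D (snd p) * (if fst p < snd p then 1 else 0)) *\<^sub>R \<sigma> (fst p)) \<in> borel_measurable (M \<Otimes>\<^sub>M leb ?I)"
      proof -
        have 1[measurable]: "(\<lambda>p. snd p) \<in> borel_measurable (M \<Otimes>\<^sub>M leb ?I)"
          by (rule measurable_compose[OF measurable_snd idL])
        have 2[measurable]: "(\<lambda>p. fst p) \<in> borel_measurable (M \<Otimes>\<^sub>M leb ?I)"
          by (rule measurable_compose[OF measurable_fst idM])
        have [measurable]: "(\<lambda>p. D (snd p)) \<in> borel_measurable (M \<Otimes>\<^sub>M leb ?I)"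
          using measurable_compose[OF 1 Dm] by simp
        have "Measurable.pred (M \<Otimes>\<^sub>M leb ?I) (\<lambda>p. fst p < snd p)"
          by (rule borel_measurable_pred_less[OF 2 1])
        then show ?thesis by measurable
      qed
      show "AE y in M. AE x in leb ?I. norm ((D (snd (y, x)) * (if fst (y, x) < snd (y, x) then 1 else 0)) *\<^sub>R \<sigma> (fst (y, x))) \<le> B * 1"
        using bd
      proof eventually_elim
        case (elim y)
        show ?case
        proof (rule AE_I2)
          fix x
          show "norm ((D (snd (y, x)) * (if fst (y, x) < snd (y, x) then 1 else 0)) *\<^sub>R \<sigma> (fst (y, x))) \<le> B * 1"
            using elim B[of x] B0 mult_mono[of "norm (D x)" B "norm (\<sigma> y)" 1] by auto
        qed
      qed
    qed (fact | rule finite_measure_leb_interval)+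
    from Fubini_integral[OF this]
    have "(LINT x|leb ?I. LINT y|M. (D x * indicator {..<x} y) *\<^sub>R \<sigma> y)
        = (LINT y|M. LINT x|leb ?I. (D x * indicator {..<x} y) *\<^sub>R \<sigma> y)" .
    then show ?thesis by (simp add: indicator_def)
  qed
  also have "\<dots> = (LINT y|M. - (\<phi> y *\<^sub>R \<sigma> y))"
  proof (rule Bochner_Integration.integral_cong[OF refl])
    fix y assume "y \<in> space M"
    then have y: "a < y" "y < b" by (auto simp: spM)
    have "(LINT x|leb ?I. (D x * indicator {y<..} x) *\<^sub>R \<sigma> y) = (LINT x|leb ?I. D x * indicator {y<..} x) *\<^sub>R \<sigma> y"
    proof (rule integral_scaleR_left)
      show "integrable (leb ?I) (\<lambda>x. D x * indicator {y<..} x)"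
      proof (rule L.integrable_const_bound[where B = B])
        have "(\<lambda>x. D x * indicator {y<..} x) \<in> borel_measurable lborel" by measurable
        then show "(\<lambda>x. D x * indicator {y<..} x) \<in> borel_measurable (leb ?I)"
          by (rule measurable_restrict_space1)
        show "AE x in leb ?I. norm (D x * indicator {y<..} x) \<le> B"
          using B B0 by (intro AE_I2) (auto simp: indicator_def)
      qed
    qed
    \<comment> \<open>the endpoints \<open>y\<close> and \<open>b\<close> are null; the closed interval is the form
      used by the fundamental theorem of calculus\<close>
    also have "(LINT x|leb ?I. D x * indicator {y<..} x) = (LINT x|lborel. indicator {y..b} x *\<^sub>R D x)"
    proof (subst integral_restrict_space)
      show "(LINT x|lborel. indicator ?I x *\<^sub>R (D x * indicator {y<..} x)) = (LINT x|lborel. indicator {y..b} x *\<^sub>R D x)"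
      proof (rule integral_cong_AE)
        have "AE x in lborel. x \<noteq> y" "AE x in lborel. x \<noteq> b" by (rule AE_lborel_singleton)+
        then show "AE x in lborel. indicator ?I x *\<^sub>R (D x * indicator {y<..} x) = indicator {y..b} x *\<^sub>R D x"
          by eventually_elim (use y in \<open>auto simp: indicator_def\<close>)
      qed measurable
    qed auto
    also have "\<dots> = \<phi> b - \<phi> y"
      using y D by (intro integral_FTC_Icc) (auto intro: has_vector_derivative_at_within continuous_on_subset)
    also have "\<phi> b = 0" using K by (metis greaterThanLessThan_iff less_irrefl subsetD)
    finally show "(LINT x|leb ?I. (D x * indicator {y<..} x) *\<^sub>R \<sigma> y) = - (\<phi> y *\<^sub>R \<sigma> y)" by simp
  qed
  finally show ?thesis by simp
qed

text \<open>One-sided limits of an a.e. class are tested on sets of full measure, which meet every one-sided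
  neighbourhood.\<close>

lemma frequently_at_left_if_AE:
  assumes P: "AE y in leb {a<..<b}. P y" and x: "a < x" "x \<le> b"
  shows "frequently P (at_left x)"
  unfolding frequently_def
proof
  assume "eventually (\<lambda>y. \<not> P y) (at_left x)"
  then obtain c where c: "c < x" "\<And>y. c < y \<Longrightarrow> y < x \<Longrightarrow> \<not> P y"
    unfolding eventually_at_left_field by blast
  have "AE y in lborel. y \<in> {a<..<b} \<longrightarrow> P y"
    using P by (simp add: AE_restrict_space_iff)
  then have "AE y in lborel. y \<notin> {max a c<..<x}"
    by eventually_elim (use c x in auto)
  then have "{max a c<..<x} \<in> null_sets lborel" by (simp add: AE_iff_null_sets)
  then have "emeasure lborel {max a c<..<x} = 0" by blast
  then show False using c(1) x(1) by (simp add: ennreal_eq_0_iff)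
qed

lemma frequently_at_right_if_AE:
  assumes P: "AE y in leb {a<..<b}. P y" and x: "a \<le> x" "x < b"
  shows "frequently P (at_right x)"
  unfolding frequently_def
proof
  assume "eventually (\<lambda>y. \<not> P y) (at_right x)"
  then obtain c where c: "x < c" "\<And>y. x < y \<Longrightarrow> y < c \<Longrightarrow> \<not> P y"
    unfolding eventually_at_right_field by blast
  have "AE y in lborel. y \<in> {a<..<b} \<longrightarrow> P y"
    using P by (simp add: AE_restrict_space_iff)
  then have "AE y in lborel. y \<notin> {x<..<min b c}"
    by eventually_elim (use c x in auto)
  then have "{x<..<min b c} \<in> null_sets lborel" by (simp add: AE_iff_null_sets)
  then have "emeasure lborel {x<..<min b c} = 0" by blast
  then show False using c(1) x(2) by (simp add: ennreal_eq_0_iff)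
qed

lemma limits_eq_if_frequently_eq:
  fixes f g :: "real \<Rightarrow> 'a::real_normed_vector"
  assumes "(f \<longlongrightarrow> l) F" "(g \<longlongrightarrow> m) F" "frequently (\<lambda>y. f y = g y) F"
  shows "l = m"
proof (rule ccontr)
  assume "l \<noteq> m"
  then have "eventually (\<lambda>y. f y - g y \<noteq> 0) F"
    by (intro tendsto_imp_eventually_ne[OF tendsto_diff[OF assms(1,2)]]) simp
  then show False using assms(3) by (simp add: frequently_def)
qed

lemma limit_in_closed_if_frequently_in:
  assumes "(f \<longlongrightarrow> l) F" "frequently (\<lambda>y. f y \<in> S) F" "closed S"
  shows "l \<in> S"
proof (rule ccontr)
  assume "l \<notin> S"
  then have "eventually (\<lambda>y. f y \<in> - S) F"
    using assms by (intro topological_tendstoD) auto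
  then show False using assms(2) by (simp add: frequently_def)
qed

lemma lft_eqI:
  assumes w: "AE y in leb {a<..<b}. F y = w y" and F: "(F \<longlongrightarrow> l) (at_left x)"
    and x: "a < x" "x \<le> b"
  shows "lft {a<..<b} w x = l"
  unfolding lft_def
proof (rule the_equality)
  show "\<exists>v. (AE y in leb {a<..<b}. v y = w y) \<and> (v \<longlongrightarrow> l) (at_left x)" using w F by blast
  fix m assume "\<exists>v. (AE y in leb {a<..<b}. v y = w y) \<and> (v \<longlongrightarrow> m) (at_left x)"
  then obtain v where v: "AE y in leb {a<..<b}. v y = w y" "(v \<longlongrightarrow> m) (at_left x)" by blast
  have "AE y in leb {a<..<b}. v y = F y" using w v(1) by eventually_elim simp
  from frequently_at_left_if_AE[OF this x]
  show "m = l" by (rule limits_eq_if_frequently_eq[OF v(2) F])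
qed

lemma rgt_eqI:
  assumes w: "AE y in leb {a<..<b}. F y = w y" and F: "(F \<longlongrightarrow> l) (at_right x)"
    and x: "a \<le> x" "x < b"
  shows "rgt {a<..<b} w x = l"
  unfolding rgt_def
proof (rule the_equality)
  show "\<exists>v. (AE y in leb {a<..<b}. v y = w y) \<and> (v \<longlongrightarrow> l) (at_right x)" using w F by blast
  fix m assume "\<exists>v. (AE y in leb {a<..<b}. v y = w y) \<and> (v \<longlongrightarrow> m) (at_right x)"
  then obtain v where v: "AE y in leb {a<..<b}. v y = w y" "(v \<longlongrightarrow> m) (at_right x)" by blast
  have "AE y in leb {a<..<b}. v y = F y" using w v(1) by eventually_elim simp
  from frequently_at_right_if_AE[OF this x]
  show "m = l" by (rule limits_eq_if_frequently_eq[OF v(2) F])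
qed

text \<open>Throughout, \<open>M\<close> and \<open>\<sigma>\<close> are the total variation measure and the polar
  density chosen by \<open>tv_meas\<close> and \<open>dens\<close>, and \<open>S\<close> is the null set that
  carries the singular part.\<close>

locale bv_function =
  fixes a b :: real and w :: "real \<Rightarrow> 'a::euclidean_space"
  assumes ab: "a < b" and bv: "bv {a<..<b} w"
begin

abbreviation "I \<equiv> {a<..<b}"
abbreviation "M \<equiv> tv_meas I w"
abbreviation "\<sigma> \<equiv> dens I w"

lemma polar: "has_deriv_polar I w M \<sigma>"
proof -
  obtain \<mu> s where "has_deriv_polar I w \<mu> s" using bv unfolding bv_def by blast
  then have "has_deriv_polar I w (fst (\<mu>, s)) (snd (\<mu>, s))" by simp
  from someI[of "\<lambda>P. has_deriv_polar I w (fst P) (snd P)", OF this]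
  show ?thesis unfolding tv_meas_def dens_def deriv_polar_def .
qed

lemma integrable_w: "integrable (leb I) w" using bv unfolding bv_def by blast

lemma sets_M[measurable_cong]: "sets M = sets (leb I)"
  and finite_measure_tv: "finite_measure M"
  and dens_meas[measurable]: "\<sigma> \<in> borel_measurable M"
  and norm_dens: "AE x in M. norm (\<sigma> x) = 1"
  using polar unfolding has_deriv_polar_def by blast+

sublocale finite_measure M by (rule finite_measure_tv)

lemma space_M: "space M = I"
  using sets_eq_imp_space_eq[OF sets_M] by (simp add: space_restrict_space)

lemma id_meas[measurable]: "(\<lambda>x. x) \<in> borel_measurable M"
  by (simp add: measurable_cong_sets[OF sets_M refl] measurable_restrict_space1)

lemma norm_dens_le: "AE x in M. norm (\<sigma> x) \<le> 1"
  using norm_dens by eventually_elim simp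

lemma integrable_dens: "integrable M \<sigma>"
  using norm_dens_le by (rule integrable_const_bound) measurable

lemma sets_I_iff: "A \<in> sets (leb I) \<longleftrightarrow> A \<subseteq> I \<and> A \<in> sets borel"
  by (subst sets_restrict_space_iff) auto

lemma borel_measurable_cum_left: "cum_left M \<sigma> \<in> borel_measurable borel"
  unfolding cum_left_def
proof (rule borel_measurable_lebesgue_integral)
  have "(\<lambda>(x, y). indicator {..<x} y *\<^sub>R \<sigma> y) = (\<lambda>p. (if snd p < fst p then 1 else 0) *\<^sub>R \<sigma> (snd p))"
    by (auto simp: fun_eq_iff indicator_def)
  moreover have "(\<lambda>p. (if snd p < fst p then 1 else 0) *\<^sub>R \<sigma> (snd p)) \<in> borel_measurable (borel \<Otimes>\<^sub>M M)"
  proof -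
    have 1[measurable]: "(\<lambda>p. snd p) \<in> borel_measurable (borel \<Otimes>\<^sub>M M)"
      by (rule measurable_compose[OF measurable_snd id_meas])
    have "Measurable.pred (borel \<Otimes>\<^sub>M M) (\<lambda>p. snd p < fst p)"
      by (rule borel_measurable_pred_less[OF 1]) measurable
    then show ?thesis by measurable
  qed
  ultimately show "(\<lambda>(x, y). indicator {..<x} y *\<^sub>R \<sigma> y) \<in> borel_measurable (borel \<Otimes>\<^sub>M M)" by metis
qed

lemma cum_left_a: "cum_left M \<sigma> a = 0"
  unfolding cum_left_def
  by (subst Bochner_Integration.integral_cong[OF refl, where g = "\<lambda>_. 0"]) (auto simp: space_M)

lemma norm_cum_left_le: "a \<le> x \<Longrightarrow> norm (cum_left M \<sigma> x) \<le> measure M I"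
  using norm_cum_left_diff_le[OF id_meas integrable_dens finite_measure_tv norm_dens_le, of a x]
    finite_measure_mono[of "{a..<x} \<inter> I" I]
  by (auto simp: cum_left_a space_M sets_M sets_I_iff)

text \<open>The function and the distribution function of its derivative have the same weak derivative, so they
  differ by a constant, which is the right limit at the left end.\<close>

lemma good_representative: "AE x in leb I. rgt I w a + cum_left M \<sigma> x = w x"
proof -
  interpret L: finite_measure "leb I" by (rule finite_measure_leb_interval)
  have ic: "integrable (leb I) (cum_left M \<sigma>)"
    by (rule L.integrable_const_bound[where B = "measure M I"])
      (use norm_cum_left_le borel_measurable_cum_left in
        \<open>auto intro: measurable_restrict_space1 simp: AE_restrict_space_iff intro!: AE_I2\<close>)
  have "\<exists>c. AE x in leb I. w x - cum_left M \<sigma> x = c"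
  proof (rule AE_const_if_weak_deriv_zero[OF ab])
    show "integrable (leb I) (\<lambda>x. w x - cum_left M \<sigma> x)" using integrable_w ic by simp
    fix \<phi> assume \<phi>: "test_fun I \<phi>"
    obtain B where B: "\<And>x. \<bar>deriv \<phi> x\<bar> \<le> B" and "deriv \<phi> \<in> borel_measurable borel"
      using test_fun_props[OF \<phi>] by blast
    then have dm: "deriv \<phi> \<in> borel_measurable (leb I)" by (intro measurable_restrict_space1) simp
    have i: "integrable (leb I) (\<lambda>x. deriv \<phi> x *\<^sub>R f x)" if f: "integrable (leb I) f" for f :: "real \<Rightarrow> 'a"
    proof (rule Bochner_Integration.integrable_bound[OF integrable_scaleR_right[OF f, of B]])
      show "AE x in leb I. norm (deriv \<phi> x *\<^sub>R f x) \<le> norm (B *\<^sub>R f x)"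
        using B by (intro AE_I2) (auto intro!: mult_right_mono order_trans[OF _ abs_ge_self])
    qed (use dm f in measurable)
    have "(LINT x|leb I. deriv \<phi> x *\<^sub>R w x) = - (LINT x|M. \<phi> x *\<^sub>R \<sigma> x)"
      using polar \<phi> unfolding has_deriv_polar_def by blast
    moreover have "(LINT x|leb I. deriv \<phi> x *\<^sub>R cum_left M \<sigma> x) = - (LINT x|M. \<phi> x *\<^sub>R \<sigma> x)"
      by (rule weak_deriv_cum_left[OF ab finite_measure_tv sets_M dens_meas norm_dens_le \<phi>])
    ultimately show "(LINT x|leb I. deriv \<phi> x *\<^sub>R (w x - cum_left M \<sigma> x)) = 0"
      unfolding scaleR_diff_right
      by (subst Bochner_Integration.integral_diff[OF i[OF integrable_w] i[OF ic]]) simp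
  qed
  then obtain c where c: "AE x in leb I. w x - cum_left M \<sigma> x = c" by blast
  then have c': "AE x in leb I. c + cum_left M \<sigma> x = w x" by eventually_elim (simp add: algebra_simps)
  have "cum_right M \<sigma> a = 0"
    unfolding cum_right_def by (subst Bochner_Integration.integral_cong[OF refl, where g = "\<lambda>_. 0"]) (auto simp: space_M)
  then have "rgt I w a = c"
    using tendsto_add[OF tendsto_const tendsto_cum_at_right[OF id_meas integrable_dens], of c a] ab
    by (intro rgt_eqI[OF c']) auto
  then show ?thesis using c' by simp
qed

lemma lft_eq: "a < x \<Longrightarrow> x \<le> b \<Longrightarrow> lft I w x = rgt I w a + cum_left M \<sigma> x"
  using tendsto_add[OF tendsto_const tendsto_cum_at_left[OF id_meas integrable_dens]]
  by (intro lft_eqI[OF good_representative]) auto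

lemma rgt_eq: "a \<le> x \<Longrightarrow> x < b \<Longrightarrow> rgt I w x = rgt I w a + cum_right M \<sigma> x"
  using tendsto_add[OF tendsto_const tendsto_cum_at_right[OF id_meas integrable_dens]]
  by (intro rgt_eqI[OF good_representative]) auto

lemma AE_lft: "AE x in leb I. lft I w x = w x"
  using good_representative AE_space by eventually_elim (simp add: lft_eq space_restrict_space)

lemma lft_in_closed:
  assumes S: "closed S" "AE x in leb I. w x \<in> S" and x: "a < x" "x \<le> b"
  shows "lft I w x \<in> S"
proof -
  have 1: "((\<lambda>y. rgt I w a + cum_left M \<sigma> y) \<longlongrightarrow> rgt I w a + cum_left M \<sigma> x) (at_left x)"
    by (rule tendsto_add[OF tendsto_const tendsto_cum_at_left[OF id_meas integrable_dens]])
  have 2: "AE y in leb I. rgt I w a + cum_left M \<sigma> y \<in> S" using good_representative S(2) by eventually_elim simp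
  have "rgt I w a + cum_left M \<sigma> x \<in> S"
    using 1 frequently_at_left_if_AE[OF 2 x] S(1) by (rule limit_in_closed_if_frequently_in)
  then show ?thesis unfolding lft_eq[OF x] .
qed

lemma rgt_in_closed:
  assumes S: "closed S" "AE x in leb I. w x \<in> S" and x: "a \<le> x" "x < b"
  shows "rgt I w x \<in> S"
proof -
  have 1: "((\<lambda>y. rgt I w a + cum_left M \<sigma> y) \<longlongrightarrow> rgt I w a + cum_right M \<sigma> x) (at_right x)"
    by (rule tendsto_add[OF tendsto_const tendsto_cum_at_right[OF id_meas integrable_dens]])
  have 2: "AE y in leb I. rgt I w a + cum_left M \<sigma> y \<in> S" using good_representative S(2) by eventually_elim simp
  have "rgt I w a + cum_right M \<sigma> x \<in> S"
    using 1 frequently_at_right_if_AE[OF 2 x] S(1) by (rule limit_in_closed_if_frequently_in)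
  then show ?thesis using rgt_eq[OF x] by simp
qed

lemma singleton_sets: "x \<in> I \<Longrightarrow> {x} \<in> sets M"
  by (simp add: sets_M sets_I_iff)

lemma jump_eq: "x \<in> I \<Longrightarrow> rgt I w x = lft I w x + measure M {x} *\<^sub>R \<sigma> x"
  using cum_right_eq_cum_left_plus_atom[OF id_meas integrable_dens finite_measure_tv singleton_sets, of x]
    lft_eq[of x] rgt_eq[of x] by simp

lemma jump_set_eq: "jump_set I w = {x \<in> I. measure M {x} \<noteq> 0}"
proof -
  have "norm (\<sigma> x) = 1" if x: "x \<in> I" "measure M {x} \<noteq> 0" for x
  proof (rule ccontr)
    assume n: "norm (\<sigma> x) \<noteq> 1"
    obtain S where S: "{y \<in> space M. \<not> norm (\<sigma> y) = 1} \<subseteq> S" "emeasure M S = 0" "S \<in> sets M"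
      using norm_dens by (rule AE_E)
    have "x \<in> S" using S(1) x(1) n space_M by blast
    then have "emeasure M {x} \<le> emeasure M S" using S(3) by (intro emeasure_mono) auto
    then show False using x(2) S(2) measure_nonneg[of M "{x}"] by (simp add: emeasure_eq_measure)
  qed
  show ?thesis
  proof (intro set_eqI iffI)
    fix x assume "x \<in> jump_set I w"
    then show "x \<in> {x \<in> I. measure M {x} \<noteq> 0}"
      using jump_eq[of x] unfolding jump_set_def by auto
  next
    fix x assume "x \<in> {x \<in> I. measure M {x} \<noteq> 0}"
    then show "x \<in> jump_set I w"
      using jump_eq[of x] \<open>\<And>x. x \<in> I \<Longrightarrow> measure M {x} \<noteq> 0 \<Longrightarrow> norm (\<sigma> x) = 1\<close>[of x]
      unfolding jump_set_def by auto
  qed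
qed

lemma countable_jump_set: "countable (jump_set I w)"
  unfolding jump_set_eq by (rule countable_subset[OF _ countable_support]) blast

lemma jump_set_sets: "jump_set I w \<in> sets borel" 
  by (rule sets.countable[OF _ countable_jump_set]) simp

text \<open>The chain rule for the square of the norm, the derivative being weighted with the sum of the two
  one-sided values. The double integral of \<open>\<sigma> y \<bullet> \<sigma> y'\<close> over the square is split
  along the diagonal, and Fubini exchanges the roles of \<open>y\<close> and \<open>y'\<close> in one half; the
  diagonal itself is accounted for by the right-continuous version.\<close>

lemma cum_left_square:
  "cum_left M \<sigma> x \<bullet> cum_left M \<sigma> x = (LINT y|M. indicator {..<x} y * ((cum_left M \<sigma> y + cum_right M \<sigma> y) \<bullet> \<sigma> y))"
proof -
  interpret P: pair_sigma_finite M M ..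
  note i = integrable_indicator_scaleR[OF id_meas integrable_dens]
  define f where "f y y' = indicator {..<y'} y * indicator {..<x} y' * (\<sigma> y \<bullet> \<sigma> y')" for y y'
  have f: "integrable (M \<Otimes>\<^sub>M M) (case_prod f)"
  proof (rule integrable_pair_if_AE_bounded[OF finite_measure_tv finite_measure_tv])
    have eq: "case_prod f = (\<lambda>p. (if fst p < snd p then 1 else 0) * (if snd p < x then 1 else 0) * (\<sigma> (fst p) \<bullet> \<sigma> (snd p)))"
      by (auto simp: fun_eq_iff f_def indicator_def)
    have 1: "(\<lambda>p. fst p) \<in> borel_measurable (M \<Otimes>\<^sub>M M)" "(\<lambda>p. snd p) \<in> borel_measurable (M \<Otimes>\<^sub>M M)"
      by (rule measurable_compose[OF measurable_fst id_meas] measurable_compose[OF measurable_snd id_meas])+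
    have [measurable]: "Measurable.pred (M \<Otimes>\<^sub>M M) (\<lambda>p. fst p < snd p)" "Measurable.pred (M \<Otimes>\<^sub>M M) (\<lambda>p. snd p < x)"
      using 1 by (auto intro: borel_measurable_pred_less)
    show "case_prod f \<in> borel_measurable (M \<Otimes>\<^sub>M M)" unfolding eq by measurable
    show "AE y in M. AE x in M. norm (case_prod f (y, x)) \<le> 1"
      using norm_dens_le
    proof eventually_elim
      case (elim y)
      show ?case using norm_dens_le
      proof eventually_elim
        case (elim y')
        have "\<bar>\<sigma> y \<bullet> \<sigma> y'\<bar> \<le> 1 * 1"
          by (rule order_trans[OF Cauchy_Schwarz_ineq2 mult_mono]) (use elim \<open>norm (\<sigma> y) \<le> 1\<close> in auto)
        then show ?case by (auto simp: f_def indicator_def abs_mult)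
      qed
    qed
  qed
  have 1: "(LINT y|M. LINT y'|M. f y y') = (LINT y'|M. LINT y|M. f y y')"
    using P.Fubini_integral[OF f] by simp
  have 2: "(LINT y|M. f y y') = indicator {..<x} y' * (cum_left M \<sigma> y' \<bullet> \<sigma> y')" for y'
  proof -
    have "(LINT y|M. f y y') = (LINT y|M. (indicator {..<y'} y *\<^sub>R \<sigma> y) \<bullet> (indicator {..<x} y' *\<^sub>R \<sigma> y'))"
      by (intro Bochner_Integration.integral_cong) (auto simp: f_def)
    also have "\<dots> = cum_left M \<sigma> y' \<bullet> (indicator {..<x} y' *\<^sub>R \<sigma> y')"
      unfolding cum_left_def by (rule integral_inner_left) (auto intro: i)
    finally show ?thesis by simp
  qed
  have 3: "(LINT y'|M. f y y') = indicator {..<x} y * (\<sigma> y \<bullet> (cum_left M \<sigma> x - cum_right M \<sigma> y))" for y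
  proof (cases "y < x")
    case True
    have "(LINT y'|M. f y y') = (LINT y'|M. \<sigma> y \<bullet> (indicator {..<x} y' *\<^sub>R \<sigma> y' - indicator {..y} y' *\<^sub>R \<sigma> y'))"
      using True by (intro Bochner_Integration.integral_cong) (auto simp: f_def indicator_def)
    also have "\<dots> = \<sigma> y \<bullet> (LINT y'|M. (indicator {..<x} y' *\<^sub>R \<sigma> y' - indicator {..y} y' *\<^sub>R \<sigma> y'))"
      by (rule integral_inner_right) (auto intro!: i Bochner_Integration.integrable_diff)
    also have "\<dots> = \<sigma> y \<bullet> (cum_left M \<sigma> x - cum_right M \<sigma> y)"
      unfolding cum_left_def cum_right_def by (subst Bochner_Integration.integral_diff) (auto intro: i)
    finally show ?thesis using True by simp
  next
    case False
    then have "f y y' = 0" for y' by (auto simp: f_def indicator_def)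
    then show ?thesis using False by simp
  qed
  have "integrable M (\<lambda>y. LINT y'|M. f y y')" using P.integrable_fst[OF f] .
  then have i3: "integrable M (\<lambda>y. indicator {..<x} y * (\<sigma> y \<bullet> (cum_left M \<sigma> x - cum_right M \<sigma> y)))" unfolding 3 .
  have i2: "integrable M (\<lambda>y. indicator {..<x} y * (cum_left M \<sigma> y \<bullet> \<sigma> y))"
    using P.integrable_snd[OF f] unfolding 2 .
  have i0: "integrable M (\<lambda>y. cum_left M \<sigma> x \<bullet> (indicator {..<x} y *\<^sub>R \<sigma> y))"
    by (intro integrable_inner_right) (auto intro: i)
  have "cum_left M \<sigma> x \<bullet> cum_left M \<sigma> x = (LINT y|M. cum_left M \<sigma> x \<bullet> (indicator {..<x} y *\<^sub>R \<sigma> y))"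
    by (subst (2) cum_left_def, rule integral_inner_right[symmetric]) (auto intro: i)
  also have "\<dots> = (LINT y|M. cum_left M \<sigma> x \<bullet> (indicator {..<x} y *\<^sub>R \<sigma> y)) 
      - (LINT y|M. LINT y'|M. f y y') + (LINT y'|M. LINT y|M. f y y')" using 1 by simp
  also have "\<dots> = (LINT y|M. cum_left M \<sigma> x \<bullet> (indicator {..<x} y *\<^sub>R \<sigma> y)
      - indicator {..<x} y * (\<sigma> y \<bullet> (cum_left M \<sigma> x - cum_right M \<sigma> y)) + indicator {..<x} y * (cum_left M \<sigma> y \<bullet> \<sigma> y))"
    unfolding 2 3 using i0 i2 i3 by simp
  also have "\<dots> = (LINT y|M. indicator {..<x} y * ((cum_left M \<sigma> y + cum_right M \<sigma> y) \<bullet> \<sigma> y))"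
    by (intro Bochner_Integration.integral_cong) (auto simp: algebra_simps inner_commute inner_diff_left inner_diff_right inner_add_left)
  finally show ?thesis .
qed

abbreviation "S \<equiv> sing_set I w"

lemma emeasure_density_indicator:
  assumes "A \<in> sets M" "B \<in> sets M"
  shows "emeasure (density M (indicator A)) B = emeasure M (A \<inter> B)"
  using assms by (subst emeasure_density) (auto simp: indicator_inter_arith[symmetric])

text \<open>Among the Lebesgue null sets one of maximal variation exists, since countable unions of null sets are
  null. Off such a set a null set has no variation, for otherwise the maximum could be enlarged.\<close>

lemma sing_set_props:
  "S \<in> null_sets (leb I) \<and> absolutely_continuous (leb I) (density M (indicator (I - S)))"
proof -
  obtain f :: "nat \<Rightarrow> ennreal" where f: "range f \<subseteq> emeasure M ` null_sets (leb I)"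
    "Sup (emeasure M ` null_sets (leb I)) = Sup (range f)"
    using ennreal_Sup_countable_SUP[of "emeasure M ` null_sets (leb I)"] by auto
  then have "\<forall>n. \<exists>A. A \<in> null_sets (leb I) \<and> f n = emeasure M A" by blast
  then obtain A where A: "\<And>n::nat. A n \<in> null_sets (leb I)" "\<And>n. f n = emeasure M (A n)"
    by metis
  define B where "B = (\<Union>n. A n)"
  have B: "B \<in> null_sets (leb I)" unfolding B_def using A(1) by (rule null_sets_UN)
  have BM: "B \<in> sets M" using B by (auto simp: sets_M)
  have max: "emeasure M A' \<le> emeasure M B" if "A' \<in> null_sets (leb I)" for A'
  proof -
    have "emeasure M A' \<le> Sup (range f)" unfolding f(2)[symmetric] using that by (intro Sup_upper) auto
    also have "\<dots> \<le> emeasure M B"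
      using A(2) BM by (intro SUP_least) (auto simp: B_def intro!: emeasure_mono)
    finally show ?thesis .
  qed
  have "absolutely_continuous (leb I) (density M (indicator (I - B)))"
    unfolding absolutely_continuous_def
  proof
    fix C assume C: "C \<in> null_sets (leb I)"
    have CM: "C \<in> sets M" using C by (auto simp: sets_M)
    have "emeasure M (B \<union> C) \<le> emeasure M B" using B C by (intro max) auto
    then have le: "measure M (B \<union> C) \<le> measure M B" by (simp add: emeasure_eq_measure)
    have "measure M (B \<union> C) = measure M B + measure M (C - B)"
      using BM CM by (rule finite_measure_Union')
    then have "measure M (C - B) = 0" using le measure_nonneg[of M "C - B"] by linarith
    moreover have "(I - B) \<inter> C = C - B" using sets.sets_into_space[OF CM] by (auto simp: space_M)
    moreover have "I - B \<in> sets M" using sets.compl_sets[OF BM] by (simp add: space_M)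
    ultimately have "emeasure (density M (indicator (I - B))) C = 0"
      using CM by (simp add: emeasure_density_indicator emeasure_eq_measure)
    then show "C \<in> null_sets (density M (indicator (I - B)))" using CM by (auto simp: null_sets_def)
  qed
  with B have "B \<in> null_sets (leb I) \<and> absolutely_continuous (leb I) (density M (indicator (I - B)))" by blast
  from someI[of "\<lambda>S. S \<in> null_sets (leb I) \<and> absolutely_continuous (leb I) (density M (indicator (I - S)))", OF this]
  show ?thesis unfolding sing_set_def .
qed

lemma S_sets: "S \<in> sets M" using sing_set_props by (auto simp: sets_M)

lemma compl_S_sets: "I - S \<in> sets M"
  using sets.compl_sets[OF S_sets] by (simp add: space_M)

lemma finite_density_compl: "finite_measure (density M (indicator (I - S)))"
proof
  have "emeasure (density M (indicator (I - S))) I = emeasure M ((I - S) \<inter> I)"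
    by (intro emeasure_density_indicator compl_S_sets) (simp add: sets_M sets_I_iff)
  then show "emeasure (density M (indicator (I - S))) (space (density M (indicator (I - S)))) \<noteq> \<infinity>"
    by (simp add: space_M emeasure_eq_measure)
qed

text \<open>The scalar density of the absolutely continuous part of \<open>M\<close>.\<close>

definition "ac_rate x = enn2real (RN_deriv (leb I) (density M (indicator (I - S))) x)"

lemma ac_density_eq: "ac_density I w x = ac_rate x *\<^sub>R \<sigma> x"
  by (simp add: ac_density_def ac_rate_def)

lemma borel_measurable_ac_rate: "ac_rate \<in> borel_measurable (leb I)"
  unfolding ac_rate_def by (intro borel_measurable_enn2real borel_measurable_RN_deriv)

lemma density_ac_rate: "density (leb I) (\<lambda>x. ennreal (ac_rate x)) = density M (indicator (I - S))"
proof -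
  interpret L: finite_measure "leb I" by (rule finite_measure_leb_interval)
  let ?D = "density M (indicator (I - S))" and ?f = "RN_deriv (leb I) (density M (indicator (I - S)))"
  have ac: "absolutely_continuous (leb I) ?D" and s: "sets ?D = sets (leb I)"
    using sing_set_props by (simp_all add: sets_M)
  interpret D: finite_measure ?D by (rule finite_density_compl)
  have fin: "AE x in leb I. ?f x \<noteq> \<infinity>"
    by (rule L.RN_deriv_finite[OF _ ac s]) unfold_locales
  have "density (leb I) (\<lambda>x. ennreal (ac_rate x)) = density (leb I) ?f"
  proof (rule density_cong)
    show "AE x in leb I. ennreal (ac_rate x) = ?f x"
      using fin by eventually_elim (simp add: ac_rate_def less_top)
  qed (use borel_measurable_ac_rate in measurable)
  also have "\<dots> = ?D" by (rule L.density_RN_deriv[OF ac s])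
  finally show ?thesis .
qed

lemma measurable_M_iff: "f \<in> borel_measurable M \<longleftrightarrow> f \<in> borel_measurable (leb I)"
  by (simp add: measurable_cong_sets[OF sets_M refl])

lemma nn_integral_ac:
  assumes g: "g \<in> borel_measurable (leb I)"
  shows "(\<integral>\<^sup>+ x. indicator (I - S) x * ennreal \<bar>g x \<bullet> \<sigma> x\<bar> \<partial>M) = (\<integral>\<^sup>+ x. ennreal \<bar>g x \<bullet> ac_density I w x\<bar> \<partial>leb I)"
proof -
  have gM: "g \<in> borel_measurable M" using g by (simp add: measurable_M_iff)
  have sL: "\<sigma> \<in> borel_measurable (leb I)" using dens_meas by (simp add: measurable_M_iff)
  have "(\<integral>\<^sup>+ x. indicator (I - S) x * ennreal \<bar>g x \<bullet> \<sigma> x\<bar> \<partial>M) = (\<integral>\<^sup>+ x. ennreal \<bar>g x \<bullet> \<sigma> x\<bar> \<partial>density M (indicator (I - S)))"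
    by (rule nn_integral_density[symmetric]) (use gM dens_meas compl_S_sets in measurable)
  also have "\<dots> = (\<integral>\<^sup>+ x. ennreal \<bar>g x \<bullet> \<sigma> x\<bar> \<partial>density (leb I) (\<lambda>x. ennreal (ac_rate x)))"
    by (simp add: density_ac_rate)
  also have "\<dots> = (\<integral>\<^sup>+ x. ennreal (ac_rate x) * ennreal \<bar>g x \<bullet> \<sigma> x\<bar> \<partial>leb I)"
    by (rule nn_integral_density) (use g sL borel_measurable_ac_rate in measurable)
  also have "\<dots> = (\<integral>\<^sup>+ x. ennreal \<bar>g x \<bullet> ac_density I w x\<bar> \<partial>leb I)"
    by (intro nn_integral_cong)
      (simp add: ac_density_eq abs_mult ac_rate_def ennreal_mult)
  finally show ?thesis .
qed

lemma integral_ac: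
  shows "integrable (leb I) (ac_density I w)"
    and "(LINT x|leb I. ac_density I w x) = (LINT x|M. indicator (I - S) x *\<^sub>R \<sigma> x)"
proof -
  have sL: "\<sigma> \<in> borel_measurable (leb I)" using dens_meas by (simp add: measurable_M_iff)
  have i: "integrable M (\<lambda>x. indicator (I - S) x *\<^sub>R \<sigma> x)"
    using integrable_mult_indicator[OF compl_S_sets integrable_dens] .
  have eq: "density M (\<lambda>x. ennreal (indicator (I - S) x)) = density M (indicator (I - S))"
    by (simp only: ennreal_indicator)
  have im: "(indicator (I - S) :: real \<Rightarrow> real) \<in> borel_measurable M" by (rule borel_measurable_indicator[OF compl_S_sets])
  have "integrable (density M (indicator (I - S))) \<sigma>"
    unfolding eq[symmetric] using i by (subst integrable_density[OF dens_meas im]) auto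
  then have "integrable (density (leb I) (\<lambda>x. ennreal (ac_rate x))) \<sigma>" by (simp add: density_ac_rate)
  then show "integrable (leb I) (ac_density I w)"
    unfolding ac_density_eq[abs_def] by (subst (asm) integrable_density[OF sL borel_measurable_ac_rate]) (auto simp: ac_rate_def)
  have "(LINT x|M. indicator (I - S) x *\<^sub>R \<sigma> x) = (LINT x|density M (indicator (I - S)). \<sigma> x)"
    unfolding eq[symmetric] by (rule integral_density[OF dens_meas im, symmetric]) auto
  also have "\<dots> = (LINT x|density (leb I) (\<lambda>x. ennreal (ac_rate x)). \<sigma> x)" by (simp add: density_ac_rate)
  also have "\<dots> = (LINT x|leb I. ac_rate x *\<^sub>R \<sigma> x)"
    by (rule integral_density[OF sL borel_measurable_ac_rate]) (auto simp: ac_rate_def)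
  finally show "(LINT x|leb I. ac_density I w x) = (LINT x|M. indicator (I - S) x *\<^sub>R \<sigma> x)"
    by (simp add: ac_density_eq)
qed

lemma jump_set_sets_M: "jump_set I w \<in> sets M"
  using jump_set_sets by (auto simp: sets_M sets_I_iff jump_set_def)

lemma AE_diffuse_iff: "(AE x in tv_diffuse I w. P x) \<longleftrightarrow> (AE x in M. x \<notin> jump_set I w \<longrightarrow> P x)"
proof -
  have "I - jump_set I w \<in> sets M" using sets.compl_sets[OF jump_set_sets_M] by (simp add: space_M)
  then have "(AE x in tv_diffuse I w. P x) \<longleftrightarrow> (AE x in M. 0 < (indicator (I - jump_set I w) x :: ennreal) \<longrightarrow> P x)"
    unfolding tv_diffuse_def by (intro AE_density borel_measurable_indicator)
  also have "\<dots> \<longleftrightarrow> (AE x in M. x \<notin> jump_set I w \<longrightarrow> P x)"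
    by (rule AE_cong) (auto simp: indicator_def space_M)
  finally show ?thesis .
qed

lemma AE_cantor_iff: "(AE x in tv_cantor I w. P x) \<longleftrightarrow> (AE x in M. x \<notin> jump_set I w \<longrightarrow> x \<in> S \<longrightarrow> P x)"
proof -
  have "S \<in> sets (tv_diffuse I w)" using S_sets by (simp add: tv_diffuse_def)
  then have "(AE x in tv_cantor I w. P x) \<longleftrightarrow> (AE x in tv_diffuse I w. 0 < (indicator S x :: ennreal) \<longrightarrow> P x)"
    unfolding tv_cantor_def by (intro AE_density borel_measurable_indicator)
  also have "\<dots> \<longleftrightarrow> (AE x in M. x \<notin> jump_set I w \<longrightarrow> x \<in> S \<longrightarrow> P x)"
    unfolding AE_diffuse_iff by (rule AE_cong) (auto simp: indicator_def)
  finally show ?thesis .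
qed

end

text \<open>Compare \<open>h\<close> with its positive part; a non-integrable \<open>h\<close> has integral
  \<open>0\<close> by convention.\<close>

lemma integral_le_nn_integral_bound:
  fixes h k :: "'b \<Rightarrow> real"
  assumes "AE x in M. h x \<le> k x"
  shows "ennreal (LINT x|M. h x) \<le> (\<integral>\<^sup>+ x. ennreal (k x) \<partial>M)"
proof (cases "integrable M h")
  case True
  then have i: "integrable M (\<lambda>x. max 0 (h x))" by (intro integrable_max) auto
  have "ennreal (LINT x|M. h x) \<le> ennreal (LINT x|M. max 0 (h x))"
    by (intro ennreal_leI integral_mono True i) auto
  also have "\<dots> = (\<integral>\<^sup>+ x. ennreal (max 0 (h x)) \<partial>M)"
    by (rule nn_integral_eq_integral[symmetric, OF i]) auto
  also have "\<dots> \<le> (\<integral>\<^sup>+ x. ennreal (k x) \<partial>M)"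
    by (rule nn_integral_mono_AE) (use assms in \<open>eventually_elim, auto simp: max_def intro: ennreal_leI\<close>)
  finally show ?thesis .
qed (simp add: not_integrable_integral_eq)

section \<open>Tangent spaces, short curves and the geodesic distance\<close>

lemma Ck_on_cong:
  assumes "open S" "\<And>x. x \<in> S \<Longrightarrow> f x = g x" "Ck_on k S f"
  shows "Ck_on k S g"
  using assms(2,3)
proof (induction k arbitrary: f g)
  case 0
  then show ?case by (simp cong: continuous_on_cong)
next
  case (Suc k)
  have d: "f differentiable (at x)" if "x \<in> S" for x using Suc.prems that by simp
  have 1: "g differentiable (at x)" if "x \<in> S" for x
    using d[OF that] Suc.prems(1) assms(1) that
    unfolding differentiable_def by (blast intro: has_derivative_transform_within_open)
  have 2: "frechet_derivative f (at x) = frechet_derivative g (at x)" if "x \<in> S" for x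
    using d[OF that] assms(1) that Suc.prems(1) by (rule frechet_derivative_transform_within_open)
  have "Ck_on k S (\<lambda>x. frechet_derivative g (at x) v)" for v
  proof (rule Suc.IH)
    show "Ck_on k S (\<lambda>x. frechet_derivative f (at x) v)" using Suc.prems(2) by simp
  qed (simp add: 2)
  then show ?case using 1 by simp
qed

text \<open>The factor \<open>c\<close> makes the induction go through: differentiating along \<open>s\<close>
  produces another factor \<open>s\<close>.\<close>

lemma Ck_on_affine:
  fixes f :: "'a::real_normed_vector \<Rightarrow> 'b::real_normed_vector"
  assumes "open S" "\<And>t. t \<in> S \<Longrightarrow> x0 + t *\<^sub>R w \<in> V" "Ck_on k V f"
  shows "Ck_on k S (\<lambda>t::real. c *\<^sub>R f (x0 + t *\<^sub>R w))"
  using assms(3)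
proof (induction k arbitrary: f c)
  case 0
  then have f: "continuous_on V f" by simp
  have "continuous_on S (f \<circ> (\<lambda>t. x0 + t *\<^sub>R w))"
    by (intro continuous_on_compose continuous_on_subset[OF f] continuous_intros) (use assms(2) in auto)
  then show ?case by (auto simp: o_def intro!: continuous_intros)
next
  case (Suc k)
  have D: "((\<lambda>t. c *\<^sub>R f (x0 + t *\<^sub>R w)) has_derivative (\<lambda>s. c *\<^sub>R frechet_derivative f (at (x0 + t *\<^sub>R w)) (s *\<^sub>R w))) (at t)"
    if "t \<in> S" for t
  proof -
    have "f differentiable (at (x0 + t *\<^sub>R w))" using Suc.prems assms(2)[OF that] by simp
    then have f: "(f has_derivative frechet_derivative f (at (x0 + t *\<^sub>R w))) (at (x0 + t *\<^sub>R w))"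
      by (simp add: frechet_derivative_works)
    have "((\<lambda>t. x0 + t *\<^sub>R w) has_derivative (\<lambda>s. s *\<^sub>R w)) (at t)"
      by (auto intro!: derivative_eq_intros)
    from has_derivative_compose[OF this f]
    show ?thesis by (rule has_derivative_scaleR_right)
  qed
  have "Ck_on k S (\<lambda>x. frechet_derivative (\<lambda>t. c *\<^sub>R f (x0 + t *\<^sub>R w)) (at x) s)" for s
  proof (rule Ck_on_cong[OF assms(1)])
    show "Ck_on k S (\<lambda>t. (c * s) *\<^sub>R frechet_derivative f (at (x0 + t *\<^sub>R w)) w)"
      by (rule Suc.IH) (use Suc.prems in simp)
    fix t assume t: "t \<in> S"
    have "linear (frechet_derivative f (at (x0 + t *\<^sub>R w)))"
      by (rule linear_frechet_derivative) (use Suc.prems assms(2)[OF t] in simp)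
    then show "(c * s) *\<^sub>R frechet_derivative f (at (x0 + t *\<^sub>R w)) w
        = frechet_derivative (\<lambda>t. c *\<^sub>R f (x0 + t *\<^sub>R w)) (at t) s"
      unfolding frechet_derivative_at[OF D[OF t], symmetric] by (simp add: linear_cmul)
  qed
  then show ?case using D by (auto simp: differentiable_def)
qed

lemma smooth_on_affine:
  assumes "open S" "\<And>t. t \<in> S \<Longrightarrow> x0 + t *\<^sub>R w \<in> V" "smooth_on V f"
  shows "smooth_on S (\<lambda>t::real. f (x0 + t *\<^sub>R w))"
  unfolding smooth_on_def
proof
  fix k
  have "Ck_on k S (\<lambda>t. 1 *\<^sub>R f (x0 + t *\<^sub>R w))"
    by (rule Ck_on_affine[OF assms(1,2)]) (use assms(3) in \<open>auto simp: smooth_on_def\<close>)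
  then show "Ck_on k S (\<lambda>t. f (x0 + t *\<^sub>R w))" by simp
qed

lemma smooth_on_has_derivative:
  "smooth_on S f \<Longrightarrow> x \<in> S \<Longrightarrow> (f has_derivative frechet_derivative f (at x)) (at x)"
  unfolding smooth_on_def by (drule spec[of _ "Suc 0"]) (simp add: frechet_derivative_works)

lemma smooth_on_frechet: "smooth_on S f \<Longrightarrow> smooth_on S (\<lambda>x. frechet_derivative f (at x) v)"
  unfolding smooth_on_def
proof
  fix k assume "\<forall>k. Ck_on k S f"
  then have "Ck_on (Suc k) S f" ..
  then show "Ck_on k S (\<lambda>x. frechet_derivative f (at x) v)" by simp
qed

lemma smooth_on_continuous: "smooth_on S f \<Longrightarrow> continuous_on S f"
  unfolding smooth_on_def by (drule spec[of _ 0]) simp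

lemma smooth_on_vector_derivative:
  fixes \<gamma> :: "real \<Rightarrow> 'a::real_normed_vector"
  assumes "smooth_on S \<gamma>" "x \<in> S"
  shows "(\<gamma> has_vector_derivative frechet_derivative \<gamma> (at x) 1) (at x)"
proof -
  note d = smooth_on_has_derivative[OF assms]
  have "frechet_derivative \<gamma> (at x) s = s *\<^sub>R frechet_derivative \<gamma> (at x) 1" for s
    using linear_cmul[OF has_derivative_linear[OF d], of s 1] by simp
  then have "frechet_derivative \<gamma> (at x) = (\<lambda>s. s *\<^sub>R frechet_derivative \<gamma> (at x) 1)" by (rule ext)
  from has_derivative_eq_rhs[OF d this] show ?thesis unfolding has_vector_derivative_def .
qed

text \<open>The definition of smoothness gives continuity of each directional derivative separately; finitely many
  basis directions suffice for a uniform bound.\<close>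

lemma derivative_bound_on_compact:
  fixes f :: "'a::euclidean_space \<Rightarrow> 'b::real_normed_vector"
  assumes f: "smooth_on V f" and K: "compact K" "K \<subseteq> V"
  shows "\<exists>B\<ge>0. \<forall>x\<in>K. \<forall>h. norm (frechet_derivative f (at x) h) \<le> B * norm h"
proof -
  have "\<exists>B\<ge>0. \<forall>x\<in>K. norm (frechet_derivative f (at x) v) \<le> B" for v
  proof -
    have "continuous_on K (\<lambda>x. frechet_derivative f (at x) v)"
      using smooth_on_continuous[OF smooth_on_frechet[OF f]] K(2) by (rule continuous_on_subset)
    then have "bounded ((\<lambda>x. frechet_derivative f (at x) v) ` K)"
      using K(1) by (intro compact_imp_bounded compact_continuous_image)
    then show ?thesis unfolding bounded_pos by (auto intro: less_imp_le)
  qed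
  then obtain B where B: "\<And>v. B v \<ge> 0" "\<And>v x. x \<in> K \<Longrightarrow> norm (frechet_derivative f (at x) v) \<le> B v"
    by metis
  show ?thesis
  proof (intro exI[of _ "\<Sum>i\<in>Basis. B i"] conjI ballI allI)
    show "0 \<le> (\<Sum>i\<in>Basis. B i)" using B(1) by (simp add: sum_nonneg)
    fix x h assume x: "x \<in> K"
    have lin: "linear (frechet_derivative f (at x))"
      using smooth_on_has_derivative[OF f] x K(2) by (blast intro: has_derivative_linear)
    have "frechet_derivative f (at x) h = frechet_derivative f (at x) (\<Sum>i\<in>Basis. (h \<bullet> i) *\<^sub>R i)"
      by (simp add: euclidean_representation)
    also have "\<dots> = (\<Sum>i\<in>Basis. (h \<bullet> i) *\<^sub>R frechet_derivative f (at x) i)"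
      using lin by (simp add: linear_sum linear_cmul)
    also have "norm \<dots> \<le> (\<Sum>i\<in>Basis. norm h * B i)"
    proof (rule sum_norm_le)
      fix i :: 'a assume "i \<in> Basis"
      then have "\<bar>h \<bullet> i\<bar> \<le> norm h" by (rule Basis_le_norm)
      then show "norm ((h \<bullet> i) *\<^sub>R frechet_derivative f (at x) i) \<le> norm h * B i"
        using B x by (auto intro!: mult_mono)
    qed
    finally show "norm (frechet_derivative f (at x) h) \<le> (\<Sum>i\<in>Basis. B i) * norm h"
      by (simp add: sum_distrib_left mult.commute)
  qed
qed

lemma vector_derivative_chain:
  assumes "(f has_vector_derivative d) (at x)" "(g has_derivative A) (at (f x))"
  shows "((\<lambda>t. g (f t)) has_vector_derivative A d) (at x)"
  using vector_derivative_diff_chain_within[OF assms(1) has_derivative_at_withinI[OF assms(2)]]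
  by (simp add: o_def)

text \<open>The component of \<open>f\<close> orthogonal to \<open>L\<close> vanishes near \<open>x\<close>, so its
  derivative does too.\<close>

lemma vector_derivative_in_subspace:
  fixes f :: "real \<Rightarrow> 'a::euclidean_space"
  assumes L: "subspace L" and ev: "eventually (\<lambda>t. f t \<in> L) (nhds x)"
    and f: "(f has_vector_derivative d) (at x)"
  shows "d \<in> L"
proof -
  obtain y z where yz: "y \<in> span L" "\<And>w. w \<in> span L \<Longrightarrow> orthogonal z w" "d = y + z"
    using orthogonal_subspace_decomp_exists[of L d] by metis
  have sp: "span L = L" using L by (simp add: span_eq_iff)
  have "((\<lambda>t. f t \<bullet> z) has_vector_derivative d \<bullet> z) (at x)"
    by (rule bounded_linear.has_vector_derivative[OF bounded_linear_inner_left f])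
  moreover have ev0: "eventually (\<lambda>t. f t \<bullet> z = 0) (nhds x)"
    using ev
  proof eventually_elim
    case (elim t)
    then have "orthogonal z (f t)" using yz(2) sp by simp
    then show ?case by (simp add: orthogonal_def inner_commute)
  qed
  have "((\<lambda>t. f t \<bullet> z) has_vector_derivative 0) (at x)"
    by (subst has_vector_derivative_cong_ev[where g = "\<lambda>_. 0"])
      (use ev0 eventually_nhds_x_imp_x[OF ev0] in \<open>auto elim: eventually_mono\<close>)
  ultimately have "d \<bullet> z = 0" by (rule vector_derivative_unique_at)
  then have "z = 0" using yz(2)[OF yz(1)] by (simp add: yz(3) inner_add_left inner_add_right orthogonal_def inner_commute)
  then show ?thesis using yz sp by simp
qed

lemma submanifold_chartE:
  fixes N :: "'a::euclidean_space set"
  assumes N: "smooth_submanifold n N" and p: "p \<in> N"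
  obtains U V \<Phi> \<Psi> L where "open U" "p \<in> U" "open (V :: 'a set)" "homeomorphism U V \<Phi> \<Psi>"
    "smooth_on U \<Phi>" "smooth_on V \<Psi>" "subspace L" "\<Phi> ` (N \<inter> U) = L \<inter> V"
proof -
  from bspec[OF N[unfolded smooth_submanifold_def] p] show thesis
    by (elim exE conjE) (rule that, assumption+)
qed

text \<open>In a chart \<open>\<Phi>\<close> with inverse \<open>\<Psi>\<close> that flattens \<open>N\<close> to
  the linear space \<open>L\<close>, the tangent space is the image of \<open>L\<close> under the derivative of
  \<open>\<Psi>\<close>: curves in \<open>N\<close> are mapped to curves in \<open>L\<close>, and straight lines in
  \<open>L\<close> are mapped to curves in \<open>N\<close>.\<close>

lemma tangent_space_subspace:
  fixes N :: "'a::euclidean_space set"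
  assumes N: "smooth_submanifold n N" and p: "p \<in> N"
  shows "subspace (tangent_space N p)"
proof -
  obtain U V \<Phi> \<Psi> L where "open U" "p \<in> U" "open (V :: 'a set)" and hom: "homeomorphism U V \<Phi> \<Psi>"
    and \<Phi>: "smooth_on U \<Phi>" and \<Psi>: "smooth_on V \<Psi>" and L: "subspace L" and im: "\<Phi> ` (N \<inter> U) = L \<inter> V"
    using N p by (rule submanifold_chartE)
  have pV: "\<Phi> p \<in> V" "\<Phi> p \<in> L" "\<Psi> (\<Phi> p) = p"
    using hom \<open>p \<in> U\<close> p im unfolding homeomorphism_def by auto
  define A where "A = frechet_derivative \<Psi> (at (\<Phi> p))"
  have A: "(\<Psi> has_derivative A) (at (\<Phi> p))"
    unfolding A_def by (rule smooth_on_has_derivative[OF \<Psi> pV(1)])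
  have "tangent_space N p = A ` L"
  proof (intro set_eqI iffI)
    fix v assume "v \<in> tangent_space N p"
    then obtain \<gamma> e where e: "e > 0" "smooth_on {-e<..<e} \<gamma>" "\<gamma> ` {-e<..<e} \<subseteq> N"
      and \<gamma>: "\<gamma> 0 = p" "(\<gamma> has_vector_derivative v) (at 0)"
      unfolding tangent_space_def curve_through_def by blast
    define d where "d = frechet_derivative \<Phi> (at p) v"
    have D: "((\<lambda>t. \<Phi> (\<gamma> t)) has_vector_derivative d) (at 0)"
      unfolding d_def
      by (rule vector_derivative_chain[OF \<gamma>(2)]) (use smooth_on_has_derivative[OF \<Phi> \<open>p \<in> U\<close>] \<gamma>(1) in simp)
    have "continuous (at 0) \<gamma>" using \<gamma>(2) by (rule has_vector_derivative_continuous)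
    then have "(\<gamma> \<longlongrightarrow> p) (nhds 0)" using \<gamma>(1) by (simp add: continuous_at isCont_def tendsto_nhds_iff)
    then have "eventually (\<lambda>t. \<gamma> t \<in> U) (nhds 0)"
      by (rule topological_tendstoD) (use \<open>open U\<close> \<open>p \<in> U\<close> in auto)
    moreover have "eventually (\<lambda>t. t \<in> {-e<..<e}) (nhds (0::real))"
      by (rule eventually_nhds_in_open) (use e in auto)
    ultimately have ev: "eventually (\<lambda>t. \<gamma> t \<in> N \<inter> U) (nhds 0)"
      by eventually_elim (use e in auto)
    then have "eventually (\<lambda>t. \<Phi> (\<gamma> t) \<in> L) (nhds 0)"
      by eventually_elim (use im in auto)
    from vector_derivative_in_subspace[OF L this D] have "d \<in> L" .
    have "((\<lambda>t. \<Psi> (\<Phi> (\<gamma> t))) has_vector_derivative A d) (at 0)"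
      by (rule vector_derivative_chain[OF D]) (use A \<gamma>(1) in simp)
    moreover have "eventually (\<lambda>t. \<Psi> (\<Phi> (\<gamma> t)) = \<gamma> t) (nhds 0)"
      using ev by eventually_elim (use hom in \<open>auto simp: homeomorphism_def\<close>)
    then have "((\<lambda>t. \<Psi> (\<Phi> (\<gamma> t))) has_vector_derivative A d) (at 0) = (\<gamma> has_vector_derivative A d) (at 0)"
      by (intro has_vector_derivative_cong_ev) (use pV \<gamma>(1) in \<open>auto elim: eventually_mono\<close>)
    ultimately have "(\<gamma> has_vector_derivative A d) (at 0)" by simp
    then have "v = A d" using \<gamma>(2) vector_derivative_unique_at by blast
    then show "v \<in> A ` L" using \<open>d \<in> L\<close> by blast
  next
    fix v assume "v \<in> A ` L"
    then obtain w where w: "w \<in> L" "v = A w" by blast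
    obtain r where r: "r > 0" "ball (\<Phi> p) r \<subseteq> V"
      using \<open>open V\<close> pV(1) open_contains_ball by blast
    \<comment> \<open>the line through \<open>\<Phi> p\<close> in direction \<open>w\<close> stays in the ball of
      radius \<open>r\<close> for times below \<open>e\<close>\<close>
    define e where "e = r / (norm w + 1)"
    have e: "e > 0" using r by (simp add: e_def add_nonneg_pos)
    have inV: "\<Phi> p + t *\<^sub>R w \<in> V" if "t \<in> {-e<..<e}" for t
    proof -
      have "norm (t *\<^sub>R w) \<le> e * norm w" using that by (auto intro!: mult_right_mono)
      also have "\<dots> < e * (norm w + 1)" using e by (simp add: distrib_left)
      also have "\<dots> = r" using norm_ge_zero[of w] by (simp add: e_def add_nonneg_eq_0_iff)
      finally show ?thesis using r by (auto simp: dist_norm)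
    qed
    have "(\<lambda>t. \<Psi> (\<Phi> p + t *\<^sub>R w)) ` {-e<..<e} \<subseteq> N"
    proof
      fix x assume "x \<in> (\<lambda>t. \<Psi> (\<Phi> p + t *\<^sub>R w)) ` {-e<..<e}"
      then obtain t where t: "t \<in> {-e<..<e}" "x = \<Psi> (\<Phi> p + t *\<^sub>R w)" by blast
      have "\<Phi> p + t *\<^sub>R w \<in> L \<inter> V" using inV[OF t(1)] pV w L by (auto intro: subspace_add subspace_scale)
      then obtain y where "y \<in> N \<inter> U" "\<Phi> p + t *\<^sub>R w = \<Phi> y" using im by blast
      then show "x \<in> N" using t hom by (auto simp: homeomorphism_def)
    qed
    moreover have "smooth_on {-e<..<e} (\<lambda>t. \<Psi> (\<Phi> p + t *\<^sub>R w))"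
      by (rule smooth_on_affine[OF _ inV \<Psi>]) auto
    moreover have "((\<lambda>t. \<Psi> (\<Phi> p + t *\<^sub>R w)) has_vector_derivative v) (at 0)"
    proof -
      have "((\<lambda>t. \<Phi> p + t *\<^sub>R w) has_vector_derivative w) (at 0)"
        by (auto intro!: derivative_eq_intros)
      then show ?thesis unfolding w(2) by (rule vector_derivative_chain) (use A in simp)
    qed
    ultimately have "curve_through N p v (\<lambda>t. \<Psi> (\<Phi> p + t *\<^sub>R w))"
      unfolding curve_through_def using e pV by auto
    then show "v \<in> tangent_space N p" unfolding tangent_space_def by blast
  qed
  then show ?thesis
    using linear_subspace_image[OF has_derivative_linear[OF A] L] by simp
qed

text \<open>On a linear tangent space the definite description in \<open>tproj\<close> denotes the orthogonal
  projection.\<close>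

lemma tproj_props:
  assumes "subspace (tangent_space N p)"
  shows tproj_in: "tproj N p v \<in> tangent_space N p"
    and tproj_orth: "y \<in> tangent_space N p \<Longrightarrow> y \<bullet> tproj N p v = y \<bullet> v"
proof -
  let ?T = "tangent_space N p"
  obtain y z where yz: "y \<in> span ?T" "\<And>w. w \<in> span ?T \<Longrightarrow> orthogonal z w" "v = y + z"
    using orthogonal_subspace_decomp_exists[of ?T v] by metis
  have sp: "span ?T = ?T" using assms by (simp add: span_eq_iff)
  have "tproj N p v = y"
    unfolding tproj_def
  proof (rule the_equality)
    show "y \<in> ?T \<and> (\<forall>x\<in>?T. (v - y) \<bullet> x = 0)"
      using yz sp by (auto simp: orthogonal_def)
    fix w assume w: "w \<in> ?T \<and> (\<forall>x\<in>?T. (v - w) \<bullet> x = 0)"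
    have m: "y - w \<in> ?T" using w yz sp assms by (auto intro: subspace_diff)
    have "(y - w) \<bullet> (y - w) = (v - w) \<bullet> (y - w) - z \<bullet> (y - w)" by (simp add: yz(3) inner_add_left inner_diff_left)
    also have "\<dots> = 0" using w m yz(2) sp by (auto simp: orthogonal_def)
    finally show "w = y" by simp
  qed
  moreover have "x \<bullet> z = 0" if "x \<in> ?T" for x using yz(2) that sp by (simp add: orthogonal_def inner_commute)
  ultimately show "tproj N p v \<in> ?T" "\<And>y. y \<in> ?T \<Longrightarrow> y \<bullet> tproj N p v = y \<bullet> v"
    using yz sp by (auto simp: inner_add_right)
qed

text \<open>A \<open>C\<^sup>1\<close> transition from \<open>0\<close> to \<open>1\<close> over the unit interval,
  constant outside.\<close>

definition step_fun :: "real \<Rightarrow> real" where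
  "step_fun s = 4 * half_sq_pos s - 8 * half_sq_pos (s - 1/2) + 4 * half_sq_pos (s - 1)"

definition step_deriv :: "real \<Rightarrow> real" where
  "step_deriv s = 4 * max 0 s - 8 * max 0 (s - 1/2) + 4 * max 0 (s - 1)"

lemma step_fun_deriv: "(step_fun has_real_derivative step_deriv s) (at s)"
proof -
  have 1: "((\<lambda>t. half_sq_pos (t - c)) has_real_derivative max 0 (s - c)) (at s)" for c
    using DERIV_shift[of half_sq_pos "max 0 (s - c)" s "- c"] half_sq_pos_deriv[of "s - c"] by simp
  have 0: "(half_sq_pos has_real_derivative max 0 s) (at s)" by (rule half_sq_pos_deriv)
  show ?thesis
    unfolding step_fun_def[abs_def] step_deriv_def by (intro DERIV_add DERIV_diff DERIV_cmult 1 0)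
qed

lemma continuous_step_deriv: "continuous_on S step_deriv"
  unfolding step_deriv_def by (intro continuous_intros)

lemma step_deriv_bounds: "0 \<le> step_deriv s" "step_deriv s \<le> 2"
  by (auto simp: step_deriv_def max_def)

lemma step_fun_left: "s \<le> 0 \<Longrightarrow> step_fun s = 0"
  by (simp add: step_fun_def half_sq_pos_def)

lemma step_fun_right: "s \<ge> 1 \<Longrightarrow> step_fun s = 1"
  by (simp add: step_fun_def half_sq_pos_def power2_eq_square field_simps)

lemma step_deriv_outside: "s \<le> 0 \<or> 1 \<le> s \<Longrightarrow> step_deriv s = 0"
  by (auto simp: step_deriv_def)

lemma step_fun_mono: "s \<le> t \<Longrightarrow> step_fun s \<le> step_fun t"
  by (rule DERIV_nonneg_imp_nondecreasing) (use step_fun_deriv step_deriv_bounds in blast)+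

lemma step_fun_bounds: "0 \<le> step_fun s" "step_fun s \<le> 1"
  using step_fun_mono[of "min 0 s" s] step_fun_mono[of s "max 1 s"]
  by (auto simp: step_fun_left step_fun_right)

text \<open>The curves stand still outside the unit interval, so that they can be concatenated without losing
  differentiability; \<open>L\<close> bounds the speed, hence the length.\<close>

definition C1_join :: "'a::euclidean_space set \<Rightarrow> 'a \<Rightarrow> 'a \<Rightarrow> real \<Rightarrow> bool" where
  "C1_join N p q L \<longleftrightarrow> (\<exists>g g'. (\<forall>t::real. (g has_vector_derivative g' t) (at t)) \<and> continuous_on UNIV g' \<and>
     (\<forall>t. g t \<in> N) \<and> (\<forall>t\<le>0. g t = p) \<and> (\<forall>t\<ge>1. g t = q) \<and>
     (\<forall>t. t \<le> 0 \<or> 1 \<le> t \<longrightarrow> g' t = 0) \<and> (\<forall>t. norm (g' t) \<le> L))"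

lemma C1_joinI:
  assumes "\<And>t::real. (g has_vector_derivative g' t) (at t)" "continuous_on UNIV g'"
    "\<And>t. g t \<in> N" "\<And>t. t \<le> 0 \<Longrightarrow> g t = p" "\<And>t. t \<ge> 1 \<Longrightarrow> g t = q"
    "\<And>t. t \<le> 0 \<or> 1 \<le> t \<Longrightarrow> g' t = 0" "\<And>t. norm (g' t) \<le> L"
  shows "C1_join N p q L"
  unfolding C1_join_def using assms by (intro exI[of _ g] exI[of _ g']) auto

lemma C1_join_mono: "C1_join N p q L \<Longrightarrow> L \<le> L' \<Longrightarrow> C1_join N p q L'"
  unfolding C1_join_def by (elim exE) (intro exI, auto intro: order_trans)

lemma has_vector_derivative_affine:
  assumes "(g has_vector_derivative d) (at (c + s * t))"
  shows "((\<lambda>t. g (c + s * t)) has_vector_derivative s *\<^sub>R d) (at (t::real))"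
proof -
  have "((\<lambda>t. c + s * t) has_vector_derivative s) (at t)"
    by (auto intro!: derivative_eq_intros)
  from vector_derivative_chain[OF this assms[unfolded has_vector_derivative_def]]
  show ?thesis by simp
qed

lemma continuous_on_affine:
  assumes "continuous_on UNIV (g :: real \<Rightarrow> 'b::real_normed_vector)"
  shows "continuous_on S (\<lambda>t. s *\<^sub>R g (c + s * t))"
  by (intro continuous_intros continuous_on_compose2[OF assms]) auto

lemma C1_join_sym:
  assumes "C1_join N p q L"
  shows "C1_join N q p L"
proof -
  obtain g g' where g: "\<And>t::real. (g has_vector_derivative g' t) (at t)" "continuous_on UNIV g'"
    "\<And>t. g t \<in> N" "\<And>t. t \<le> 0 \<Longrightarrow> g t = p" "\<And>t. t \<ge> 1 \<Longrightarrow> g t = q"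
    "\<And>t. t \<le> 0 \<or> 1 \<le> t \<Longrightarrow> g' t = 0" "\<And>t. norm (g' t) \<le> L"
    using assms unfolding C1_join_def by blast
  show ?thesis
  proof (rule C1_joinI[where g = "\<lambda>t. g (1 + (-1) * t)" and g' = "\<lambda>t. (-1) *\<^sub>R g' (1 + (-1) * t)"])
    show "((\<lambda>t. g (1 + (-1) * t)) has_vector_derivative (-1) *\<^sub>R g' (1 + (-1) * t)) (at t)" for t
      by (rule has_vector_derivative_affine[OF g(1)])
    show "continuous_on UNIV (\<lambda>t. (-1) *\<^sub>R g' (1 + (-1) * t))"
      by (rule continuous_on_affine[OF g(2)])
  qed (use g in auto)
qed

text \<open>Since each curve stands still while the other one moves, concatenation is addition followed by
  subtracting the common point \<open>q\<close>.\<close>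

lemma C1_join_trans:
  assumes "C1_join N p q L" "C1_join N q r L'"
  shows "C1_join N p r (2 * (L + L'))"
proof -
  obtain g g' where g: "\<And>t::real. (g has_vector_derivative g' t) (at t)" "continuous_on UNIV g'"
    "\<And>t. g t \<in> N" "\<And>t. t \<le> 0 \<Longrightarrow> g t = p" "\<And>t. t \<ge> 1 \<Longrightarrow> g t = q"
    "\<And>t. t \<le> 0 \<or> 1 \<le> t \<Longrightarrow> g' t = 0" "\<And>t. norm (g' t) \<le> L"
    using assms(1) unfolding C1_join_def by blast
  obtain h h' where h: "\<And>t::real. (h has_vector_derivative h' t) (at t)" "continuous_on UNIV h'"
    "\<And>t. h t \<in> N" "\<And>t. t \<le> 0 \<Longrightarrow> h t = q" "\<And>t. t \<ge> 1 \<Longrightarrow> h t = r"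
    "\<And>t. t \<le> 0 \<or> 1 \<le> t \<Longrightarrow> h' t = 0" "\<And>t. norm (h' t) \<le> L'"
    using assms(2) unfolding C1_join_def by blast
  let ?k = "\<lambda>t. g (0 + 2 * t) + h (- 1 + 2 * t) - q"
  let ?k' = "\<lambda>t. 2 *\<^sub>R g' (0 + 2 * t) + 2 *\<^sub>R h' (- 1 + 2 * t)"
  have left: "?k t = g (2 * t)" if "t \<le> 1/2" for t using h(4)[of "- 1 + 2 * t"] that by simp
  have right: "?k t = h (- 1 + 2 * t)" if "t \<ge> 1/2" for t using g(5)[of "2 * t"] that by simp
  show ?thesis
  proof (rule C1_joinI[where g = ?k and g' = ?k'])
    show "(?k has_vector_derivative ?k' t) (at t)" for t
      using has_vector_derivative_diff[OF has_vector_derivative_add[OF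
          has_vector_derivative_affine[OF g(1), of 0 2 t] has_vector_derivative_affine[OF h(1), of "- 1" 2 t]]
          has_vector_derivative_const, of q] by simp
    show "continuous_on UNIV ?k'"
      by (intro continuous_on_add continuous_on_affine g(2) h(2))
    show "?k t \<in> N" for t using left[of t] right[of t] g(3) h(3) by (cases "t \<le> 1/2") simp_all
    show "?k t = p" if "t \<le> 0" for t using left[of t] g(4)[of "2 * t"] that by simp
    show "?k t = r" if "t \<ge> 1" for t using right[of t] h(5)[of "- 1 + 2 * t"] that by simp
    show "?k' t = 0" if "t \<le> 0 \<or> 1 \<le> t" for t
      using that g(6)[of "2 * t"] h(6)[of "- 1 + 2 * t"] by auto
    show "norm (?k' t) \<le> 2 * (L + L')" for t
      using norm_triangle_ineq[of "2 *\<^sub>R g' (0 + 2 * t)" "2 *\<^sub>R h' (- 1 + 2 * t)"] g(7)[of "2 * t"] h(7)[of "- 1 + 2 * t"]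
      by simp
  qed
qed

text \<open>Segments in a chart: both the chart and its inverse are Lipschitz on small balls.\<close>

lemma C1_join_local:
  fixes N :: "'a::euclidean_space set"
  assumes N: "smooth_submanifold n N" and p: "p \<in> N"
  shows "\<exists>r>0. \<exists>C\<ge>0. \<forall>x\<in>N \<inter> ball p r. \<forall>y\<in>N \<inter> ball p r. C1_join N x y (C * norm (x - y))"
proof -
  obtain U V \<Phi> \<Psi> L where U: "open U" "p \<in> U" and V: "open (V :: 'a set)" and hom: "homeomorphism U V \<Phi> \<Psi>"
    and \<Phi>: "smooth_on U \<Phi>" and \<Psi>: "smooth_on V \<Psi>" and L: "subspace L" and im: "\<Phi> ` (N \<inter> U) = L \<inter> V"
    using N p by (rule submanifold_chartE)
  have inv: "\<And>x. x \<in> U \<Longrightarrow> \<Psi> (\<Phi> x) = x" "\<And>x. x \<in> U \<Longrightarrow> \<Phi> x \<in> V"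
    using hom by (auto simp: homeomorphism_def)
  obtain e where e: "e > 0" "cball (\<Phi> p) e \<subseteq> V"
    using V inv(2)[OF U(2)] open_contains_cball by blast
  have "continuous_on U \<Phi>" using \<Phi> by (rule smooth_on_continuous)
  then have "open (U \<inter> \<Phi> -` ball (\<Phi> p) e)"
    using U(1) by (intro continuous_open_preimage) auto
  moreover have "p \<in> U \<inter> \<Phi> -` ball (\<Phi> p) e" using U e by auto
  ultimately obtain r where r: "r > 0" "cball p r \<subseteq> U \<inter> \<Phi> -` ball (\<Phi> p) e"
    using open_contains_cball by blast
  obtain A where A: "A \<ge> 0" "\<And>x h. x \<in> cball p r \<Longrightarrow> norm (frechet_derivative \<Phi> (at x) h) \<le> A * norm h"
    using derivative_bound_on_compact[OF \<Phi>, of "cball p r"] r by auto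
  obtain B where B: "B \<ge> 0" "\<And>x h. x \<in> cball (\<Phi> p) e \<Longrightarrow> norm (frechet_derivative \<Psi> (at x) h) \<le> B * norm h"
    using derivative_bound_on_compact[OF \<Psi>, of "cball (\<Phi> p) e"] e by auto
  show ?thesis
  proof (intro exI conjI ballI)
    show "r > 0" by fact
    show "0 \<le> 2 * B * A" using A B by simp
    fix x y assume xy: "x \<in> N \<inter> ball p r" "y \<in> N \<inter> ball p r"
    have lip: "norm (\<Phi> y - \<Phi> x) \<le> A * norm (y - x)"
    proof (rule differentiable_bound[of "cball p r"])
      fix z assume z: "z \<in> cball p r"
      have "z \<in> U" using z r by blast
      then show "(\<Phi> has_derivative frechet_derivative \<Phi> (at z)) (at z within cball p r)"
        by (rule has_derivative_at_withinI[OF smooth_on_has_derivative[OF \<Phi>]])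
      show "onorm (frechet_derivative \<Phi> (at z)) \<le> A"
        using A(2)[OF z] by (intro onorm_bound A(1))
    qed (use xy in auto)
    define w where "w = \<Phi> y - \<Phi> x"
    define z where "z t = \<Phi> x + step_fun t *\<^sub>R w" for t
    have "x \<in> cball p r" "y \<in> cball p r" using xy by auto
    then have xy': "x \<in> U \<inter> \<Phi> -` ball (\<Phi> p) e" "y \<in> U \<inter> \<Phi> -` ball (\<Phi> p) e"
      using r(2) by blast+
    have xyb: "\<Phi> x \<in> ball (\<Phi> p) e" "\<Phi> y \<in> ball (\<Phi> p) e" "x \<in> U" "y \<in> U" using xy' by auto
    have zb: "z t \<in> ball (\<Phi> p) e" for t
    proof -
      have "z t = (1 - step_fun t) *\<^sub>R \<Phi> x + step_fun t *\<^sub>R \<Phi> y"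
        by (simp add: z_def w_def algebra_simps)
      then show ?thesis
        using convexD_alt[OF convex_ball xyb(1,2) step_fun_bounds, of t] by simp
    qed
    have zV: "z t \<in> V" for t using zb[of t] e by auto
    have "\<Phi> x \<in> L" "\<Phi> y \<in> L" using im xy xyb by auto
    then have zL: "z t \<in> L" for t
      unfolding z_def w_def using L by (intro subspace_add subspace_scale subspace_diff)
    have dz: "(z has_vector_derivative step_deriv t *\<^sub>R w) (at t)" for t
    proof -
      have "(step_fun has_vector_derivative step_deriv t) (at t)"
        using step_fun_deriv by (simp add: has_real_derivative_iff_has_vector_derivative)
      from has_vector_derivative_add[OF has_vector_derivative_const
          bounded_linear.has_vector_derivative[OF bounded_linear_scaleR_left this]]
      show ?thesis by (simp add: z_def[abs_def])
    qed
    show "C1_join N x y (2 * B * A * norm (x - y))"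
    proof (rule C1_joinI[where g = "\<lambda>t. \<Psi> (z t)" and g' = "\<lambda>t. step_deriv t *\<^sub>R frechet_derivative \<Psi> (at (z t)) w"])
      fix t
      have d: "(\<Psi> has_derivative frechet_derivative \<Psi> (at (z t))) (at (z t))"
        by (rule smooth_on_has_derivative[OF \<Psi> zV])
      show "((\<lambda>t. \<Psi> (z t)) has_vector_derivative step_deriv t *\<^sub>R frechet_derivative \<Psi> (at (z t)) w) (at t)"
        using vector_derivative_chain[OF dz d] has_derivative_linear[OF d] by (simp add: linear_cmul)
      have "z t \<in> \<Phi> ` (N \<inter> U)" unfolding im using zL zV by blast
      then show "\<Psi> (z t) \<in> N" using inv(1) by auto
      show "t \<le> 0 \<Longrightarrow> \<Psi> (z t) = x" using inv(1) xyb by (simp add: z_def step_fun_left)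
      show "1 \<le> t \<Longrightarrow> \<Psi> (z t) = y" using inv(1) xyb by (simp add: z_def step_fun_right w_def)
      show "t \<le> 0 \<or> 1 \<le> t \<Longrightarrow> step_deriv t *\<^sub>R frechet_derivative \<Psi> (at (z t)) w = 0"
        by (simp add: step_deriv_outside)
      have "norm (frechet_derivative \<Psi> (at (z t)) w) \<le> B * norm w"
        using zb[of t] by (intro B(2)) auto
      also have "\<dots> \<le> B * (A * norm (x - y))"
        using lip B(1) by (intro mult_left_mono) (auto simp: w_def norm_minus_commute)
      finally have "norm (step_deriv t *\<^sub>R frechet_derivative \<Psi> (at (z t)) w) \<le> 2 * (B * (A * norm (x - y)))"
        using step_deriv_bounds[of t] by (auto intro!: mult_mono)
      then show "norm (step_deriv t *\<^sub>R frechet_derivative \<Psi> (at (z t)) w) \<le> 2 * B * A * norm (x - y)"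
        by (simp add: mult.assoc)
    next
      have cz: "continuous_on UNIV z"
        using dz by (intro continuous_at_imp_continuous_on ballI has_vector_derivative_continuous) 
      have "continuous_on V (\<lambda>x. frechet_derivative \<Psi> (at x) w)"
        by (rule smooth_on_continuous[OF smooth_on_frechet[OF \<Psi>]])
      then have "continuous_on UNIV (\<lambda>t. frechet_derivative \<Psi> (at (z t)) w)"
        by (rule continuous_on_compose2[OF _ cz]) (use zV in auto)
      then show "continuous_on UNIV (\<lambda>t. step_deriv t *\<^sub>R frechet_derivative \<Psi> (at (z t)) w)"
        by (intro continuous_on_scaleR continuous_step_deriv)
    qed
  qed
qed

text \<open>Being joined is an equivalence relation with open classes on the connected set
  \<open>N\<close>.\<close>

lemma C1_join_exists:
  fixes N :: "'a::euclidean_space set"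
  assumes N: "smooth_submanifold n N" "connected N" and pq: "p \<in> N" "q \<in> N"
  shows "\<exists>L. C1_join N p q L"
proof (rule connected_equivalence_relation[OF N(2) pq])
  show "\<exists>L. C1_join N y x L" if "\<exists>L. C1_join N x y L" for x y using that C1_join_sym by blast
  show "\<exists>L. C1_join N x z L" if "\<exists>L. C1_join N x y L" "\<exists>L. C1_join N y z L" for x y z
    using that C1_join_trans by blast
  fix x assume x: "x \<in> N"
  obtain r C where r: "r > 0" and C: "\<forall>y\<in>N \<inter> ball x r. \<forall>z\<in>N \<inter> ball x r. C1_join N y z (C * norm (y - z))"
    using C1_join_local[OF N(1) x] by blast
  show "\<exists>T. openin (top_of_set N) T \<and> x \<in> T \<and> (\<forall>y\<in>T. \<exists>L. C1_join N x y L)"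
  proof (intro exI[of _ "N \<inter> ball x r"] conjI ballI)
    fix y assume "y \<in> N \<inter> ball x r"
    moreover have "x \<in> N \<inter> ball x r" using x r by simp
    ultimately have "C1_join N x y (C * norm (x - y))" using C by blast
    then show "\<exists>L. C1_join N x y L" by blast
  qed (use r x in auto)
qed

text \<open>Otherwise there are pairs of points \<open>x\<^sub>n\<close>, \<open>y\<^sub>n\<close> violating the
  estimate with constant \<open>n\<close>, and by compactness they may be assumed to converge. If the limits agree,
  this contradicts the local estimate there. If they differ, then the distances stay away from zero while a bounded
  speed suffices to pass through the two limits.\<close>

lemma C1_join_lipschitz:
  fixes N :: "'a::euclidean_space set"
  assumes N: "smooth_submanifold n N" "connected N" "closed N"
  shows "\<exists>C\<ge>0. \<forall>x\<in>N \<inter> cball 0 R. \<forall>y\<in>N \<inter> cball 0 R. C1_join N x y (C * norm (x - y))"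
proof (rule ccontr)
  let ?K = "N \<inter> cball 0 R"
  assume "\<not> ?thesis"
  then have "\<exists>x\<in>?K. \<exists>y\<in>?K. \<not> C1_join N x y (real n * norm (x - y))" for n
    by (metis of_nat_0_le_iff)
  then obtain x y where xy: "\<And>n. x n \<in> ?K" "\<And>n. y n \<in> ?K" "\<And>n. \<not> C1_join N (x n) (y n) (real n * norm (x n - y n))"
    by metis
  have "compact ?K" using N(3) by (simp add: closed_Int_compact)
  then have "compact (?K \<times> ?K)" by (intro compact_Times)
  moreover have "\<forall>n. (x n, y n) \<in> ?K \<times> ?K" using xy by auto
  ultimately obtain l r where l: "l \<in> ?K \<times> ?K" and r: "strict_mono r" "((\<lambda>n. (x n, y n)) \<circ> r) \<longlonglongrightarrow> l"
    by (rule compact_imp_seq_compact[THEN seq_compactE])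
  obtain p q where pq: "l = (p, q)" by (cases l)
  have xp: "(\<lambda>n. x (r n)) \<longlonglongrightarrow> p" and yq: "(\<lambda>n. y (r n)) \<longlonglongrightarrow> q"
    using tendsto_fst[OF r(2)] tendsto_snd[OF r(2)] by (simp_all add: pq o_def)
  have pN: "p \<in> N" "q \<in> N" using l pq by auto
  obtain r1 C1 where r1: "r1 > 0" "C1 \<ge> 0" "\<forall>x\<in>N \<inter> ball p r1. \<forall>y\<in>N \<inter> ball p r1. C1_join N x y (C1 * norm (x - y))"
    using C1_join_local[OF N(1) pN(1)] by blast
  obtain r2 C2 where r2: "r2 > 0" "C2 \<ge> 0" "\<forall>x\<in>N \<inter> ball q r2. \<forall>y\<in>N \<inter> ball q r2. C1_join N x y (C2 * norm (x - y))"
    using C1_join_local[OF N(1) pN(2)] by blast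
  have e1: "eventually (\<lambda>n. x (r n) \<in> ball p r1) sequentially"
    using xp r1 by (intro topological_tendstoD) auto
  have big: "eventually (\<lambda>n. c \<le> real (r n)) sequentially" for c
  proof -
    have "filterlim (\<lambda>n. real (r n)) at_top sequentially"
      by (rule filterlim_compose[OF filterlim_real_sequentially filterlim_subseq[OF r(1)]])
    then show ?thesis unfolding filterlim_at_top by blast
  qed
  show False
  proof (cases "p = q")
    case True
    have e2: "eventually (\<lambda>n. y (r n) \<in> ball p r1) sequentially"
      using yq r1 True by (intro topological_tendstoD) auto
    have "eventually (\<lambda>n. False) sequentially"
      using e1 e2 big[of C1]
    proof eventually_elim
      case (elim n)
      have "C1_join N (x (r n)) (y (r n)) (C1 * norm (x (r n) - y (r n)))"
        using r1(3) elim xy by blast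
      then have "C1_join N (x (r n)) (y (r n)) (real (r n) * norm (x (r n) - y (r n)))"
        by (rule C1_join_mono) (use elim in \<open>auto intro: mult_right_mono\<close>)
      then show False using xy(3) by blast
    qed
    then show False by simp
  next
    case False
    obtain L where L: "C1_join N p q L" using C1_join_exists[OF N(1,2) pN] by blast
    define d where "d = norm (p - q)"
    have d: "d > 0" using False by (simp add: d_def)
    have "(\<lambda>n. norm (x (r n) - y (r n))) \<longlonglongrightarrow> d"
      unfolding d_def by (intro tendsto_intros xp yq)
    then have e3: "eventually (\<lambda>n. d / 2 < norm (x (r n) - y (r n))) sequentially"
      using d by (intro order_tendstoD) auto
    have e2: "eventually (\<lambda>n. y (r n) \<in> ball q r2) sequentially"
      using yq r2 by (intro topological_tendstoD) auto
    define M where "M = 2 * (2 * (C1 * r1 + L) + C2 * r2)"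
    have "eventually (\<lambda>n. False) sequentially"
      using e1 e2 e3 big[of "\<bar>M\<bar> / (d / 2)"]
    proof eventually_elim
      case (elim n)
      have "C1_join N (x (r n)) p (C1 * norm (x (r n) - p))"
        using r1 elim xy pN by auto
      then have 1: "C1_join N (x (r n)) p (C1 * r1)"
        by (rule C1_join_mono) (use elim r1 in \<open>auto intro!: mult_left_mono simp: dist_norm norm_minus_commute\<close>)
      have "C1_join N q (y (r n)) (C2 * norm (q - y (r n)))"
        using r2 elim xy pN by auto
      then have 2: "C1_join N q (y (r n)) (C2 * r2)"
        by (rule C1_join_mono) (use elim r2 in \<open>auto intro!: mult_left_mono simp: dist_norm norm_minus_commute\<close>)
      have "C1_join N (x (r n)) (y (r n)) M"
        unfolding M_def by (rule C1_join_trans[OF C1_join_trans[OF 1 L] 2])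
      moreover have "M \<le> real (r n) * norm (x (r n) - y (r n))"
      proof -
        have "M \<le> \<bar>M\<bar> / (d / 2) * (d / 2)" using d by simp
        also have "\<dots> \<le> real (r n) * norm (x (r n) - y (r n))"
          using elim d by (intro mult_mono) auto
        finally show ?thesis .
      qed
      ultimately show False using xy(3) C1_join_mono by blast
    qed
    then show False by simp
  qed
qed

text \<open>The fundamental theorem of calculus for a piecewise \<open>C\<^sup>1\<close> curve holds for the gauge
  integral; when the length is finite, the derivative is Lebesgue integrable and the two integrals agree.\<close>

lemma dist_le_path_len:
  fixes g :: "real \<Rightarrow> 'a::euclidean_space"
  assumes "valid_path g"
  shows "ennreal (norm (pathfinish g - pathstart g)) \<le> path_len g"
proof -
  obtain S where S: "finite S" and cont: "continuous_on {0..1} g" and C1: "g C1_differentiable_on ({0..1} - S)"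
    using assms unfolding valid_path_def piecewise_C1_differentiable_on_def by blast
  define D where "D t = vector_derivative g (at t)" for t
  have cD: "continuous_on ({0..1} - S) D" and dg: "\<And>t. t \<in> {0..1} - S \<Longrightarrow> (g has_vector_derivative D t) (at t)"
    using C1 unfolding C1_differentiable_on_eq D_def by (auto simp: vector_derivative_works)
  define f where "f t = indicator ({0..1} - S) t *\<^sub>R D t" for t
  have bS: "{0..1} - S \<in> sets borel" using S by (intro sets.Diff) (auto intro: finite_imp_closed borel_closed)
  have fm: "f \<in> borel_measurable lborel"
    using borel_measurable_continuous_on_indicator[OF bS cD] by (simp add: f_def[abs_def])
  have "AE t in lborel. t \<notin> S" using S by (intro AE_not_in finite_imp_null_set_lborel)
  then have len: "path_len g = (\<integral>\<^sup>+ t. ennreal (norm (f t)) \<partial>lborel)"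
    unfolding path_len_def by (intro nn_integral_cong_AE) (auto elim!: eventually_mono simp: f_def D_def indicator_def)
  show ?thesis
  proof (cases "path_len g = \<infinity>")
    case True then show ?thesis by simp
  next
    case False
    then have fi: "integrable lborel f"
      using fm len by (intro integrableI_bounded) (auto simp: less_top)
    have "(f has_integral integral\<^sup>L lborel f) UNIV"
      by (rule has_integral_integral_lborel[OF fi])
    then have "((\<lambda>t. if t \<in> {0..1} then f t else 0) has_integral integral\<^sup>L lborel f) UNIV"
      by (rule has_integral_eq[rotated]) (auto simp: f_def)
    then have 1: "(f has_integral integral\<^sup>L lborel f) {0..1}"
      using has_integral_restrict_UNIV[of "{0..1}" f] by simp
    have "(D has_integral (g 1 - g 0)) {0..1}"
      by (rule fundamental_theorem_of_calculus_interior_strong[OF S _ _ cont]) (auto intro: dg)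
    then have "(f has_integral (g 1 - g 0)) {0..1}"
      by (rule has_integral_spike_finite[OF S, rotated]) (auto simp: f_def)
    then have "g 1 - g 0 = integral\<^sup>L lborel f" using 1 has_integral_unique by blast
    then have "ennreal (norm (pathfinish g - pathstart g)) = ennreal (norm (integral\<^sup>L lborel f))"
      by (simp add: pathfinish_def pathstart_def)
    also have "\<dots> \<le> (\<integral>\<^sup>+ t. ennreal (norm (f t)) \<partial>lborel)"
      by (rule integral_norm_bound_ennreal[OF fi])
    finally show ?thesis unfolding len .
  qed
qed

lemma path_len_le:
  assumes "\<And>t. norm (vector_derivative g (at t)) \<le> L"
  shows "path_len g \<le> ennreal L"
proof -
  have "path_len g \<le> (\<integral>\<^sup>+ t. ennreal L * indicator {0..1} t \<partial>(lborel :: real measure))"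
    unfolding path_len_def
    by (intro nn_integral_mono mult_right_mono ennreal_leI assms) simp
  also have "\<dots> = ennreal L" by (subst nn_integral_cmult_indicator) auto
  finally show ?thesis .
qed

lemma geo_dist_le:
  assumes "valid_path g" "path_image g \<subseteq> N" "pathstart g = p" "pathfinish g = q" "path_len g \<le> ennreal L" "0 \<le> L"
  shows "geo_dist N p q \<le> L"
proof -
  have "(INF g\<in>{g. valid_path g \<and> path_image g \<subseteq> N \<and> pathstart g = p \<and> pathfinish g = q}. path_len g) \<le> ennreal L"
    by (rule INF_lower2[of g]) (use assms in auto)
  then show ?thesis
    unfolding geo_dist_def using enn2real_mono[of _ "ennreal L"] assms(6) by fastforce
qed

text \<open>The infimum of the lengths is bounded below by the Euclidean distance. It is also finite, so the
  conversion to a real number does not send it to the default value \<open>0\<close>.\<close>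

lemma geo_dist_pos:
  fixes N :: "'a::euclidean_space set"
  assumes N: "smooth_submanifold n N" "connected N" and pq: "p \<in> N" "q \<in> N" "p \<noteq> q"
  shows "geo_dist N p q > 0"
proof -
  let ?P = "{g. valid_path g \<and> path_image g \<subseteq> N \<and> pathstart g = p \<and> pathfinish g = q}"
  obtain L where "C1_join N p q L" using C1_join_exists[OF N pq(1,2)] by blast
  then obtain g g' where g: "\<And>t::real. (g has_vector_derivative g' t) (at t)" "continuous_on UNIV g'"
    "\<And>t. g t \<in> N" "\<And>t. t \<le> 0 \<Longrightarrow> g t = p" "\<And>t. t \<ge> 1 \<Longrightarrow> g t = q"
    "\<And>t. norm (g' t) \<le> L"
    unfolding C1_join_def by blast
  have "g C1_differentiable_on {0..1}"
    unfolding C1_differentiable_on_def using g(1,2) continuous_on_subset by blast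
  then have "valid_path g" unfolding valid_path_def by (rule C1_differentiable_imp_piecewise)
  then have "g \<in> ?P" using g by (auto simp: path_image_def pathstart_def pathfinish_def)
  moreover have "path_len g \<le> ennreal L"
    by (rule path_len_le) (use g vector_derivative_at in metis)
  ultimately have fin: "(INF g\<in>?P. path_len g) \<le> ennreal L" by (rule INF_lower2[of g])
  have "ennreal (norm (q - p)) \<le> (INF g\<in>?P. path_len g)"
    by (rule INF_greatest) (use dist_le_path_len in auto)
  then have "enn2real (ennreal (norm (q - p))) \<le> enn2real (INF g\<in>?P. path_len g)"
    by (rule enn2real_mono) (rule le_less_trans[OF fin], simp)
  then have "norm (q - p) \<le> geo_dist N p q" unfolding geo_dist_def by simp
  moreover have "norm (q - p) > 0" using pq(3) by simp
  ultimately show ?thesis by linarith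
qed

text \<open>Geodesics have constant speed, because the velocity is tangential and the acceleration is normal. The
  restriction to the unit interval is therefore a curve of length \<open>norm v\<close>.\<close>

lemma geo_dist_exp_le_speed:
  fixes N :: "'a::euclidean_space set"
  assumes N: "smooth_submanifold n N" and \<gamma>: "geodesic_from N p v \<gamma>"
  shows "geo_dist N p (\<gamma> 1) \<le> norm v"
proof -
  have sm: "smooth_on UNIV \<gamma>" and inN: "\<And>t. \<gamma> t \<in> N"
    and acc: "\<And>t. tproj N (\<gamma> t) (vector_derivative (\<lambda>s. vector_derivative \<gamma> (at s)) (at t)) = 0"
    and 0: "\<gamma> 0 = p" "(\<gamma> has_vector_derivative v) (at 0)"
    using \<gamma> unfolding geodesic_from_def geodesic_def by auto
  define \<gamma>' where "\<gamma>' t = frechet_derivative \<gamma> (at t) 1" for t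
  have d1: "(\<gamma> has_vector_derivative \<gamma>' t) (at t)" for t
    unfolding \<gamma>'_def by (rule smooth_on_vector_derivative[OF sm]) simp
  have v1: "vector_derivative \<gamma> (at t) = \<gamma>' t" for t using d1 by (rule vector_derivative_at)
  have sm': "smooth_on UNIV \<gamma>'" unfolding \<gamma>'_def by (rule smooth_on_frechet[OF sm])
  define \<gamma>'' where "\<gamma>'' t = frechet_derivative \<gamma>' (at t) 1" for t
  have d2: "(\<gamma>' has_vector_derivative \<gamma>'' t) (at t)" for t
    unfolding \<gamma>''_def by (rule smooth_on_vector_derivative[OF sm']) simp
  have v2: "vector_derivative (\<lambda>s. vector_derivative \<gamma> (at s)) (at t) = \<gamma>'' t" for t
    unfolding v1 using d2 by (rule vector_derivative_at)
  have tang: "\<gamma>' t \<in> tangent_space N (\<gamma> t)" for t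
  proof -
    have "curve_through N (\<gamma> t) (\<gamma>' t) (\<lambda>s. \<gamma> (t + s *\<^sub>R 1))"
      unfolding curve_through_def
    proof (intro conjI exI[of _ 1])
      show "smooth_on {-1<..<1} (\<lambda>s. \<gamma> (t + s *\<^sub>R 1))"
        by (rule smooth_on_affine[OF _ _ sm]) auto
      show "((\<lambda>s. \<gamma> (t + s *\<^sub>R 1)) has_vector_derivative \<gamma>' t) (at 0)"
        using has_vector_derivative_affine[of \<gamma> "\<gamma>' t" t 1 0] d1[of t] by simp
    qed (use inN in auto)
    then show ?thesis unfolding tangent_space_def by blast
  qed
  have orth: "\<gamma>' t \<bullet> \<gamma>'' t = 0" for t
    using tproj_orth[OF tangent_space_subspace[OF N inN] tang[of t], where v = "\<gamma>'' t"] acc[of t] unfolding v2 by simp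
  have "((\<lambda>t. \<gamma>' t \<bullet> \<gamma>' t) has_vector_derivative 0) (at t within UNIV)" for t
  proof -
    have "((\<lambda>t. \<gamma>' t \<bullet> \<gamma>' t) has_derivative (\<lambda>h. \<gamma>' t \<bullet> (h *\<^sub>R \<gamma>'' t) + (h *\<^sub>R \<gamma>'' t) \<bullet> \<gamma>' t)) (at t)"
      using d2[of t] unfolding has_vector_derivative_def by (intro has_derivative_inner)
    then show ?thesis unfolding has_vector_derivative_def using orth[of t] by (simp add: inner_commute)
  qed
  then obtain c where "\<And>t. \<gamma>' t \<bullet> \<gamma>' t = c"
    using has_vector_derivative_zero_constant[of UNIV "\<lambda>t. \<gamma>' t \<bullet> \<gamma>' t"] by auto
  then have "\<gamma>' t \<bullet> \<gamma>' t = \<gamma>' 0 \<bullet> \<gamma>' 0" for t by simp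
  then have "norm (\<gamma>' t) = norm (\<gamma>' 0)" for t by (simp add: norm_eq_sqrt_inner)
  moreover have "\<gamma>' 0 = v" using d1 0(2) vector_derivative_unique_at by blast
  ultimately have speed: "norm (\<gamma>' t) = norm v" for t by simp
  have "\<gamma> C1_differentiable_on {0..1}"
    unfolding C1_differentiable_on_def using d1 smooth_on_continuous[OF sm'] continuous_on_subset by blast
  then have "valid_path \<gamma>" unfolding valid_path_def by (rule C1_differentiable_imp_piecewise)
  moreover have "path_len \<gamma> \<le> ennreal (norm v)"
    by (rule path_len_le) (simp add: v1 speed)
  ultimately show ?thesis
    using inN 0(1) by (intro geo_dist_le[of \<gamma>]) (auto simp: path_image_def pathstart_def pathfinish_def)
qed

text \<open>The point \<open>q\<close> lies in a geodesic ball on which the exponential map is a bijection, so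
  \<open>log_map N p q\<close> is indeed a preimage of \<open>q\<close>, and the geodesic leading to it bounds the
  distance.\<close>

lemma geo_dist_le_norm_log:
  fixes N :: "'a::euclidean_space set"
  assumes N: "smooth_submanifold n N" and complete: "geodesically_complete N"
    and pq: "p \<in> N" "q \<in> N" "ereal (geo_dist N p q) < inj_radius N"
  shows "geo_dist N p q \<le> norm (log_map N p q)"
proof -
  have "ereal (geo_dist N p q) < inj_radius_at N p"
    using pq(3) INF_lower[OF pq(1), of "inj_radius_at N"] unfolding inj_radius_def by (rule less_le_trans)
  then obtain r where r: "geo_dist N p q < r"
    "diffeo {v \<in> tangent_space N p. norm v < r} {q \<in> N. geo_dist N p q < r} (exp_map N p)"
    and rle: "ereal r \<le> inj_radius_at N p"
  proof -
    assume a: "ereal (geo_dist N p q) < inj_radius_at N p"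
      and that: "\<And>r. geo_dist N p q < r \<Longrightarrow> diffeo {v \<in> tangent_space N p. norm v < r} {q \<in> N. geo_dist N p q < r} (exp_map N p)
        \<Longrightarrow> ereal r \<le> inj_radius_at N p \<Longrightarrow> thesis"
    from a obtain r where "geo_dist N p q < r" "0 < r"
      "diffeo {v \<in> tangent_space N p. norm v < r} {q \<in> N. geo_dist N p q < r} (exp_map N p)"
      unfolding inj_radius_at_def less_Sup_iff by auto
    moreover have "ereal r \<le> inj_radius_at N p"
      unfolding inj_radius_at_def by (rule Sup_upper) (use calculation in blast)
    ultimately show thesis using that by blast
  qed
  let ?B = "{v \<in> tangent_space N p. ereal (norm v) < inj_radius_at N p}"
  have "q \<in> exp_map N p ` {v \<in> tangent_space N p. norm v < r}"
    using r pq(2) unfolding diffeo_def bij_betw_def by auto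
  then obtain v where v: "v \<in> tangent_space N p" "norm v < r" "exp_map N p v = q" by blast
  have "ereal (norm v) < inj_radius_at N p" using v(2) rle by (auto intro: less_le_trans[of _ "ereal r"])
  then have "q \<in> exp_map N p ` ?B" using v by blast
  then have l: "log_map N p q \<in> ?B" "exp_map N p (log_map N p q) = q"
    unfolding log_map_def by (rule inv_into_into, rule f_inv_into_f)
  then have "\<exists>\<gamma>. geodesic_from N p (log_map N p q) \<gamma>"
    using complete pq(1) unfolding geodesically_complete_def by blast
  then have "geodesic_from N p (log_map N p q) (SOME \<gamma>. geodesic_from N p (log_map N p q) \<gamma>)"
    by (rule someI_ex)
  from geo_dist_exp_le_speed[OF N this] show ?thesis using l(2) unfolding exp_map_def by simp
qed

lemma norm_Tminus_ge_1:
  fixes N :: "'a::euclidean_space set"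
  assumes N: "smooth_submanifold n N" "connected N" and complete: "geodesically_complete N"
    and w: "lft I w x \<in> N" "rgt I w x \<in> N" "lft I w x \<noteq> rgt I w x"
      "ereal (geo_dist N (lft I w x) (rgt I w x)) < inj_radius N"
  shows "norm (Tminus N I w x) \<ge> 1"
proof -
  have "geo_dist N (lft I w x) (rgt I w x) > 0" using N w by (intro geo_dist_pos) auto
  moreover have "geo_dist N (lft I w x) (rgt I w x) \<le> norm (log_map N (lft I w x) (rgt I w x))"
    using N(1) complete w by (intro geo_dist_le_norm_log) auto
  ultimately show ?thesis unfolding Tminus_def by (simp add: field_simps)
qed

section \<open>Finiteness of the relaxed total variation\<close>

text \<open>One curve per grid cell, rescaled to that cell. As all curves stand still outside their own cells, the
  interpolation is the telescoping sum of their displacements.\<close>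

lemma C1_interpolation:
  fixes P :: "nat \<Rightarrow> 'a::euclidean_space" and L :: "nat \<Rightarrow> real"
  assumes d: "d > 0" and k: "k > 0" and PN: "\<And>i. i \<le> k \<Longrightarrow> P i \<in> N"
    and J: "\<And>i. i < k \<Longrightarrow> C1_join N (P i) (P (Suc i)) (L i)"
  shows "\<exists>v v'. (\<forall>t. (v has_vector_derivative v' t) (at t)) \<and> continuous_on UNIV v' \<and> (\<forall>t\<in>{a..a + real k * d}. v t \<in> N) \<and>
     (\<forall>i<k. \<forall>t\<in>{a + real i * d..a + real (Suc i) * d}. norm (v t - P i) \<le> L i \<and> norm (v' t) \<le> L i / d)"
proof -
  define Q where "Q i g g' \<longleftrightarrow> (\<forall>t::real. (g has_vector_derivative g' t) (at t)) \<and> continuous_on UNIV g' \<and>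
     (\<forall>t. g t \<in> N) \<and> (\<forall>t\<le>0. g t = P i) \<and> (\<forall>t\<ge>1. g t = P (Suc i)) \<and>
     (\<forall>t. t \<le> 0 \<or> 1 \<le> t \<longrightarrow> g' t = 0) \<and> (\<forall>t. norm (g' t) \<le> L i)" for i g g'
  have "\<exists>g g'. i < k \<longrightarrow> Q i g g'" for i
    using J unfolding C1_join_def Q_def by blast
  then obtain g g' where "\<And>i. i < k \<Longrightarrow> Q i (g i) (g' i)" by metis
  then have g: "\<And>i t::real. i < k \<Longrightarrow> (g i has_vector_derivative g' i t) (at t)"
    "\<And>i. i < k \<Longrightarrow> continuous_on UNIV (g' i)" "\<And>i t. i < k \<Longrightarrow> g i t \<in> N"
    "\<And>i t. i < k \<Longrightarrow> t \<le> 0 \<Longrightarrow> g i t = P i" "\<And>i t. i < k \<Longrightarrow> t \<ge> 1 \<Longrightarrow> g i t = P (Suc i)"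
    "\<And>i t. i < k \<Longrightarrow> norm (g' i t) \<le> L i" "\<And>i t. i < k \<Longrightarrow> t \<le> 0 \<or> 1 \<le> t \<Longrightarrow> g' i t = 0"
    unfolding Q_def by blast+
  define s where "s i t = - (a / d + real i) + (1 / d) * t" for i t
  define v where "v t = P 0 + (\<Sum>i<k. g i (s i t) - P i)" for t
  define v' where "v' t = (\<Sum>i<k. (1 / d) *\<^sub>R g' i (s i t))" for t
  have dv: "(v has_vector_derivative v' t) (at t)" for t
  proof -
    have "((\<lambda>t. g i (s i t) - P i) has_vector_derivative (1 / d) *\<^sub>R g' i (s i t)) (at t)" if "i < k" for i
      using has_vector_derivative_diff[OF has_vector_derivative_affine[OF g(1)[OF that], of "- (a / d + real i)" "1 / d" t] has_vector_derivative_const, of "P i"]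
      by (simp add: s_def)
    then have "((\<lambda>t. P 0 + (\<Sum>i<k. g i (s i t) - P i)) has_vector_derivative 0 + v' t) (at t)"
      unfolding v'_def by (intro has_vector_derivative_add has_vector_derivative_sum has_vector_derivative_const) auto
    then show ?thesis by (simp add: v_def[abs_def])
  qed
  have cv: "continuous_on UNIV v'"
    unfolding v'_def s_def by (intro continuous_on_sum continuous_on_affine g(2)) auto
  have si: "s i (a + u * d) = u - real i" for i u using d by (simp add: s_def field_simps)
  have loc: "v t = g i (s i t) \<and> (\<forall>j<k. j \<noteq> i \<longrightarrow> g' j (s j t) = 0)"
    if i: "i < k" and t: "t \<in> {a + real i * d..a + real (Suc i) * d}" for i t
  proof -
    define u where "u = (t - a) / d"
    have tu: "t = a + u * d" "real i \<le> u" "u \<le> real i + 1" using t d by (auto simp: u_def field_simps)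
    have before: "g j (s j t) = P (Suc j)" if "j < i" for j
      using that i tu by (intro g(5)) (auto simp: si)
    have after: "g j (s j t) = P j" if "i < j" "j < k" for j
      using that tu by (intro g(4)) (auto simp: si)
    have "(\<Sum>j<k. g j (s j t) - P j) = (\<Sum>j<i. g j (s j t) - P j) + (\<Sum>j=i..<k. g j (s j t) - P j)"
      using i sum.atLeastLessThan_concat[of 0 i k "\<lambda>j. g j (s j t) - P j"]
      by (simp add: lessThan_atLeast0)
    also have "(\<Sum>j<i. g j (s j t) - P j) = (\<Sum>j<i. P (Suc j) - P j)"
      by (intro sum.cong) (auto simp: before)
    also have "\<dots> = P i - P 0" by (rule sum_lessThan_telescope)
    also have "(\<Sum>j=i..<k. g j (s j t) - P j) = (g i (s i t) - P i) + (\<Sum>j=Suc i..<k. g j (s j t) - P j)"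
      using i by (simp add: sum.atLeast_Suc_lessThan)
    also have "(\<Sum>j=Suc i..<k. g j (s j t) - P j) = 0"
      by (intro sum.neutral) (auto simp: after)
    finally have "v t = g i (s i t)" by (simp add: v_def)
    moreover have "g' j (s j t) = 0" if j: "j < k" "j \<noteq> i" for j
    proof -
      have "s j t \<le> 0 \<or> 1 \<le> s j t" using j tu by (cases "j < i") (auto simp: si)
      then show ?thesis by (rule g(7)[OF j(1)])
    qed
    ultimately show ?thesis by blast
  qed
  have ex_i: "\<exists>i<k. v t = g i (s i t)" if t: "t \<in> {a..a + real k * d}" for t
  proof -
    \<comment> \<open>the minimum assigns the right end point to the last cell\<close>
    define i where "i = min (nat \<lfloor>(t - a) / d\<rfloor>) (k - 1)"
    have i: "i < k" using k by (auto simp: i_def)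
    have "0 \<le> (t - a) / d" "(t - a) / d \<le> real k" using t d by (auto simp: field_simps)
    then have "real i \<le> (t - a) / d" "(t - a) / d \<le> real (Suc i)"
      using k unfolding i_def by (auto simp: min_def le_nat_floor of_nat_floor) linarith+
    then have "t \<in> {a + real i * d..a + real (Suc i) * d}" using d by (auto simp: field_simps)
    then show ?thesis using loc[OF i] i by blast
  qed
  show ?thesis
  proof (intro exI conjI allI impI ballI)
    show "(v has_vector_derivative v' t) (at t)" for t by (rule dv)
    show "continuous_on UNIV v'" by (rule cv)
    show "v t \<in> N" if "t \<in> {a..a + real k * d}" for t using ex_i[OF that] g(3) by auto
    fix i t assume i: "i < k" and t: "t \<in> {a + real i * d..a + real (Suc i) * d}"
    have L0: "L i \<ge> 0" using g(6)[OF i, of 0] norm_ge_zero order_trans by blast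
    have st: "0 \<le> s i t" "s i t \<le> 1"
    proof -
      define u where "u = (t - a) / d"
      have "t = a + u * d" "real i \<le> u" "u \<le> real i + 1" using t d by (auto simp: u_def field_simps)
      then show "0 \<le> s i t" "s i t \<le> 1" by (auto simp: si)
    qed
    have "norm (g i (s i t) - g i 0) \<le> L i * norm (s i t - 0)"
    proof (rule differentiable_bound[of UNIV])
      show "(g i has_derivative (\<lambda>h. h *\<^sub>R g' i x)) (at x within UNIV)" for x
        using g(1)[OF i, of x] by (simp add: has_vector_derivative_def)
      show "onorm (\<lambda>h. h *\<^sub>R g' i x) \<le> L i" for x
        by (rule onorm_bound) (use g(6)[OF i] L0 in \<open>auto simp: mult.commute intro!: mult_left_mono\<close>)
    qed auto
    also have "\<dots> \<le> L i" using L0 st by (simp add: mult_left_le)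
    finally show "norm (v t - P i) \<le> L i" using loc[OF i t] g(4)[OF i, of 0] by simp
    have "v' t = (1 / d) *\<^sub>R g' i (s i t)"
    proof -
      have "v' t = (\<Sum>j\<in>{i}. (1 / d) *\<^sub>R g' j (s j t))"
        unfolding v'_def by (rule sum.mono_neutral_right) (use loc[OF i t] i in auto)
      then show ?thesis by simp
    qed
    then show "norm (v' t) \<le> L i / d" using g(6)[OF i, of "s i t"] d by (simp add: divide_right_mono)
  qed
qed

lemma uniform_grid_cover:
  fixes a b :: real
  assumes ab: "a < b" and k: "k > 0" and x: "x \<in> {a<..<b}"
  defines "d \<equiv> (b - a) / real k"
  shows "\<exists>i<k. x \<in> {a + real i * d..<a + real (Suc i) * d}"
proof -
  have d: "d > 0" using ab k by (simp add: d_def)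
  define i where "i = nat \<lfloor>(x - a) / d\<rfloor>"
  have "0 \<le> (x - a) / d" using x d by simp
  then have i: "real i \<le> (x - a) / d" "(x - a) / d < real i + 1" unfolding i_def by linarith+
  have "(x - a) / d < real k" using x k ab by (simp add: d_def field_simps)
  then have "i < k" using i by linarith
  moreover have "x \<in> {a + real i * d..<a + real (Suc i) * d}" using i d by (auto simp: field_simps)
  ultimately show ?thesis by blast
qed

text \<open>Sample the left-continuous representative \<open>F\<close> on uniform grids. On a grid cell, both the
  oscillation of \<open>F\<close> and the length of the joining curve are controlled by the variation \<open>m
  i\<close> of that cell. Thus the total length is at most \<open>C \<mu>\<close>, and the squared
  \<open>L\<^sup>2\<close> error is at most a constant times the sum of the \<open>m i ^ 2\<close> times the mesh
  size, which tends to zero. Every admissible lower semicontinuous functional is therefore at most \<open>C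
  \<mu>\<close> at \<open>w\<close>.\<close>

lemma TV_finite:
  fixes N :: "'a::euclidean_space set" and a b :: real
  assumes N: "smooth_submanifold n N" "connected N" "closed N"
    and ab: "a < b" and w: "bvN N {a<..<b} w"
  shows "TV N {a<..<b} w < \<infinity>"
proof -
  interpret bv_function a b w
    using ab w by unfold_locales (auto simp: bvN_def)
  have wN: "AE x in leb I. w x \<in> N" using w by (simp add: bvN_def)
  define \<mu> where "\<mu> = measure M I"
  have \<mu>0: "\<mu> \<ge> 0" by (simp add: \<mu>_def)
  define F where "F x = rgt I w a + cum_left M \<sigma> x" for x
  have FN: "F x \<in> N" if "x \<in> {a..b}" for x
  proof (cases "x = a")
    case True
    then show ?thesis using rgt_in_closed[OF N(3) wN, of a] ab by (simp add: F_def cum_left_a)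
  next
    case False
    then show ?thesis using lft_in_closed[OF N(3) wN, of x] lft_eq[of x] that by (simp add: F_def)
  qed
  have FL: "norm (F y - F x) \<le> measure M ({x..<y} \<inter> I)" if "x \<le> y" for x y
    using norm_cum_left_diff_le[OF id_meas integrable_dens finite_measure_tv norm_dens_le that] by (simp add: F_def space_M)
  \<comment> \<open>all samples lie in the ball of radius \<open>R\<close>, on which one constant \<open>C\<close>
    serves for all pairs\<close>
  define R where "R = norm (rgt I w a) + \<mu>"
  have FR: "norm (F x) \<le> R" if "x \<ge> a" for x
  proof -
    have "norm (F x) \<le> norm (rgt I w a) + norm (cum_left M \<sigma> x)" unfolding F_def by (rule norm_triangle_ineq)
    then show ?thesis using norm_cum_left_le[OF that] by (simp add: R_def \<mu>_def)
  qed
  obtain C where C: "C \<ge> 0" "\<forall>x\<in>N \<inter> cball 0 R. \<forall>y\<in>N \<inter> cball 0 R. C1_join N x y (C * norm (x - y))"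
    using C1_join_lipschitz[OF N] by blast
  have approx: "\<exists>v. v C1_differentiable_on closure I \<and> v ` closure I \<subseteq> N \<and> v \<in> L2N N I \<and>
      (\<integral>\<^sup>+ x. ennreal (norm (vector_derivative v (at x))) \<partial>leb I) \<le> ennreal (C * \<mu>) \<and>
      (\<integral>\<^sup>+ x. ennreal ((norm (v x - w x))\<^sup>2) \<partial>leb I) \<le> ennreal ((C + 1)\<^sup>2 * \<mu>\<^sup>2 * (b - a) / real k)"
    if k: "k > 0" for k
  proof -
    define d where "d = (b - a) / real k"
    have d: "d > 0" using ab k by (simp add: d_def)
    have kd: "a + real k * d = b" using k by (simp add: d_def)
    define Z where "Z i = {a + real i * d..<a + real (Suc i) * d}" for i
    define m where "m i = measure M (Z i \<inter> I)" for i
    have m0: "m i \<ge> 0" for i by (simp add: m_def)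
    have Zmeas: "Z i \<inter> I \<in> sets M" for i by (auto simp: sets_M sets_I_iff Z_def)
    have grid: "a + real i * d \<in> {a..b}" if "i \<le> k" for i
    proof -
      have "real i * d \<le> real k * d" using that d by (intro mult_right_mono) auto
      then show ?thesis using kd d by auto
    qed
    have mle: "m i \<le> \<mu>" for i
      unfolding m_def \<mu>_def by (rule finite_measure_mono) (auto simp: sets_M sets_I_iff)
    have disj: "disjoint_family_on (\<lambda>i. Z i \<inter> I) {..<k}"
    proof -
      have "Z i \<inter> Z j = {}" if "i < j" for i j
      proof -
        have "real (Suc i) * d \<le> real j * d" using that d by (intro mult_right_mono) auto
        then show ?thesis unfolding Z_def by auto
      qed
      then have "Z i \<inter> Z j = {}" if "i \<noteq> j" for i j using that by (metis Int_commute nat_neq_iff)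
      then show ?thesis unfolding disjoint_family_on_def by blast
    qed
    have msum: "(\<Sum>i<k. m i) \<le> \<mu>"
    proof -
      have "(\<Sum>i<k. m i) = measure M (\<Union>i<k. Z i \<inter> I)"
        unfolding m_def by (rule finite_measure_finite_Union[symmetric]) (use Zmeas disj in auto)
      also have "\<dots> \<le> \<mu>" unfolding \<mu>_def
        by (rule finite_measure_mono) (auto simp: sets_M sets_I_iff)
      finally show ?thesis .
    qed
    define P where "P i = F (a + real i * d)" for i
    have PK: "P i \<in> N \<inter> cball 0 R" if "i \<le> k" for i
      using FN[OF grid[OF that]] FR[of "a + real i * d"] grid[OF that] by (auto simp: P_def)
    have J: "C1_join N (P i) (P (Suc i)) (C * m i)" if "i < k" for i
    proof (rule C1_join_mono)
      show "C1_join N (P i) (P (Suc i)) (C * norm (P i - P (Suc i)))"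
        using C(2) PK[of i] PK[of "Suc i"] that by auto
      have "norm (P (Suc i) - P i) \<le> m i"
        unfolding P_def m_def Z_def by (rule FL) (use d in \<open>simp add: mult_right_mono\<close>)
      then show "C * norm (P i - P (Suc i)) \<le> C * m i"
        using C(1) by (intro mult_left_mono) (simp_all add: norm_minus_commute)
    qed
    have "\<exists>v v'. (\<forall>t. (v has_vector_derivative v' t) (at t)) \<and> continuous_on UNIV v' \<and> (\<forall>t\<in>{a..b}. v t \<in> N) \<and>
        (\<forall>i<k. \<forall>t\<in>{a + real i * d..a + real (Suc i) * d}. norm (v t - P i) \<le> C * m i \<and> norm (v' t) \<le> C * m i / d)"
      by (rule C1_interpolation[OF d k, where P = P and L = "\<lambda>i. C * m i" and a = a, unfolded kd]) (use PK J in auto)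
    then obtain v v' where v: "\<And>t. (v has_vector_derivative v' t) (at t)" "continuous_on UNIV v'" "\<And>t. t \<in> {a..b} \<Longrightarrow> v t \<in> N"
      and vb: "\<And>i t. i < k \<Longrightarrow> t \<in> {a + real i * d..a + real (Suc i) * d} \<Longrightarrow> norm (v t - P i) \<le> C * m i \<and> norm (v' t) \<le> C * m i / d"
      by blast
    have sum_bound: "(\<integral>\<^sup>+ x. ennreal (f x) \<partial>leb I) \<le> ennreal (\<Sum>i<k. B i * d)"
      if B: "\<And>i. i < k \<Longrightarrow> 0 \<le> B i" and f: "AE x in leb I. \<forall>i<k. x \<in> Z i \<longrightarrow> f x \<le> B i" for f B
    proof -
      have "(\<integral>\<^sup>+ x. ennreal (f x) \<partial>leb I) \<le> (\<integral>\<^sup>+ x. (\<Sum>i<k. ennreal (B i) * indicator (Z i) x) \<partial>leb I)"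
      proof (rule nn_integral_mono_AE)
        show "AE x in leb I. ennreal (f x) \<le> (\<Sum>i<k. ennreal (B i) * indicator (Z i) x)"
          using f AE_space
        proof eventually_elim
          case (elim x)
          then have "x \<in> I" by (simp add: space_restrict_space)
          then obtain i where i: "i < k" "x \<in> Z i"
            using uniform_grid_cover[OF ab k] unfolding Z_def d_def by blast
          have "ennreal (f x) \<le> ennreal (B i) * indicator (Z i) x" using elim i by (auto intro: ennreal_leI)
          also have "\<dots> \<le> (\<Sum>i<k. ennreal (B i) * indicator (Z i) x)"
            by (rule member_le_sum) (use i in auto)
          finally show ?case .
        qed
      qed
      also have "\<dots> = (\<integral>\<^sup>+ x. (\<Sum>i<k. ennreal (B i) * indicator (Z i) x) * indicator I x \<partial>lborel)"
        by (rule nn_integral_restrict_space) auto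
      also have "\<dots> \<le> (\<integral>\<^sup>+ x. (\<Sum>i<k. ennreal (B i) * indicator (Z i) x) \<partial>lborel)"
        by (intro nn_integral_mono) (auto simp: indicator_def)
      also have "\<dots> = (\<Sum>i<k. ennreal (B i) * emeasure lborel (Z i))"
        by (subst nn_integral_sum) (auto simp: Z_def nn_integral_cmult_indicator)
      also have "\<dots> = (\<Sum>i<k. ennreal (B i * d))"
      proof (intro sum.cong refl)
        fix i assume "i \<in> {..<k}"
        have "emeasure lborel (Z i) = ennreal d"
          using d unfolding Z_def by (subst emeasure_lborel_Ico) (auto simp: algebra_simps)
        then show "ennreal (B i) * emeasure lborel (Z i) = ennreal (B i * d)"
          using B \<open>i \<in> {..<k}\<close> d by (simp add: ennreal_mult)
      qed
      also have "\<dots> = ennreal (\<Sum>i<k. B i * d)"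
        using B d by (intro sum_ennreal) auto
      finally show ?thesis .
    qed
    have cv: "continuous_on UNIV v"
      using v(1) by (intro continuous_at_imp_continuous_on ballI has_vector_derivative_continuous)
    have "v C1_differentiable_on closure I"
      unfolding C1_differentiable_on_def using v(1,2) continuous_on_subset by blast
    moreover have "v ` closure I \<subseteq> N" using v(3) ab by auto
    moreover have "v \<in> L2N N I"
      unfolding L2N_def
    proof (intro CollectI conjI)
      show "v \<in> borel_measurable (leb I)"
        by (rule measurable_restrict_space1) (simp add: borel_measurable_continuous_onI[OF cv])
      show "AE x in leb I. v x \<in> N" using v(3) by (intro AE_I2) (auto simp: space_restrict_space)
      have "(\<integral>\<^sup>+ x. ennreal ((norm (v x))\<^sup>2) \<partial>leb I) \<le> ennreal (\<Sum>i<k. (C * m i + R)\<^sup>2 * d)"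
      proof (rule sum_bound)
        show "AE x in leb I. \<forall>i<k. x \<in> Z i \<longrightarrow> (norm (v x))\<^sup>2 \<le> (C * m i + R)\<^sup>2"
        proof (intro AE_I2 allI impI)
          fix x i assume i: "i < k" "x \<in> Z i"
          have "norm (v x) \<le> norm (v x - P i) + norm (P i)" by (metis diff_add_cancel norm_triangle_ineq)
          also have "\<dots> \<le> C * m i + R"
            using vb[OF i(1), of x] i PK[of i] unfolding Z_def by (intro add_mono) auto
          finally show "(norm (v x))\<^sup>2 \<le> (C * m i + R)\<^sup>2" by (intro power_mono) auto
        qed
      qed auto
      then show "(\<integral>\<^sup>+ x. ennreal ((norm (v x))\<^sup>2) \<partial>leb I) < \<infinity>" by (rule le_less_trans) simp
    qed
    moreover have "(\<integral>\<^sup>+ x. ennreal (norm (vector_derivative v (at x))) \<partial>leb I) \<le> ennreal (C * \<mu>)"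
    proof -
      have "(\<integral>\<^sup>+ x. ennreal (norm (vector_derivative v (at x))) \<partial>leb I) \<le> ennreal (\<Sum>i<k. C * m i / d * d)"
      proof (rule sum_bound)
        show "AE x in leb I. \<forall>i<k. x \<in> Z i \<longrightarrow> norm (vector_derivative v (at x)) \<le> C * m i / d"
        proof (intro AE_I2 allI impI)
          fix x i assume i: "i < k" "x \<in> Z i"
          then show "norm (vector_derivative v (at x)) \<le> C * m i / d"
            using vb[OF i(1), of x] vector_derivative_at[OF v(1), of x] unfolding Z_def by auto
        qed
      qed (use C m0 d in auto)
      also have "(\<Sum>i<k. C * m i / d * d) = C * (\<Sum>i<k. m i)" using d by (simp add: sum_distrib_left)
      also have "ennreal \<dots> \<le> ennreal (C * \<mu>)" using msum C by (intro ennreal_leI mult_left_mono)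
      finally show ?thesis .
    qed
    moreover have "(\<integral>\<^sup>+ x. ennreal ((norm (v x - w x))\<^sup>2) \<partial>leb I) \<le> ennreal ((C + 1)\<^sup>2 * \<mu>\<^sup>2 * (b - a) / real k)"
    proof -
      have "(\<integral>\<^sup>+ x. ennreal ((norm (v x - w x))\<^sup>2) \<partial>leb I) \<le> ennreal (\<Sum>i<k. ((C + 1) * m i)\<^sup>2 * d)"
      proof (rule sum_bound)
        show "AE x in leb I. \<forall>i<k. x \<in> Z i \<longrightarrow> (norm (v x - w x))\<^sup>2 \<le> ((C + 1) * m i)\<^sup>2"
          using good_representative AE_space
        proof eventually_elim
          case (elim x)
          show ?case
          proof (intro allI impI)
            fix i assume i: "i < k" "x \<in> Z i"
            have "norm (w x - P i) \<le> measure M ({a + real i * d..<x} \<inter> I)"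
              using FL[of "a + real i * d" x] elim i unfolding F_def P_def Z_def by auto
            also have "\<dots> \<le> m i" unfolding m_def
              by (rule finite_measure_mono[OF _ Zmeas]) (use i in \<open>auto simp: Z_def\<close>)
            finally have "norm (w x - P i) \<le> m i" .
            moreover have "norm (v x - P i) \<le> C * m i" using vb[OF i(1), of x] i unfolding Z_def by auto
            ultimately have "norm (v x - w x) \<le> (C + 1) * m i"
              using norm_triangle_ineq4[of "v x - P i" "w x - P i"] by (simp add: algebra_simps)
            then show "(norm (v x - w x))\<^sup>2 \<le> ((C + 1) * m i)\<^sup>2" by (intro power_mono) auto
          qed
        qed
      qed auto
      also have "(\<Sum>i<k. ((C + 1) * m i)\<^sup>2 * d) = (C + 1)\<^sup>2 * d * (\<Sum>i<k. m i * m i)"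
        by (simp add: sum_distrib_left power_mult_distrib power2_eq_square mult_ac)
      also have "\<dots> \<le> (C + 1)\<^sup>2 * d * (\<Sum>i<k. \<mu> * m i)"
        using d m0 mle by (intro mult_left_mono sum_mono mult_right_mono) auto
      also have "\<dots> \<le> (C + 1)\<^sup>2 * d * (\<mu> * \<mu>)"
        unfolding sum_distrib_left[symmetric] using d msum \<mu>0 by (intro mult_left_mono) auto
      also have "\<dots> = (C + 1)\<^sup>2 * \<mu>\<^sup>2 * (b - a) / real k" by (simp add: d_def power2_eq_square)
      finally show ?thesis by (simp add: ennreal_leI)
    qed
    ultimately show ?thesis by blast
  qed
  then have "\<forall>k. \<exists>v. v C1_differentiable_on closure I \<and> v ` closure I \<subseteq> N \<and> v \<in> L2N N I \<and>
      (\<integral>\<^sup>+ x. ennreal (norm (vector_derivative v (at x))) \<partial>leb I) \<le> ennreal (C * \<mu>) \<and>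
      (\<integral>\<^sup>+ x. ennreal ((norm (v x - w x))\<^sup>2) \<partial>leb I) \<le> ennreal ((C + 1)\<^sup>2 * \<mu>\<^sup>2 * (b - a) / real (Suc k))"
    by blast
  from choice[OF this] obtain V where V: "\<And>k. V k C1_differentiable_on closure I" "\<And>k. V k ` closure I \<subseteq> N" "\<And>k. V k \<in> L2N N I"
      "\<And>k. (\<integral>\<^sup>+ x. ennreal (norm (vector_derivative (V k) (at x))) \<partial>leb I) \<le> ennreal (C * \<mu>)"
      "\<And>k. (\<integral>\<^sup>+ x. ennreal ((norm (V k x - w x))\<^sup>2) \<partial>leb I) \<le> ennreal ((C + 1)\<^sup>2 * \<mu>\<^sup>2 * (b - a) / real (Suc k))"
    by blast
  have wL2: "w \<in> L2N N I"
    unfolding L2N_def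
  proof (intro CollectI conjI)
    interpret L: finite_measure "leb I" by (rule finite_measure_leb_interval)
    show "w \<in> borel_measurable (leb I)" using integrable_w by simp
    have "(\<integral>\<^sup>+ x. ennreal ((norm (w x))\<^sup>2) \<partial>leb I) \<le> (\<integral>\<^sup>+ x. ennreal (R\<^sup>2) \<partial>leb I)"
    proof (rule nn_integral_mono_AE)
      show "AE x in leb I. ennreal ((norm (w x))\<^sup>2) \<le> ennreal (R\<^sup>2)"
        using good_representative AE_space
      proof eventually_elim
        case (elim x)
        then have "norm (w x) \<le> R" using FR[of x] by (auto simp: F_def space_restrict_space)
        then show ?case by (intro ennreal_leI power_mono) auto
      qed
    qed
    also have "\<dots> < \<infinity>"
      by (simp add: L.emeasure_eq_measure ennreal_mult_less_top)
    finally show "(\<integral>\<^sup>+ x. ennreal ((norm (w x))\<^sup>2) \<partial>leb I) < \<infinity>" .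
  qed (rule wN)
  have lim: "(\<lambda>k. \<integral>\<^sup>+ x. ennreal ((norm (V k x - w x))\<^sup>2) \<partial>leb I) \<longlonglongrightarrow> 0"
  proof (rule tendsto_sandwich[OF _ _ tendsto_const])
    show "(\<lambda>k. ennreal ((C + 1)\<^sup>2 * \<mu>\<^sup>2 * (b - a) / real (Suc k))) \<longlonglongrightarrow> 0"
      using tendsto_ennrealI[OF LIMSEQ_Suc[OF lim_const_over_n]] by simp
  qed (use V(5) in auto)
  have "TV N I w \<le> ennreal (C * \<mu>)"
    unfolding TV_def
  proof (rule SUP_least, elim CollectE conjE)
    fix G assume lsc: "L2_lsc N I G"
      and G: "\<forall>v. v C1_differentiable_on closure I \<and> v ` closure I \<subseteq> N \<longrightarrow> G v \<le> (\<integral>\<^sup>+ x. ennreal (norm (vector_derivative v (at x))) \<partial>leb I)"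
    have "G w \<le> liminf (\<lambda>k. G (V k))"
      using lsc wL2 V(3) lim unfolding L2_lsc_def by blast
    also have "\<dots> \<le> liminf (\<lambda>k. ennreal (C * \<mu>))"
    proof (rule Liminf_mono, rule always_eventually, rule allI)
      fix k
      have "G (V k) \<le> (\<integral>\<^sup>+ x. ennreal (norm (vector_derivative (V k) (at x))) \<partial>leb I)" using G V(1,2) by blast
      then show "G (V k) \<le> ennreal (C * \<mu>)" using V(4) by (rule order_trans)
    qed
    finally show "G w \<le> ennreal (C * \<mu>)" by (simp add: Liminf_const)
  qed
  then show ?thesis by (rule le_less_trans) simp
qed

section \<open>Strong solutions at a fixed time\<close>

text \<open>Follow the square of the norm of \<open>z\<close> by \<open>cum_left_square\<close> from the left end
  to a point where it is at least one. The integrand is nonpositive at jumps and vanishes on the Cantor part, and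
  on the absolutely continuous part it is twice the inner product of \<open>z\<close> with
  \<open>wt\<close>.\<close>

lemma velocity_L1_ge_1:
  fixes N :: "'a::euclidean_space set" and a b :: real and w wt z :: "real \<Rightarrow> 'a"
  assumes N: "smooth_submanifold n N" "connected N" "closed N" "geodesically_complete N"
    and ab: "a < b" and w: "bvN N {a<..<b} w" and z: "bv {a<..<b} z"
    and inj: "\<And>x. x \<in> {a<..<b} \<Longrightarrow> ereal (geo_dist N (lft {a<..<b} w x) (rgt {a<..<b} w x)) < inj_radius N"
    and strong: "strong_conditions N a b w wt z"
    and nonconst: "emeasure (tv_meas {a<..<b} w) {a<..<b} \<noteq> 0"
  shows "1 \<le> (\<integral>\<^sup>+ x. ennreal (2 * norm (wt x)) \<partial>leb {a<..<b})"
proof -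
  interpret W: bv_function a b w
    using ab w by unfold_locales (auto simp: bvN_def)
  interpret Z: bv_function a b z
    using ab z by unfold_locales
  let ?I = "{a<..<b}"
  have wN: "AE x in leb ?I. w x \<in> N" using w by (simp add: bvN_def)
  have s1: "AE x in leb ?I. wt x = tproj N (w x) (ac_density ?I z x)"
    and s2: "AE x in tv_cantor ?I z. tproj N (lft ?I w x) (dens ?I z x) = 0"
    and s3: "\<And>x. x \<in> ?I \<Longrightarrow> lft ?I z x \<in> tangent_space N (lft ?I w x)"
    and s4: "\<And>x. x \<in> ?I \<Longrightarrow> norm (lft ?I z x) \<le> 1 \<and> norm (rgt ?I z x) \<le> 1"
    and s5: "AE x in tv_diffuse ?I w. lft ?I z x = dens ?I w x"
    and s6: "jump_set ?I z \<subseteq> jump_set ?I w"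
    and s7: "\<And>x. x \<in> jump_set ?I w \<Longrightarrow> lft ?I z x = Tminus N ?I w x"
    and s8: "rgt ?I z a = 0"
    using strong unfolding strong_conditions_def Let_def by auto
  have lN: "lft ?I w x \<in> N" "rgt ?I w x \<in> N" if "x \<in> ?I" for x
    using W.lft_in_closed[OF N(3) wN, of x] W.rgt_in_closed[OF N(3) wN, of x] that by auto
  have T: "subspace (tangent_space N (lft ?I w x))" if "x \<in> ?I" for x
    by (rule tangent_space_subspace[OF N(1) lN(1)[OF that]])
  have jump1: "norm (lft ?I z x) \<ge> 1" if "x \<in> jump_set ?I w" for x
  proof -
    have x: "x \<in> ?I" "lft ?I w x \<noteq> rgt ?I w x" using that by (auto simp: jump_set_def)
    show ?thesis unfolding s7[OF that]
      by (rule norm_Tminus_ge_1[OF N(1,2,4)]) (use lN[OF x(1)] x inj in auto)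
  qed
  \<comment> \<open>at a jump of \<open>w\<close>, or else at a point where \<open>z\<close> is the unit density of
    the diffuse part\<close>
  have "\<exists>x0\<in>?I. norm (lft ?I z x0) \<ge> 1"
  proof (rule ccontr)
    assume no: "\<not> ?thesis"
    then have "jump_set ?I w = {}" using jump1 by (auto simp: jump_set_def)
    then have "AE x in W.M. lft ?I z x = dens ?I w x"
      using s5 unfolding W.AE_diffuse_iff by simp
    then have "AE x in W.M. False"
      using W.norm_dens AE_space
    proof eventually_elim
      case (elim x)
      then have "x \<in> ?I" "norm (lft ?I z x) \<ge> 1" using W.space_M by auto
      then show False using no by blast
    qed
    then obtain K where K: "{x \<in> space W.M. \<not> False} \<subseteq> K" "emeasure W.M K = 0" "K \<in> sets W.M"
      by (rule AE_E)
    then have "emeasure W.M (space W.M) \<le> emeasure W.M K" by (intro emeasure_mono) auto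
    then have "emeasure W.M (space W.M) = 0" using K by simp
    then show False using nonconst by (simp add: W.space_M)
  qed
  then obtain x0 where x0: "x0 \<in> ?I" "norm (lft ?I z x0) \<ge> 1" by blast
  define l where "l = cum_left Z.M Z.\<sigma>"
  have lz: "lft ?I z x = l x" if "x \<in> ?I" for x using Z.lft_eq[of x] that s8 by (simp add: l_def)
  have rz: "rgt ?I z x = cum_right Z.M Z.\<sigma> x" if "x \<in> ?I" for x using Z.rgt_eq[of x] that s8 by simp
  define h where "h y = indicator {..<x0} y * ((l y + cum_right Z.M Z.\<sigma> y) \<bullet> Z.\<sigma> y)" for y
  define k where "k y = indicator (?I - Z.S) y * (2 * \<bar>l y \<bullet> Z.\<sigma> y\<bar>)" for y
  have "1 \<le> l x0 \<bullet> l x0"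
    using x0 lz by (simp add: dot_square_norm)
  then have "1 \<le> ennreal (LINT y|Z.M. h y)"
    unfolding h_def l_def Z.cum_left_square by (simp add: ennreal_leI flip: ennreal_1)
  also have "\<dots> \<le> (\<integral>\<^sup>+ y. ennreal (k y) \<partial>Z.M)"
  proof (rule integral_le_nn_integral_bound)
    show "AE y in Z.M. h y \<le> k y"
      using s2[unfolded Z.AE_cantor_iff] AE_space
    proof eventually_elim
      case (elim y)
      then have y: "y \<in> ?I" by (simp add: Z.space_M)
      have k0: "k y \<ge> 0" by (simp add: k_def)
      show "h y \<le> k y"
      proof (cases "y \<in> jump_set ?I z")
        case True
        define m where "m = measure Z.M {y}"
        have m: "m > 0" using True by (simp add: Z.jump_set_eq m_def zero_less_measure_iff)
        \<comment> \<open>at an atom, the integrand times the mass is the increment of the squared norm, from at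
          least one to at most one\<close>
        have r: "cum_right Z.M Z.\<sigma> y = l y + m *\<^sub>R Z.\<sigma> y"
          using Z.jump_eq[OF y] lz[OF y] rz[OF y] by (simp add: m_def)
        have "norm (l y) \<ge> 1" "norm (cum_right Z.M Z.\<sigma> y) \<le> 1"
          using jump1[of y] s6 True s4[OF y] lz[OF y] rz[OF y] by auto
        then have "cum_right Z.M Z.\<sigma> y \<bullet> cum_right Z.M Z.\<sigma> y - l y \<bullet> l y \<le> 0"
          unfolding dot_square_norm by (smt (verit) norm_ge_zero power_mono one_power2)
        moreover have "m * ((l y + cum_right Z.M Z.\<sigma> y) \<bullet> Z.\<sigma> y) = cum_right Z.M Z.\<sigma> y \<bullet> cum_right Z.M Z.\<sigma> y - l y \<bullet> l y"
          unfolding r by (simp add: inner_add_left inner_add_right inner_commute algebra_simps)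
        ultimately have "(l y + cum_right Z.M Z.\<sigma> y) \<bullet> Z.\<sigma> y \<le> 0"
          using m by (metis mult_le_0_iff not_le)
        then have "h y \<le> 0" by (auto simp: h_def indicator_def)
        then show ?thesis using k0 by linarith
      next
        case False
        then have "cum_right Z.M Z.\<sigma> y = l y" using y lz[OF y] rz[OF y] by (simp add: jump_set_def)
        then have h: "h y = indicator {..<x0} y * (2 * (l y \<bullet> Z.\<sigma> y))" by (simp add: h_def inner_add_left)
        show ?thesis
        proof (cases "y \<in> Z.S")
          case True
          then have "tproj N (lft ?I w y) (Z.\<sigma> y) = 0" using elim False by blast
          then have "l y \<bullet> Z.\<sigma> y = 0"
            using tproj_orth[OF T[OF y] s3[OF y], of "Z.\<sigma> y"] lz[OF y] by simp
          then show ?thesis using h k0 by simp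
        next
          case False
          then show ?thesis using h y by (auto simp: k_def indicator_def)
        qed
      qed
    qed
  qed
  also have "\<dots> = (\<integral>\<^sup>+ y. indicator (?I - Z.S) y * ennreal \<bar>(2 *\<^sub>R l y) \<bullet> Z.\<sigma> y\<bar> \<partial>Z.M)"
    by (intro nn_integral_cong) (auto simp: k_def indicator_def abs_mult)
  also have "\<dots> = (\<integral>\<^sup>+ y. ennreal \<bar>(2 *\<^sub>R l y) \<bullet> ac_density ?I z y\<bar> \<partial>leb ?I)"
  proof (rule Z.nn_integral_ac)
    have "l \<in> borel_measurable (leb ?I)"
      unfolding l_def by (rule measurable_restrict_space1) (simp add: Z.borel_measurable_cum_left)
    then show "(\<lambda>y. 2 *\<^sub>R l y) \<in> borel_measurable (leb ?I)" by measurable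
  qed
  also have "\<dots> \<le> (\<integral>\<^sup>+ x. ennreal (2 * norm (wt x)) \<partial>leb ?I)"
  proof (rule nn_integral_mono_AE)
    show "AE y in leb ?I. ennreal \<bar>(2 *\<^sub>R l y) \<bullet> ac_density ?I z y\<bar> \<le> ennreal (2 * norm (wt y))"
      using s1 W.AE_lft AE_space
    proof eventually_elim
      case (elim y)
      then have y: "y \<in> ?I" by (simp add: space_restrict_space)
      have "l y \<bullet> ac_density ?I z y = l y \<bullet> wt y"
        using tproj_orth[OF T[OF y] s3[OF y], of "ac_density ?I z y"] lz[OF y] elim by simp
      moreover have "\<bar>l y \<bullet> wt y\<bar> \<le> 1 * norm (wt y)"
        by (rule order_trans[OF Cauchy_Schwarz_ineq2 mult_right_mono]) (use s4[OF y] lz[OF y] in auto)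
      ultimately show ?case by (intro ennreal_leI) (simp add: abs_mult)
    qed
  qed
  finally show ?thesis .
qed

text \<open>Integrate Young's inequality \<open>2 r \<le> 1 / c + c r\<^sup>2\<close> with \<open>c = 2 (b -
  a)\<close>, for which the constant term contributes exactly one half.\<close>

lemma L2_lower_bound_if_L1_ge_1:
  fixes f :: "real \<Rightarrow> 'a::euclidean_space"
  assumes ab: "a < b" and f[measurable]: "f \<in> borel_measurable (leb {a<..<b})"
    and one: "1 \<le> (\<integral>\<^sup>+ x. ennreal (2 * norm (f x)) \<partial>leb {a<..<b})"
  shows "ennreal (1 / (4 * (b - a))) \<le> (\<integral>\<^sup>+ x. ennreal ((norm (f x))\<^sup>2) \<partial>leb {a<..<b})"
proof (cases "(\<integral>\<^sup>+ x. ennreal ((norm (f x))\<^sup>2) \<partial>leb {a<..<b})" rule: ennreal_cases)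
  case (real r)
  define c where "c = 2 * (b - a)"
  have c: "c > 0" using ab by (simp add: c_def)
  have "1 \<le> (\<integral>\<^sup>+ x. ennreal (2 * norm (f x)) \<partial>leb {a<..<b})" by (rule one)
  also have "\<dots> \<le> (\<integral>\<^sup>+ x. ennreal (1 / c) + ennreal c * ennreal ((norm (f x))\<^sup>2) \<partial>leb {a<..<b})"
  proof (rule nn_integral_mono)
    fix x
    have "0 \<le> (1 - c * norm (f x))\<^sup>2" by simp
    then have "c * (2 * norm (f x)) \<le> 1 + c * (c * (norm (f x))\<^sup>2)"
      by (simp add: power2_eq_square algebra_simps)
    then have "2 * norm (f x) \<le> 1 / c + c * (norm (f x))\<^sup>2"
      using c by (simp add: field_simps)
    then show "ennreal (2 * norm (f x)) \<le> ennreal (1 / c) + ennreal c * ennreal ((norm (f x))\<^sup>2)"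
      using c by (simp add: ennreal_leI flip: ennreal_mult ennreal_plus)
  qed
  also have "\<dots> = ennreal (1 / c) * emeasure (leb {a<..<b}) (space (leb {a<..<b})) + ennreal c * ennreal r"
    unfolding real(2)[symmetric] by (subst nn_integral_add) (auto simp: nn_integral_cmult)
  also have "emeasure (leb {a<..<b}) (space (leb {a<..<b})) = ennreal (b - a)"
    using ab by (simp add: emeasure_restrict_space space_restrict_space)
  also have "ennreal (1 / c) * ennreal (b - a) + ennreal c * ennreal r = ennreal (1 / 2 + c * r)"
    using c ab real(1) by (simp add: c_def flip: ennreal_mult ennreal_plus)
  finally have "ennreal 1 \<le> ennreal (1 / 2 + c * r)" by (simp only: ennreal_1)
  then have "1 \<le> 1 / 2 + c * r" by (subst (asm) ennreal_le_iff) (use c real(1) in auto)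
  then have "1 / (4 * (b - a)) \<le> r" using ab by (simp add: c_def field_simps)
  then show ?thesis unfolding real(2) by (rule ennreal_leI)
qed simp

lemma bv_const_if_tv_zero:
  assumes "a < b" "bv {a<..<b} w" "emeasure (tv_meas {a<..<b} w) {a<..<b} = 0"
  shows "jump_set {a<..<b} w = {}" and "\<And>x. x \<in> {a<..<b} \<Longrightarrow> lft {a<..<b} w x = rgt {a<..<b} w a"
    and "AE x in leb {a<..<b}. w x = rgt {a<..<b} w a"
proof -
  interpret bv_function a b w using assms by unfold_locales
  have M0: "emeasure M A = 0" for A
  proof (cases "A \<in> sets M")
    case True
    then have "emeasure M A \<le> emeasure M I"
      by (intro emeasure_mono) (auto simp: sets_M sets_I_iff)
    then show ?thesis using assms(3) by simp
  qed (rule emeasure_notin_sets)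
  show "jump_set I w = {}" unfolding jump_set_eq by (simp add: measure_def M0)
  have AEF: "AE x in M. False"
    by (rule AE_I[where N = I]) (auto simp: space_M M0 sets_M sets_I_iff)
  have c0: "cum_left M \<sigma> x = 0" for x
    unfolding cum_left_def by (rule integral_eq_zero_AE) (use AEF in \<open>auto elim: eventually_mono\<close>)
  show lft: "lft I w x = rgt I w a" if "x \<in> I" for x using lft_eq[of x] that c0 by simp
  show "AE x in leb I. w x = rgt I w a" using good_representative by eventually_elim (simp add: c0)
qed

text \<open>The function \<open>w\<close> has a single value \<open>c\<close> and no jumps, so \<open>z\<close> has
  none either. For \<open>e\<close> tangent at \<open>c\<close> the total increment of \<open>e \<bullet> z\<close>
  is zero, the Cantor part contributes nothing to it, and the absolutely continuous part contributes the integral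
  of \<open>e \<bullet> wt\<close>. Hence the mean of \<open>wt\<close> is orthogonal to the tangent space to which
  it belongs.\<close>

lemma velocity_mean_zero_if_const:
  fixes N :: "'a::euclidean_space set" and a b :: real and w wt z :: "real \<Rightarrow> 'a"
  assumes N: "smooth_submanifold n N" "closed N"
    and ab: "a < b" and w: "bvN N {a<..<b} w" and z: "bv {a<..<b} z"
    and strong: "strong_conditions N a b w wt z"
    and const: "emeasure (tv_meas {a<..<b} w) {a<..<b} = 0"
    and int: "integrable (leb {a<..<b}) wt"
  shows "(LINT x|leb {a<..<b}. wt x) = 0"
proof -
  interpret W: bv_function a b w
    using ab w by unfold_locales (auto simp: bvN_def)
  interpret Z: bv_function a b z
    using ab z by unfold_locales
  let ?I = "{a<..<b}"
  have bw: "bv ?I w" using w by (simp add: bvN_def)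
  note C = bv_const_if_tv_zero[OF ab bw const]
  define c where "c = rgt ?I w a"
  have cN: "c \<in> N" unfolding c_def using w ab by (intro W.rgt_in_closed[OF N(2)]) (auto simp: bvN_def)
  define T where "T = tangent_space N c"
  have T: "subspace T" unfolding T_def by (rule tangent_space_subspace[OF N(1) cN])
  have s1: "AE x in leb ?I. wt x = tproj N (w x) (ac_density ?I z x)"
    and s2: "AE x in tv_cantor ?I z. tproj N (lft ?I w x) (dens ?I z x) = 0"
    and s6: "jump_set ?I z \<subseteq> jump_set ?I w"
    and s8: "rgt ?I z a = 0" "lft ?I z b = 0"
    using strong unfolding strong_conditions_def Let_def by auto
  have wt: "AE x in leb ?I. wt x = tproj N c (ac_density ?I z x)"
    using s1 C(3) by eventually_elim (simp add: c_def)
  have cantor: "AE x in Z.M. x \<in> Z.S \<longrightarrow> tproj N c (Z.\<sigma> x) = 0"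
    using s2[unfolded Z.AE_cantor_iff] AE_space
    by eventually_elim (use s6 C(1,2) Z.space_M in \<open>auto simp: c_def\<close>)
  have ac: "e \<bullet> (LINT x|leb ?I. wt x) = 0" if e: "e \<in> T" for e
  proof -
    have "(LINT x|Z.M. indicator {..<b} x *\<^sub>R Z.\<sigma> x) = 0"
      using Z.lft_eq[of b] ab s8 unfolding cum_left_def by simp
    then have "0 = e \<bullet> (LINT x|Z.M. Z.\<sigma> x)"
      by (subst Bochner_Integration.integral_cong[OF refl, where g = "\<lambda>x. indicator {..<b} x *\<^sub>R Z.\<sigma> x"])
        (auto simp: Z.space_M)
    also have "\<dots> = (LINT x|Z.M. e \<bullet> Z.\<sigma> x)" by (rule integral_inner_right[symmetric]) (rule Z.integrable_dens)
    also have "\<dots> = (LINT x|Z.M. e \<bullet> (indicator (?I - Z.S) x *\<^sub>R Z.\<sigma> x))"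
    proof (rule integral_cong_AE)
      show "AE x in Z.M. e \<bullet> Z.\<sigma> x = e \<bullet> (indicator (?I - Z.S) x *\<^sub>R Z.\<sigma> x)"
        using cantor AE_space
      proof eventually_elim
        case (elim x)
        show ?case
        proof (cases "x \<in> Z.S")
          case True
          then have "e \<bullet> Z.\<sigma> x = 0"
            using tproj_orth[of N c e "Z.\<sigma> x"] T e elim by (simp add: T_def)
          then show ?thesis by simp
        next
          case False
          then show ?thesis using elim by (simp add: Z.space_M)
        qed
      qed
      show "(\<lambda>x. e \<bullet> Z.\<sigma> x) \<in> borel_measurable Z.M" by measurable
      have "(\<lambda>x. indicator (?I - Z.S) x *\<^sub>R Z.\<sigma> x) \<in> borel_measurable Z.M"
        by (intro borel_measurable_scaleR borel_measurable_indicator Z.compl_S_sets Z.dens_meas)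
      then show "(\<lambda>x. e \<bullet> (indicator (?I - Z.S) x *\<^sub>R Z.\<sigma> x)) \<in> borel_measurable Z.M"
        by (intro borel_measurable_inner) auto
    qed
    also have "\<dots> = e \<bullet> (LINT x|Z.M. indicator (?I - Z.S) x *\<^sub>R Z.\<sigma> x)"
      by (rule integral_inner_right) (rule integrable_mult_indicator[OF Z.compl_S_sets Z.integrable_dens])
    also have "\<dots> = e \<bullet> (LINT x|leb ?I. ac_density ?I z x)" by (simp add: Z.integral_ac(2))
    also have "\<dots> = (LINT x|leb ?I. e \<bullet> ac_density ?I z x)"
      by (rule integral_inner_right[symmetric]) (rule Z.integral_ac(1))
    also have "\<dots> = (LINT x|leb ?I. e \<bullet> wt x)"
    proof (rule integral_cong_AE)
      show "AE x in leb ?I. e \<bullet> ac_density ?I z x = e \<bullet> wt x"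
        using wt
      proof eventually_elim
        case (elim x)
        then show ?case using tproj_orth[of N c e "ac_density ?I z x"] T e by (simp add: T_def)
      qed
      show "(\<lambda>x. e \<bullet> ac_density ?I z x) \<in> borel_measurable (leb ?I)"
        using borel_measurable_integrable[OF Z.integral_ac(1)] by (intro borel_measurable_inner) auto
      show "(\<lambda>x. e \<bullet> wt x) \<in> borel_measurable (leb ?I)"
        using borel_measurable_integrable[OF int] by (intro borel_measurable_inner) auto
    qed
    also have "\<dots> = e \<bullet> (LINT x|leb ?I. wt x)" by (rule integral_inner_right) (rule int)
    finally show ?thesis by simp
  qed
  obtain y q where yq: "y \<in> span T" "\<And>x. x \<in> span T \<Longrightarrow> orthogonal q x" "(LINT x|leb ?I. wt x) = y + q"
    using orthogonal_subspace_decomp_exists[of T "LINT x|leb ?I. wt x"] by metis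
  have sp: "span T = T" using T by (simp add: span_eq_iff)
  have "q \<bullet> (LINT x|leb ?I. wt x) = (LINT x|leb ?I. q \<bullet> wt x)"
    by (rule integral_inner_right[symmetric]) (rule int)
  also have "\<dots> = 0"
  proof (rule integral_eq_zero_AE)
    show "AE x in leb ?I. q \<bullet> wt x = 0"
      using wt
    proof eventually_elim
      case (elim x)
      have "wt x \<in> T" using tproj_in[of N c "ac_density ?I z x"] T elim by (simp add: T_def)
      then show ?case using yq(2) sp by (simp add: orthogonal_def)
    qed
  qed
  finally have q0: "q \<bullet> (LINT x|leb ?I. wt x) = 0" .
  have "(LINT x|leb ?I. wt x) \<bullet> (LINT x|leb ?I. wt x) = y \<bullet> (LINT x|leb ?I. wt x) + q \<bullet> (LINT x|leb ?I. wt x)"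
    by (subst (1) yq(3)) (rule inner_add_left)
  also have "\<dots> = 0" using q0 ac[of y] yq(1) sp by simp
  finally show ?thesis by simp
qed

section \<open>Evolution in time and finite stopping\<close>

lemma AE_leb_subset:
  assumes "AE x in leb B. P x" "A \<subseteq> B" "A \<in> sets borel" "B \<in> sets borel"
  shows "AE x in leb A. P x"
proof -
  have "AE x in lborel. x \<in> B \<longrightarrow> P x" using assms by (simp add: AE_restrict_space_iff)
  then have "AE x in lborel. x \<in> A \<longrightarrow> P x" by eventually_elim (use assms(2) in auto)
  then show ?thesis using assms by (simp add: AE_restrict_space_iff)
qed

lemma integral_leb_cong_support:
  fixes f :: "real \<Rightarrow> 'a::euclidean_space"
  assumes "A \<in> sets borel" "B \<in> sets borel" "K \<subseteq> A" "K \<subseteq> B" "\<And>t. t \<notin> K \<Longrightarrow> f t = 0"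
  shows "(LINT t|leb A. f t) = (LINT t|leb B. f t)"
proof -
  have "(\<lambda>t. indicator A t *\<^sub>R f t) = (\<lambda>t. indicator B t *\<^sub>R f t)"
  proof
    fix t show "indicator A t *\<^sub>R f t = indicator B t *\<^sub>R f t"
      using assms(3-5) by (cases "t \<in> K") (auto simp: indicator_def)
  qed
  then show ?thesis
    using assms(1,2) integral_restrict_space[of A lborel f] integral_restrict_space[of B lborel f] by simp
qed

lemma L2_cyl_integrable:
  assumes "L2_cyl {a<..<b} T' u"
  shows "integrable (leb {0<..<T'} \<Otimes>\<^sub>M leb {a<..<b}) (\<lambda>(t, x). u t x)"
proof -
  interpret A: finite_measure "leb {0<..<T'}" by (rule finite_measure_leb_interval)
  interpret B: finite_measure "leb {a<..<b}" by (rule finite_measure_leb_interval)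
  let ?P = "leb {0<..<T'} \<Otimes>\<^sub>M leb {a<..<b}"
  have m[measurable]: "(\<lambda>(t, x). u t x) \<in> borel_measurable ?P"
    and fin: "(\<integral>\<^sup>+ t. \<integral>\<^sup>+ x. ennreal ((norm (u t x))\<^sup>2) \<partial>leb {a<..<b} \<partial>leb {0<..<T'}) < \<infinity>"
    using assms unfolding L2_cyl_def by auto
  have m2: "(\<lambda>p. u (fst p) (snd p)) \<in> borel_measurable ?P" using m by (simp add: case_prod_beta')
  have "(\<integral>\<^sup>+ p. ennreal (norm (u (fst p) (snd p))) \<partial>?P) \<le> (\<integral>\<^sup>+ p. 1 + ennreal ((norm (u (fst p) (snd p)))\<^sup>2) \<partial>?P)"
  proof (rule nn_integral_mono)
    fix p
    have "norm (u (fst p) (snd p)) \<le> 1 + (norm (u (fst p) (snd p)))\<^sup>2"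
    proof -
      have "2 * norm (u (fst p) (snd p)) \<le> 1 + (norm (u (fst p) (snd p)))\<^sup>2"
        using zero_le_power2[of "norm (u (fst p) (snd p)) - 1"] unfolding power2_diff by simp
      moreover have "0 \<le> norm (u (fst p) (snd p))" by (rule norm_ge_zero)
      ultimately show ?thesis by linarith
    qed
    then show "ennreal (norm (u (fst p) (snd p))) \<le> 1 + ennreal ((norm (u (fst p) (snd p)))\<^sup>2)"
      by (simp add: ennreal_leI flip: ennreal_1 ennreal_plus)
  qed
  also have "\<dots> = emeasure ?P (space ?P) + (\<integral>\<^sup>+ p. ennreal ((norm (u (fst p) (snd p)))\<^sup>2) \<partial>?P)"
    using m2 by (subst nn_integral_add) auto
  also have "(\<integral>\<^sup>+ p. ennreal ((norm (u (fst p) (snd p)))\<^sup>2) \<partial>?P)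
      = (\<integral>\<^sup>+ t. \<integral>\<^sup>+ x. ennreal ((norm (u t x))\<^sup>2) \<partial>leb {a<..<b} \<partial>leb {0<..<T'})"
    using m2 by (subst B.nn_integral_fst[symmetric]) auto
  also have "emeasure ?P (space ?P) = emeasure (leb {0<..<T'}) (space (leb {0<..<T'})) * emeasure (leb {a<..<b}) (space (leb {a<..<b}))"
    unfolding space_pair_measure by (rule B.emeasure_pair_measure_Times[OF sets.top sets.top])
  finally have "(\<integral>\<^sup>+ p. ennreal (norm (u (fst p) (snd p))) \<partial>?P) < \<infinity>"
    using fin by (simp add: A.emeasure_eq_measure B.emeasure_eq_measure less_top top.not_eq_extremum ennreal_mult_less_top le_less_trans)
  then show ?thesis
    using m2 by (intro integrableI_bounded) (simp_all add: case_prod_beta')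
qed

text \<open>Integrate the weak formulation in space and exchange the integrals: the spatial mean has weak
  derivative zero on \<open>{s<..<T'}\<close>.\<close>

lemma mean_const_if_weak_dt_mean_zero:
  fixes u v :: "real \<Rightarrow> real \<Rightarrow> 'a::euclidean_space"
  assumes T': "T' \<in> time_int T" and s: "0 \<le> s" "s < T'"
    and u: "L2_cyl {a<..<b} T' u" and v: "has_weak_dt {a<..<b} T u v"
    and zero: "AE t in leb {s<..<T'}. (LINT x|leb {a<..<b}. v t x) = 0"
  shows "\<exists>m. AE t in leb {s<..<T'}. (LINT x|leb {a<..<b}. u t x) = m"
proof (rule AE_const_if_weak_deriv_zero[OF s(2)])
  let ?I = "{a<..<b}" and ?J = "{0<..<T'}"
  interpret A: finite_measure "leb ?J" by (rule finite_measure_leb_interval)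
  interpret B: finite_measure "leb ?I" by (rule finite_measure_leb_interval)
  interpret P: pair_sigma_finite "leb ?J" "leb ?I" ..
  have iu: "integrable (leb ?J \<Otimes>\<^sub>M leb ?I) (\<lambda>(t, x). u t x)"
    by (rule L2_cyl_integrable[OF u])
  have "L2_cyl ?I T' v" using v T' unfolding has_weak_dt_def by blast
  then have iv: "integrable (leb ?J \<Otimes>\<^sub>M leb ?I) (\<lambda>(t, x). v t x)"
    by (rule L2_cyl_integrable)
  have sub: "{s<..<T'} \<subseteq> ?J" "{s<..<T'} \<subseteq> time_int T"
    using s T' by (auto simp: time_int_def elim: less_trans[rotated])
  have tm: "time_int T \<in> sets borel"
  proof -
    have "open (time_int T)"
      unfolding time_int_def by (intro open_Collect_conj open_Collect_less continuous_intros)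
    then show ?thesis by (rule borel_open)
  qed
  show "integrable (leb {s<..<T'}) (\<lambda>t. LINT x|leb ?I. u t x)"
  proof -
    have "integrable (leb ?J) (\<lambda>t. LINT x|leb ?I. u t x)" using P.integrable_fst[OF iu] .
    then have "set_integrable lborel ?J (\<lambda>t. LINT x|leb ?I. u t x)"
      by (simp add: integrable_restrict_space set_integrable_def)
    then have "set_integrable lborel {s<..<T'} (\<lambda>t. LINT x|leb ?I. u t x)"
      by (rule set_integrable_subset) (use sub in auto)
    then show ?thesis by (simp add: integrable_restrict_space set_integrable_def)
  qed
  fix \<phi> assume \<phi>: "test_fun {s<..<T'} \<phi>"
  obtain K B where K: "K \<subseteq> {s<..<T'}" "\<And>t. t \<notin> K \<Longrightarrow> \<phi> t = 0" "\<And>t. t \<notin> K \<Longrightarrow> deriv \<phi> t = 0"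
    and B: "\<And>t. \<bar>\<phi> t\<bar> \<le> B" "\<And>t. \<bar>deriv \<phi> t\<bar> \<le> B"
    and m: "\<phi> \<in> borel_measurable borel" "deriv \<phi> \<in> borel_measurable borel"
    using test_fun_props[OF \<phi>] by blast
  have KJ: "K \<subseteq> ?J" "K \<subseteq> time_int T" using K(1) sub by auto
  have "test_fun (time_int T) \<phi>" using \<phi> sub(2) unfolding test_fun_def by blast
  then have "AE x in leb ?I. (LINT t|leb (time_int T). deriv \<phi> t *\<^sub>R u t x) = - (LINT t|leb (time_int T). \<phi> t *\<^sub>R v t x)"
    using v unfolding has_weak_dt_def by blast
  moreover have "(LINT t|leb (time_int T). deriv \<phi> t *\<^sub>R u t x) = (LINT t|leb ?J. deriv \<phi> t *\<^sub>R u t x)" for x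
    by (rule integral_leb_cong_support[OF tm _ KJ(2,1)]) (auto simp: K)
  moreover have "(LINT t|leb (time_int T). \<phi> t *\<^sub>R v t x) = (LINT t|leb ?J. \<phi> t *\<^sub>R v t x)" for x
    by (rule integral_leb_cong_support[OF tm _ KJ(2,1)]) (auto simp: K)
  ultimately have weak: "AE x in leb ?I. (LINT t|leb ?J. deriv \<phi> t *\<^sub>R u t x) = - (LINT t|leb ?J. \<phi> t *\<^sub>R v t x)"
    by simp
  have swap: "integrable (leb ?J \<Otimes>\<^sub>M leb ?I) (\<lambda>(t, x). \<psi> t *\<^sub>R f t x) \<and>
      (LINT x|leb ?I. LINT t|leb ?J. \<psi> t *\<^sub>R f t x) = (LINT t|leb ?J. \<psi> t *\<^sub>R (LINT x|leb ?I. f t x))"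
    if f: "integrable (leb ?J \<Otimes>\<^sub>M leb ?I) (\<lambda>(t, x). f t x)" and \<psi>: "\<psi> \<in> borel_measurable borel" "\<And>t. \<bar>\<psi> t\<bar> \<le> B"
    for \<psi> :: "real \<Rightarrow> real" and f :: "real \<Rightarrow> real \<Rightarrow> 'a"
  proof -
    have "integrable (leb ?J \<Otimes>\<^sub>M leb ?I) (\<lambda>p. \<psi> (fst p) *\<^sub>R f (fst p) (snd p))"
    proof (rule Bochner_Integration.integrable_bound)
      show "integrable (leb ?J \<Otimes>\<^sub>M leb ?I) (\<lambda>p. B *\<^sub>R f (fst p) (snd p))"
        using f by (intro integrable_scaleR_right) (simp add: case_prod_beta')
      have "\<psi> \<in> borel_measurable (leb ?J)" by (rule measurable_restrict_space1) (simp add: \<psi>)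
      then have "(\<lambda>p. \<psi> (fst p)) \<in> borel_measurable (leb ?J \<Otimes>\<^sub>M leb ?I)"
        by (rule measurable_compose[OF measurable_fst])
      moreover have "(\<lambda>p. f (fst p) (snd p)) \<in> borel_measurable (leb ?J \<Otimes>\<^sub>M leb ?I)"
        using borel_measurable_integrable[OF f] by (simp add: case_prod_beta')
      ultimately show "(\<lambda>p. \<psi> (fst p) *\<^sub>R f (fst p) (snd p)) \<in> borel_measurable (leb ?J \<Otimes>\<^sub>M leb ?I)"
        by (rule borel_measurable_scaleR)
      have "\<bar>\<psi> t\<bar> \<le> \<bar>B\<bar>" for t using \<psi>(2)[of t] by linarith
      then show "AE p in leb ?J \<Otimes>\<^sub>M leb ?I. norm (\<psi> (fst p) *\<^sub>R f (fst p) (snd p)) \<le> norm (B *\<^sub>R f (fst p) (snd p))"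
        by (auto intro!: mult_right_mono)
    qed
    then have i: "integrable (leb ?J \<Otimes>\<^sub>M leb ?I) (\<lambda>(t, x). \<psi> t *\<^sub>R f t x)" by (simp add: case_prod_beta')
    moreover have "(LINT x|leb ?I. LINT t|leb ?J. \<psi> t *\<^sub>R f t x) = (LINT t|leb ?J. LINT x|leb ?I. \<psi> t *\<^sub>R f t x)"
      by (rule P.Fubini_integral[OF i])
    ultimately show ?thesis by simp
  qed
  note su = swap[OF iu m(2) B(2)] and sv = swap[OF iv m(1) B(1)]
  have "(LINT t|leb {s<..<T'}. deriv \<phi> t *\<^sub>R (LINT x|leb ?I. u t x)) = (LINT t|leb ?J. deriv \<phi> t *\<^sub>R (LINT x|leb ?I. u t x))"
    by (rule integral_leb_cong_support[OF _ _ K(1) KJ(1)]) (auto simp: K)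
  also have "\<dots> = (LINT x|leb ?I. LINT t|leb ?J. deriv \<phi> t *\<^sub>R u t x)" using su by simp
  also have "\<dots> = (LINT x|leb ?I. - (LINT t|leb ?J. \<phi> t *\<^sub>R v t x))"
    by (rule integral_cong_AE)
      (use weak P.integrable_snd[OF conjunct1[OF su]] P.integrable_snd[OF conjunct1[OF sv]] in auto)
  also have "\<dots> = - (LINT t|leb ?J. \<phi> t *\<^sub>R (LINT x|leb ?I. v t x))" using sv by simp
  also have "(LINT t|leb ?J. \<phi> t *\<^sub>R (LINT x|leb ?I. v t x)) = (LINT t|leb {s<..<T'}. \<phi> t *\<^sub>R (LINT x|leb ?I. v t x))"
    by (rule integral_leb_cong_support[OF _ _ KJ(1) K(1)]) (auto simp: K)
  also have "\<dots> = 0"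
    by (rule integral_eq_zero_AE) (use zero in \<open>auto elim: eventually_mono\<close>)
  finally show "(LINT t|leb {s<..<T'}. deriv \<phi> t *\<^sub>R (LINT x|leb ?I. u t x)) = 0" by simp
qed

text \<open>Any time is a left limit of good times, and the representative of \<open>u\<close> is continuous into
  \<open>L\<^sup>2\<close>.\<close>

lemma constant_at_all_times_if_AE:
  fixes u :: "real \<Rightarrow> real \<Rightarrow> 'a::euclidean_space"
  assumes H1: "H1_loc N {a<..<b} T u" and T: "T' \<in> time_int T" and s: "0 \<le> s"
    and c: "AE t in leb {s<..<T'}. AE x in leb {a<..<b}. u t x = c"
    and t: "s < t" "t \<le> T'"
  shows "AE x in leb {a<..<b}. u t x = c"
proof -
  let ?I = "{a<..<b}"
  have tT: "0 \<le> t" "ereal t < T"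
  proof -
    show "0 \<le> t" using s t by simp
    have "ereal t \<le> ereal T'" using t by simp
    also have "\<dots> < T" using T by (simp add: time_int_def)
    finally show "ereal t < T" .
  qed
  have ut: "u t \<in> borel_measurable (leb ?I)"
    and lim: "((\<lambda>r. \<integral>\<^sup>+ x. ennreal ((norm (u r x - u t x))\<^sup>2) \<partial>leb ?I) \<longlongrightarrow> 0) (at t within {r. 0 \<le> r \<and> ereal r < T})"
    using H1 tT unfolding H1_loc_def L2N_def by auto
  have sub: "{s<..<t} \<subseteq> {r. 0 \<le> r \<and> ereal r < T}"
  proof
    fix r assume r: "r \<in> {s<..<t}"
    then have "ereal r \<le> ereal t" by simp
    then have "ereal r < T" using tT(2) by (rule le_less_trans)
    then show "r \<in> {r. 0 \<le> r \<and> ereal r < T}" using r s by auto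
  qed
  have lim': "((\<lambda>r. \<integral>\<^sup>+ x. ennreal ((norm (u r x - u t x))\<^sup>2) \<partial>leb ?I) \<longlongrightarrow> 0) (at_left t)"
  proof -
    have "at t within {s<..<t} = at_left t"
      by (rule at_within_nhd[of t "{s<..}"]) (use t in auto)
    then show ?thesis
      using tendsto_within_subset[OF lim, of "{s<..<t}"] sub by simp
  qed
  define q where "q = (\<integral>\<^sup>+ x. ennreal ((norm (c - u t x))\<^sup>2) \<partial>leb ?I)"
  have "frequently (\<lambda>r. AE x in leb ?I. u r x = c) (at_left t)"
    by (rule frequently_at_left_if_AE[OF c t])
  then have "frequently (\<lambda>r. (\<integral>\<^sup>+ x. ennreal ((norm (u r x - u t x))\<^sup>2) \<partial>leb ?I) = q) (at_left t)"
  proof (rule frequently_mono[rotated], intro allI impI)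
    fix r assume "AE x in leb ?I. u r x = c"
    then show "(\<integral>\<^sup>+ x. ennreal ((norm (u r x - u t x))\<^sup>2) \<partial>leb ?I) = q"
      unfolding q_def by (intro nn_integral_cong_AE) (auto elim: eventually_mono)
  qed
  then have "q = 0"
  proof (rule contrapos_pp)
    assume "q \<noteq> 0"
    then have "0 < q" by (simp add: zero_less_iff_neq_zero)
    from order_tendstoD(2)[OF lim' this]
    have "eventually (\<lambda>r. (\<integral>\<^sup>+ x. ennreal ((norm (u r x - u t x))\<^sup>2) \<partial>leb ?I) \<noteq> q) (at_left t)"
      by eventually_elim auto
    then show "\<not> frequently (\<lambda>r. (\<integral>\<^sup>+ x. ennreal ((norm (u r x - u t x))\<^sup>2) \<partial>leb ?I) = q) (at_left t)"
      by (simp add: frequently_def)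
  qed
  then have "AE x in leb ?I. ennreal ((norm (c - u t x))\<^sup>2) = 0"
    unfolding q_def by (subst (asm) nn_integral_0_iff_AE) (use ut in auto)
  then show ?thesis by eventually_elim simp
qed

text \<open>Distinct points of \<open>N\<close> have positive geodesic distance, so vanishing of the intrinsic
  variation excludes jumps.\<close>

lemma varN_zero_iff_tv_zero:
  fixes N :: "'a::euclidean_space set"
  assumes N: "smooth_submanifold n N" "connected N" "closed N" and ab: "a < b" and w: "bvN N {a<..<b} w"
  shows "varN N {a<..<b} w {a<..<b} = 0 \<longleftrightarrow> emeasure (tv_meas {a<..<b} w) {a<..<b} = 0"
proof -
  interpret bv_function a b w using ab w by unfold_locales (auto simp: bvN_def)
  have bw: "bv I w" and wN: "AE x in leb I. w x \<in> N" using w by (auto simp: bvN_def)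
  have comp: "I - jump_set I w \<in> sets M" using sets.compl_sets[OF jump_set_sets_M] by (simp add: space_M)
  have IM: "I \<in> sets M" by (simp add: sets_M sets_I_iff)
  have dif: "emeasure (tv_diffuse I w) I = emeasure M (I - jump_set I w)"
    unfolding tv_diffuse_def by (subst emeasure_density_indicator[OF comp IM]) (simp add: Int_absorb2)
  show ?thesis
  proof
    assume z: "emeasure M I = 0"
    have "emeasure M (I - jump_set I w) \<le> emeasure M I" by (rule emeasure_mono[OF _ IM]) auto
    then show "varN N I w I = 0"
      unfolding varN_def dif bv_const_if_tv_zero(1)[OF ab bw z] using z by (simp add: nn_integral_empty)
  next
    assume "varN N I w I = 0"
    then have 1: "emeasure M (I - jump_set I w) = 0"
      and "(\<integral>\<^sup>+ x. ennreal (geo_dist N (lft I w x) (rgt I w x)) \<partial>count_space (I \<inter> jump_set I w)) = 0"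
      unfolding varN_def dif by auto
    then have 2: "AE x in count_space (I \<inter> jump_set I w). ennreal (geo_dist N (lft I w x) (rgt I w x)) = 0"
      by (subst (asm) nn_integral_0_iff_AE) auto
    have "jump_set I w = {}"
    proof (rule ccontr)
      assume "jump_set I w \<noteq> {}"
      then obtain x where x: "x \<in> jump_set I w" by blast
      then have x': "x \<in> I" "lft I w x \<noteq> rgt I w x" by (auto simp: jump_set_def)
      have "lft I w x \<in> N" "rgt I w x \<in> N" using x' lft_in_closed[OF N(3) wN, of x] rgt_in_closed[OF N(3) wN, of x] by auto
      then have "geo_dist N (lft I w x) (rgt I w x) > 0" using N(1,2) x'(2) by (intro geo_dist_pos) auto
      moreover have "ennreal (geo_dist N (lft I w x) (rgt I w x)) = 0" using 2 x x' by (simp add: AE_count_space)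
      ultimately show False by (simp add: ennreal_eq_0_iff)
    qed
    then show "emeasure M I = 0" using 1 by simp
  qed
qed

lemma exists_time_if_AE:
  assumes "AE t in leb {0<..<\<tau>}. Q t" "0 \<le> \<tau>'" "\<tau>' < (\<tau>::real)"
  shows "\<exists>t. \<tau>' < t \<and> t < \<tau> \<and> Q t"
proof -
  have "frequently Q (at_left \<tau>)" by (rule frequently_at_left_if_AE[OF assms(1)]) (use assms in auto)
  moreover have "eventually (\<lambda>t. \<tau>' < t \<and> t < \<tau>) (at_left \<tau>)"
    using assms(3) by (auto simp: eventually_at_left_field)
  ultimately have "frequently (\<lambda>t. (\<tau>' < t \<and> t < \<tau>) \<and> Q t) (at_left \<tau>)"
    by (rule frequently_eventually_frequently[THEN frequently_elim1]) auto
  then show ?thesis by (auto dest: frequently_ex)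
qed

theorem theorem1p6:
  fixes N :: "'a::euclidean_space set" and n :: nat and a b :: real and u0 :: "real \<Rightarrow> 'a"
  defines "I \<equiv> {a<..<b}"
  assumes "a < b"
    and "smooth_submanifold n N" and "connected N" and "closed N" and "geodesically_complete N"
    and "curv_sup N < \<infinity>"
    and "u0 \<in> BV_rad N I"
  shows "\<exists>Tstar::real. 0 \<le> Tstar \<and>
    (\<forall>(T::ereal) (u :: real \<Rightarrow> real \<Rightarrow> 'a).
       ereal Tstar < T \<and> strong_solution N a b T u \<and> (AE x in leb I. u 0 x = u0 x) \<and>
       (AE t in leb (time_int T).
          TV N I (u t) +
            (\<integral>\<^sup>+ \<tau>. \<integral>\<^sup>+ x. ennreal ((norm (weak_dt I T u \<tau> x))\<^sup>2) \<partial>leb I \<partial>leb {0<..<t})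
          \<le> TV N I u0) \<and>
       (AE s in leb (time_int T). AE t in leb (time_int T). s \<le> t \<longrightarrow>
          (\<forall>A\<in>sets (leb I). varN N I (u t) A \<le> varN N I (u s) A \<and> varN N I (u s) A \<le> varN N I u0 A))
       \<longrightarrow> (\<exists>ubar\<in>N. \<forall>t. Tstar \<le> t \<and> ereal t < T \<longrightarrow> (AE x in leb I. u t x = ubar)))"
proof -
  have N: "smooth_submanifold n N" "connected N" "closed N" and complete: "geodesically_complete N" and ab: "a < b"
    by fact+
  have u0: "bvN N {a<..<b} u0" using \<open>u0 \<in> BV_rad N I\<close> by (simp add: BV_rad_def I_def)
  have fin: "TV N I u0 < \<infinity>" unfolding I_def by (rule TV_finite[OF N ab u0])
  define C where "C = enn2real (TV N I u0)"
  have C: "TV N I u0 = ennreal C" "0 \<le> C" using fin by (auto simp: C_def less_top)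
  \<comment> \<open>strictly above the dissipation bound, so that a good time lies in between\<close>
  define Tstar where "Tstar = 4 * (b - a) * C + 1"
  have Ts: "0 < Tstar" "0 \<le> 4 * (b - a) * C" "4 * (b - a) * C < Tstar" using ab C by (auto simp: Tstar_def add_nonneg_pos)
  show ?thesis
  proof (intro exI[of _ Tstar] conjI allI impI)
    show "0 \<le> Tstar" using Ts by simp
    fix T :: ereal and u :: "real \<Rightarrow> real \<Rightarrow> 'a"
    assume asm: "ereal Tstar < T \<and> strong_solution N a b T u \<and> (AE x in leb I. u 0 x = u0 x) \<and>
       (AE t in leb (time_int T).
          TV N I (u t) +
            (\<integral>\<^sup>+ \<tau>. \<integral>\<^sup>+ x. ennreal ((norm (weak_dt I T u \<tau> x))\<^sup>2) \<partial>leb I \<partial>leb {0<..<t})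
          \<le> TV N I u0) \<and>
       (AE s in leb (time_int T). AE t in leb (time_int T). s \<le> t \<longrightarrow>
          (\<forall>A\<in>sets (leb I). varN N I (u t) A \<le> varN N I (u s) A \<and> varN N I (u s) A \<le> varN N I u0 A))"
    define v where "v = weak_dt I T u"
    have TT: "ereal Tstar < T" and H1: "H1_loc N I T u" and LB: "Linf_loc_BV N I T u"
      and inj: "AE t in leb (time_int T). \<forall>x\<in>I. ereal (geo_dist N (lft I (u t) x) (rgt I (u t) x)) < inj_radius N"
      and energy: "AE t in leb (time_int T). TV N I (u t) +
            (\<integral>\<^sup>+ \<tau>. \<integral>\<^sup>+ x. ennreal ((norm (v \<tau> x))\<^sup>2) \<partial>leb I \<partial>leb {0<..<t}) \<le> TV N I u0"
      and mono: "AE s in leb (time_int T). AE t in leb (time_int T). s \<le> t \<longrightarrow>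
          (\<forall>A\<in>sets (leb I). varN N I (u t) A \<le> varN N I (u s) A \<and> varN N I (u s) A \<le> varN N I u0 A)"
      using asm unfolding strong_solution_def Let_def I_def[symmetric] v_def by blast+
    obtain z where zBV: "L2_loc_wstar_BV I T z"
      and strong: "AE t in leb (time_int T). strong_conditions N a b (u t) (v t) (z t)"
      using asm unfolding strong_solution_def Let_def I_def[symmetric] v_def by blast
    have "\<exists>v. has_weak_dt I T u v" using H1 unfolding H1_loc_def by blast
    then have dt: "has_weak_dt I T u v"
      unfolding v_def weak_dt_def by (rule someI_ex)
    have tm: "time_int T \<in> sets borel"
    proof -
      have "open (time_int T)"
        unfolding time_int_def by (intro open_Collect_conj open_Collect_less continuous_intros)
      then show ?thesis by (rule borel_open)
    qed
    have sub: "{0<..<\<tau>} \<subseteq> time_int T" if "ereal \<tau> \<le> T" for \<tau>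
    proof
      fix t assume t: "t \<in> {0<..<\<tau>}"
      then have "ereal t < ereal \<tau>" by simp
      then have "ereal t < T" using that by (rule less_le_trans)
      then show "t \<in> time_int T" using t by (simp add: time_int_def)
    qed
    have restr: "AE t in leb {0<..<\<tau>}. P t" if "AE t in leb (time_int T). P t" "ereal \<tau> \<le> T" for P \<tau>
      by (rule AE_leb_subset[OF that(1) sub[OF that(2)]]) (use tm in auto)
    define good where "good t \<longleftrightarrow> bvN N I (u t) \<and> bv I (z t) \<and> integrable (leb I) (v t) \<and>
      (\<forall>x\<in>I. ereal (geo_dist N (lft I (u t) x) (rgt I (u t) x)) < inj_radius N) \<and>
      strong_conditions N a b (u t) (v t) (z t)" for t
    have good: "AE t in leb {0<..<\<tau>}. good t" if \<tau>: "\<tau> \<in> time_int T" for \<tau>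
    proof -
      have le: "ereal \<tau> \<le> T" using \<tau> by (auto simp: time_int_def intro: less_imp_le)
      obtain K :: real where "AE t in leb {0<..<\<tau>}. bvN N I (u t) \<and> bv_norm I (u t) \<le> ennreal K"
        using LB \<tau> unfolding Linf_loc_BV_def by blast
      moreover have "AE t in leb {0<..<\<tau>}. bv I (z t)" using zBV \<tau> unfolding L2_loc_wstar_BV_def by blast
      moreover have "AE t in leb {0<..<\<tau>}. integrable (leb I) (v t)"
      proof -
        interpret A: finite_measure "leb {0<..<\<tau>}" by (rule finite_measure_leb_interval)
        interpret B: finite_measure "leb I" unfolding I_def by (rule finite_measure_leb_interval)
        interpret P: pair_sigma_finite "leb {0<..<\<tau>}" "leb I" ..
        have "L2_cyl I \<tau> v" using dt \<tau> unfolding has_weak_dt_def by blast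
        then have "integrable (leb {0<..<\<tau>} \<Otimes>\<^sub>M leb I) (\<lambda>(t, x). v t x)"
          unfolding I_def by (rule L2_cyl_integrable)
        from P.AE_integrable_fst'[OF this] show ?thesis by simp
      qed
      moreover note restr[OF inj le] restr[OF strong le]
      ultimately show ?thesis by eventually_elim (simp add: good_def)
    qed
    have rate: "ennreal (1 / (4 * (b - a))) \<le> (\<integral>\<^sup>+ x. ennreal ((norm (v t x))\<^sup>2) \<partial>leb I)"
      if g: "good t" and nz: "emeasure (tv_meas I (u t)) I \<noteq> 0" for t
      unfolding I_def
    proof (rule L2_lower_bound_if_L1_ge_1[OF ab])
      show "v t \<in> borel_measurable (leb {a<..<b})" using g unfolding good_def I_def by auto
      show "1 \<le> (\<integral>\<^sup>+ x. ennreal (2 * norm (v t x)) \<partial>leb {a<..<b})"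
        by (rule velocity_L1_ge_1[OF N complete ab, of "u t" "z t"]) (use g nz in \<open>auto simp: good_def I_def\<close>)
    qed
    have TsT: "Tstar \<in> time_int T" using TT Ts by (simp add: time_int_def)
    \<comment> \<open>if the solution were nonconstant at almost all times before \<open>Tstar\<close>, more energy
      would be dissipated than is available\<close>
    have "\<exists>s. 0 < s \<and> s < Tstar \<and> good s \<and> emeasure (tv_meas I (u s)) I = 0 \<and>
      (AE t in leb (time_int T). s \<le> t \<longrightarrow>
          (\<forall>A\<in>sets (leb I). varN N I (u t) A \<le> varN N I (u s) A \<and> varN N I (u s) A \<le> varN N I u0 A))"
    proof (rule ccontr)
      assume no: "\<not> ?thesis"
      have low: "AE s in leb {0<..<Tstar}. ennreal (1 / (4 * (b - a))) \<le> (\<integral>\<^sup>+ x. ennreal ((norm (v s x))\<^sup>2) \<partial>leb I)"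
        using good[OF TsT] restr[OF mono less_imp_le[OF TT]] AE_space
      proof eventually_elim
        case (elim s)
        then have "0 < s" "s < Tstar" by (auto simp: space_restrict_space)
        then have "emeasure (tv_meas I (u s)) I \<noteq> 0" using no elim by blast
        then show ?case using rate elim(1) by blast
      qed
      obtain t where t: "4 * (b - a) * C < t" "t < Tstar" and en: "TV N I (u t) +
            (\<integral>\<^sup>+ \<tau>. \<integral>\<^sup>+ x. ennreal ((norm (v \<tau> x))\<^sup>2) \<partial>leb I \<partial>leb {0<..<t}) \<le> TV N I u0"
        using exists_time_if_AE[OF restr[OF energy less_imp_le[OF TT]] Ts(2,3)] by blast
      have "ennreal (1 / (4 * (b - a)) * t) = (\<integral>\<^sup>+ \<tau>. ennreal (1 / (4 * (b - a))) \<partial>leb {0<..<t})"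
      proof -
        have "(\<integral>\<^sup>+ \<tau>. ennreal (1 / (4 * (b - a))) \<partial>leb {0<..<t}) = ennreal (1 / (4 * (b - a))) * ennreal t"
          using t Ts(2) by (simp add: emeasure_restrict_space space_restrict_space)
        moreover have "ennreal (1 / (4 * (b - a)) * t) = ennreal (1 / (4 * (b - a))) * ennreal t"
          by (rule ennreal_mult) (use t Ts(2) ab in auto)
        ultimately show ?thesis by (simp only:)
      qed
      also have "\<dots> \<le> (\<integral>\<^sup>+ \<tau>. \<integral>\<^sup>+ x. ennreal ((norm (v \<tau> x))\<^sup>2) \<partial>leb I \<partial>leb {0<..<t})"
        by (rule nn_integral_mono_AE, rule AE_leb_subset[OF low]) (use t in auto)
      also have "\<dots> \<le> TV N I (u t) + (\<integral>\<^sup>+ \<tau>. \<integral>\<^sup>+ x. ennreal ((norm (v \<tau> x))\<^sup>2) \<partial>leb I \<partial>leb {0<..<t})"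
        by simp
      also have "\<dots> \<le> ennreal C" using en C by simp
      finally have "1 / (4 * (b - a)) * t \<le> C" using C by simp
      then show False using t ab by (simp add: field_simps)
    qed
    then obtain s where s: "0 < s" "s < Tstar" and gs: "good s" and zs: "emeasure (tv_meas I (u s)) I = 0"
      and ms: "AE t in leb (time_int T). s \<le> t \<longrightarrow>
          (\<forall>A\<in>sets (leb I). varN N I (u t) A \<le> varN N I (u s) A \<and> varN N I (u s) A \<le> varN N I u0 A)"
      by blast
    have IS: "I \<in> sets (leb I)" by (simp add: I_def sets_restrict_space_iff)
    \<comment> \<open>after \<open>s\<close> the solution is constant in space and in time\<close>
    have stuck: "\<exists>c. \<forall>t. s < t \<and> t \<le> T' \<longrightarrow> (AE x in leb I. u t x = c)" if T': "T' \<in> time_int T" "s < T'" for T'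
    proof -
      have le: "ereal T' \<le> T" using T' by (auto simp: time_int_def intro: less_imp_le)
      have ssub: "{s<..<T'} \<subseteq> {0<..<T'}" using s by auto
      have "AE t in leb {0<..<T'}. t > s \<longrightarrow> good t \<and> emeasure (tv_meas I (u t)) I = 0"
        using good[OF T'(1)] restr[OF ms le]
      proof eventually_elim
        case (elim t)
        show ?case
        proof (intro impI conjI)
          assume "s < t"
          then have "varN N I (u t) I \<le> varN N I (u s) I" using elim(2) IS by auto
          also have "\<dots> = 0" using varN_zero_iff_tv_zero[OF N ab, of "u s"] gs zs by (simp add: good_def I_def)
          finally show "emeasure (tv_meas I (u t)) I = 0"
            using varN_zero_iff_tv_zero[OF N ab, of "u t"] elim(1) by (simp add: good_def I_def)
        qed (use elim in simp)
      qed
      then have "AE t in leb {s<..<T'}. t > s \<longrightarrow> good t \<and> emeasure (tv_meas I (u t)) I = 0"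
        by (rule AE_leb_subset[OF _ ssub]) auto
      then have after: "AE t in leb {s<..<T'}. good t \<and> emeasure (tv_meas I (u t)) I = 0"
        using AE_space by eventually_elim (auto simp: space_restrict_space)
      have "AE t in leb {s<..<T'}. (LINT x|leb I. v t x) = 0"
        using after
      proof eventually_elim
        case (elim t)
        then show ?case unfolding I_def
          by (intro velocity_mean_zero_if_const[OF N(1,3) ab, of "u t" "z t"]) (auto simp: good_def I_def)
      qed
      moreover have "L2_cyl I T' u" using H1 T' unfolding H1_loc_def by blast
      ultimately obtain m where m: "AE t in leb {s<..<T'}. (LINT x|leb I. u t x) = m"
        using mean_const_if_weak_dt_mean_zero[OF T'(1) _ T'(2), of a b u v] s dt unfolding I_def by auto
      have "AE t in leb {s<..<T'}. AE x in leb I. u t x = m /\<^sub>R (b - a)"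
        using after m
      proof eventually_elim
        case (elim t)
        then have bvt: "bv {a<..<b} (u t)" by (simp add: good_def bvN_def I_def)
        have tvt: "emeasure (tv_meas {a<..<b} (u t)) {a<..<b} = 0" using elim by (simp add: I_def)
        define c where "c = rgt {a<..<b} (u t) a"
        have c: "AE x in leb I. u t x = c"
          using bv_const_if_tv_zero(3)[OF ab bvt tvt] unfolding c_def I_def .
        have ut: "u t \<in> borel_measurable (leb I)" using bvt unfolding bv_def I_def by auto
        have "m = (LINT x|leb I. c)" unfolding elim(2)[symmetric]
          by (rule integral_cong_AE) (use c ut in auto)
        also have "\<dots> = (b - a) *\<^sub>R c"
          using ab by (simp add: I_def measure_restrict_space space_restrict_space)
        finally show ?case using c ab by simp
      qed
      then show ?thesis
        using constant_at_all_times_if_AE[of N a b T u T' s] H1 T'(1) s(1) unfolding I_def by (metis less_imp_le)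
    qed
    have uniq: "c = c'" if "AE x in leb I. f x = c" "AE x in leb I. f x = c'" for f :: "real \<Rightarrow> 'a" and c c'
    proof -
      have "AE x in leb {a<..<b}. c = c'" using that unfolding I_def by eventually_elim simp
      from frequently_ex[OF frequently_at_left_if_AE[OF this ab order_refl]] show ?thesis by blast
    qed
    obtain c where c: "AE x in leb I. u Tstar x = c"
      using stuck[OF TsT s(2)] s(2) by blast
    show "\<exists>ubar\<in>N. \<forall>t. Tstar \<le> t \<and> ereal t < T \<longrightarrow> (AE x in leb I. u t x = ubar)"
    proof (intro bexI[of _ c] allI impI)
      fix t assume t: "Tstar \<le> t \<and> ereal t < T"
      then have "t \<in> time_int T" "s < t" using Ts s by (auto simp: time_int_def)
      from stuck[OF this] obtain c' where c': "\<forall>r. s < r \<and> r \<le> t \<longrightarrow> (AE x in leb I. u r x = c')" by blast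
      have "AE x in leb I. u Tstar x = c'" using c' t s(2) by blast
      then have "c' = c" using c by (rule uniq)
      then show "AE x in leb I. u t x = c" using c' \<open>s < t\<close> by blast
    next
      have "u Tstar \<in> L2N N I" using H1 TT Ts unfolding H1_loc_def by auto
      then have "AE x in leb {a<..<b}. u Tstar x \<in> N" unfolding L2N_def I_def by blast
      then have "AE x in leb {a<..<b}. c \<in> N" using c unfolding I_def by eventually_elim simp
      from frequently_ex[OF frequently_at_left_if_AE[OF this ab order_refl]] show "c \<in> N" by blast
    qed
  qed
qed

end
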